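(* Let $X=\mathbb R^d$ and let $m$ be a measure on $X\times\mathbb R_+$ of the form $dm(x,s)=\frac{l(x,s)}{s}\,dx\,ds$ with $l(x,s)>0$ for all $x\in X$ and $s\in\mathbb R_+$, such that $\int_{A\times\mathbb R_+}l(x,s)\min\{s^{-1},1\}\,dx\,ds<\infty$ for all $A\in\mathcal B_0(X)$. Let $\mu_m$ be the corresponding completely random measure. Then $\mu_m$ is quasi-invariant with respect to the action of $\operatorname{Diff}_0(X)$ if and only if, for each $\varphi\in\operatorname{Diff}_0(X)$, $$\int_{X\times\mathbb R_+}\left(\sqrt{\frac{l(\varphi^{-1}(x),s)}{l(x,s)}J_\varphi(x)}-1\right)^2\frac{l(x,s)}{s}\,dx\,ds=\int_{X\times\mathbb R_+}\left(\sqrt{l(\varphi^{-1}(x),s)J_\varphi(x)}-\sqrt{l(x,s)}\right)^2\frac1s\,dx\,ds<\infty.$$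
   Context: $\mathbb R_+=(0,\infty)$; $l:X\times\mathbb R_+\to\mathbb R_+$ is measurable; $dx$ is Lebesgue measure. $\mathcal B_0(X)$ is the collection of Borel subsets of $X$ with compact closure. $\mathbb M(X)$ is the set of Radon measures on $X$ (finite on compact sets) with the vague topology and its Borel $\sigma$-algebra. $\mathbb K(X)\subset\mathbb M(X)$ is the set of discrete Radon measures $\eta=\sum_i s_i\delta_{x_i}$ with $s_i>0$, the $x_i\in X$ distinct and at most countably many (the zero measure included), with the trace $\sigma$-algebra. $\mu_m$ denotes the unique probability measure on $\mathbb K(X)$ with Fourier transform $\int_{\mathbb K(X)}e^{i\int f\,d\eta}\,d\mu_m(\eta)=\exp\left[\int_X\int_{\mathbb R_+}(e^{isf(x)}-1)\,dm(x,s)\right]$ for all continuous compactly supported $f:X\to\mathbb R$. $\operatorname{Diff}_0(X)$ is the group (under composition) of $C^\infty$ diffeomorphisms of $X$ that equal the identity outside a compact set. It acts on $\mathbb K(X)$ by pushforward: $\varphi^*\eta=\sum_i s_i\delta_{\varphi(x_i)}$ for $\eta=\sum_i s_i\delta_{x_i}$. $\mu_m$ is quasi-invariant with respect to $\operatorname{Diff}_0(X)$ if for each $\varphi$ the pushforward $\mu_m^\varphi$ of $\mu_m$ under $\eta\mapsto\varphi^*\eta$ is equivalent to $\mu_m$. For $\varphi\in\operatorname{Diff}_0(X)$, $J_\varphi(x)$ is the density at $x$ of the pushforward of Lebesgue measure under $\varphi$ with respect to Lebesgue measure, i.e. $J_\varphi(x)=|\det D(\varphi^{-1})(x)|$. 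*)

theory Defs
  imports "HOL-Probability.Probability"
begin

section \<open>Radon measures and the vague topology\<close>

definition C_c :: "('a::topological_space \<Rightarrow> real) set" where
  "C_c = {f. continuous_on UNIV f \<and> compact (closure {x. f x \<noteq> 0})}"

definition radon_measures :: "'a::topological_space measure set" where
  "radon_measures = {\<eta>. sets \<eta> = sets borel \<and> (\<forall>K. compact K \<longrightarrow> emeasure \<eta> K < \<infinity>)}"

text \<open>
  The vague topology is the coarsest topology on the Radon measures that makes
  \<open>\<eta> \<mapsto> \<integral>f d\<eta>\<close> continuous for every \<open>f\<close> in \<^const>\<open>C_c\<close>.
\<close>

definition vague_topology :: "'a::topological_space measure topology" where
  "vague_topology = topology_generated_by
     {{\<eta> \<in> radon_measures. (\<integral>x. f x \<partial>\<eta>) \<in> U} | f U. f \<in> C_c \<and> open U}"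

definition radon_space :: "'a::topological_space measure measure" where
  "radon_space = sigma radon_measures {U. openin vague_topology U}"

section \<open>Discrete Radon measures\<close>

text \<open>
  The atoms are indexed by their positions, so they are automatically distinct;
  \<^term>\<open>S = {}\<close> gives the zero measure.
\<close>

definition discrete_radon_measures :: "'a::topological_space measure set" where
  "discrete_radon_measures = {\<eta> \<in> radon_measures.
     \<exists>S s. countable S \<and> (\<forall>x\<in>S. (s x :: real) > 0) \<and>
       (\<forall>A\<in>sets borel. emeasure \<eta> A =
          (\<Sum>\<^sub>\<infinity>x\<in>S. ennreal (s x) * emeasure (return borel x) A))}"

definition discrete_radon_space :: "'a::topological_space measure measure" where
  "discrete_radon_space = restrict_space radon_space discrete_radon_measures"

section \<open>Completely random measures\<close>

text \<open>Lebesgue measure \<open>dx ds\<close> on \<open>X \<times> (0,\<infinity>)\<close>, with its Borel sets.\<close>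

definition lborel_marked :: "('a::euclidean_space \<times> real) measure" where
  "lborel_marked = lborel \<Otimes>\<^sub>M restrict_space lborel {0<..}"

definition intensity :: "('a::euclidean_space \<Rightarrow> real \<Rightarrow> real) \<Rightarrow> ('a \<times> real) measure" where
  "intensity l = density lborel_marked (\<lambda>(x, s). ennreal (l x s / s))"

text \<open>
  \<open>completely_random_measure m \<mu>\<close>: \<open>\<mu>\<close> is the probability measure on the discrete
  Radon measures whose Fourier transform is the one prescribed by \<open>m\<close>.
\<close>

definition completely_random_measure ::
  "('a::topological_space \<times> real) measure \<Rightarrow> 'a measure measure \<Rightarrow> bool" where
  "completely_random_measure m \<mu> \<longleftrightarrow>
     prob_space \<mu> \<and>
     sets \<mu> = sets discrete_radon_space \<and>
     (\<forall>f\<in>C_c. (\<integral>\<eta>. exp (\<i> * complex_of_real (\<integral>x. f x \<partial>\<eta>)) \<partial>\<mu>) =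
        exp (\<integral>(x, s). (exp (\<i> * complex_of_real (s * f x)) - 1) \<partial>m))"

section \<open>Compactly supported diffeomorphisms\<close>

text \<open>
  Differentiability of order \<open>k\<close> on the whole space: continuity for \<open>k = 0\<close>, and
  otherwise (Frechet) differentiability with all directional derivatives of
  order \<open>k - 1\<close>. In finite dimension this is the usual \<open>C\<^sup>k\<close>.
\<close>

primrec C_k :: "nat \<Rightarrow> ('a::euclidean_space \<Rightarrow> 'b::euclidean_space) \<Rightarrow> bool" where
  "C_k 0 f \<longleftrightarrow> continuous_on UNIV f"
| "C_k (Suc k) f \<longleftrightarrow>
     (\<forall>x. f differentiable at x) \<and> (\<forall>v. C_k k (\<lambda>x. frechet_derivative f (at x) v))"

definition C_infinity :: "('a::euclidean_space \<Rightarrow> 'b::euclidean_space) \<Rightarrow> bool" where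
  "C_infinity f \<longleftrightarrow> (\<forall>k. C_k k f)"

definition Diff0 :: "('a::euclidean_space \<Rightarrow> 'a) set" where
  "Diff0 = {\<phi>. bij \<phi> \<and> C_infinity \<phi> \<and> C_infinity (inv \<phi>) \<and>
     (\<exists>K. compact K \<and> (\<forall>x. x \<notin> K \<longrightarrow> \<phi> x = x))}"

definition Jac :: "(real^'n \<Rightarrow> real^'n) \<Rightarrow> real^'n \<Rightarrow> real" where
  "Jac \<phi> x = \<bar>det (matrix (frechet_derivative (inv \<phi>) (at x)))\<bar>"

section \<open>Quasi-invariance\<close>

definition act :: "('a::topological_space \<Rightarrow> 'a) \<Rightarrow> 'a measure \<Rightarrow> 'a measure" where
  "act \<phi> \<eta> = distr \<eta> borel \<phi>"

definition equivalent_measures :: "'a measure \<Rightarrow> 'a measure \<Rightarrow> bool" where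
  "equivalent_measures M N \<longleftrightarrow>
     sets M = sets N \<and> absolutely_continuous M N \<and> absolutely_continuous N M"

definition quasi_invariant :: "'a::euclidean_space measure measure \<Rightarrow> bool" where
  "quasi_invariant \<mu> \<longleftrightarrow>
     (\<forall>\<phi>\<in>Diff0. equivalent_measures (distr \<mu> discrete_radon_space (act \<phi>)) \<mu>)"

end

theory Submission
  imports Defs
begin

text \<open>
  The completely random measure with intensity \<open>m\<close> is the law of \<open>\<Sum> s \<delta>\<^sub>x\<close>, where \<open>(x, s)\<close> runs through
  a Poisson cloud of intensity \<open>m\<close> (\<open>crm_cloud\<close>), and its Fourier transform determines it
  (\<open>fourier_transform_determines\<close>). A diffeomorphism \<open>\<phi>\<close> moves the points of the cloud and leaves their
  weights alone, so the pushforward of \<open>\<mu>\<close> is again a completely random measure (\<open>crm_moved\<close>). By the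
  change of variables formula (\<open>distr_intensity\<close>) its intensity is \<open>\<rho> m\<close> with
  \<open>\<rho> (x, s) = l (\<phi>\<^sup>-\<^sup>1 x) s / l x s \<cdot> J x\<close>. The question is therefore when the completely random measure
  of intensity \<open>\<rho> m\<close> is absolutely continuous with respect to that of intensity \<open>m\<close>, and the answer is
  Kakutani's: if and only if the Hellinger integral \<open>\<integral>(sqrt \<rho> - 1)\<^sup>2 dm\<close> is finite.

  To see this, cut the space of pairs \<open>(x, s)\<close> into pieces on which \<open>m\<close> and \<open>\<rho> m\<close> are both finite. On the first
  \<open>n\<close> pieces the two Poisson clouds have an explicit likelihood ratio \<open>L n\<close>, the product of \<open>\<rho>\<close> over the
  points times a normalising constant, and the expectation of \<open>sqrt (L n) \<cdot> sqrt (L p)\<close> is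
  \<open>exp (- E / 2)\<close>, where \<open>E\<close> is the Hellinger integral over the pieces from \<open>n\<close> to \<open>p\<close>.

  If the Hellinger integral is finite, the \<open>sqrt (L n)\<close> form a Cauchy sequence in \<open>L\<^sup>2\<close>, so the \<open>L n\<close>
  converge in \<open>L\<^sup>1\<close> to a density. The cloud reweighted by this density has the Fourier transform of the
  measure with intensity \<open>\<rho> m\<close> (\<open>crm_density\<close>), and absolute continuity follows
  (\<open>crm_absolutely_continuous\<close>).

  If it is infinite, consider \<open>sqrt (L n)\<close> as a function of the discrete measure alone: a product over
  its atoms. Its expectation under the first law and that of its inverse under the second are at most
  \<open>exp (- E / 2)\<close>, where \<open>E\<close> is now the Hellinger integral over the first \<open>n\<close> pieces and can be made
  arbitrarily large. Markov's inequality gives events that are unlikely under the first law and likely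
  under the second (\<open>separating_event\<close>), and by the Borel-Cantelli lemma the two laws are mutually singular
  (\<open>crm_absolutely_continuous_imp_hellinger_finite\<close>).

  Only one direction of the equivalence of \<open>\<mu>\<close> and its pushforward has to be treated, since the inverse of
  \<open>\<phi>\<close> gives the other one. The two forms of the integral in the statement agree pointwise, because \<open>l\<close> is
  positive (\<open>hellinger_symmetric_form\<close>).
\<close>

section \<open>The Borel sets of the vague topology\<close>

lemma C_cI:
  fixes f :: "'a::euclidean_space \<Rightarrow> real"
  assumes "continuous_on UNIV f" "\<And>x. f x \<noteq> 0 \<Longrightarrow> norm x \<le> R"
  shows "f \<in> C_c"
proof -
  have "closure {x. f x \<noteq> 0} \<subseteq> cball 0 R"
    by (rule closure_minimal) (use assms(2) in auto)
  then have "compact (closure {x. f x \<noteq> 0})"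
    by (metis bounded_cball bounded_subset closed_closure compact_eq_bounded_closed)
  with assms(1) show ?thesis by (simp add: C_c_def)
qed

lemma C_cE:
  fixes f :: "'a::euclidean_space \<Rightarrow> real"
  assumes "f \<in> C_c"
  obtains R B where "continuous_on UNIV f" "R > 0" "B > 0"
    "\<And>x. f x \<noteq> 0 \<Longrightarrow> norm x \<le> R" "\<And>x. \<bar>f x\<bar> \<le> B"
proof -
  have cont: "continuous_on UNIV f" and K: "compact (closure {x. f x \<noteq> 0})"
    using assms by (auto simp: C_c_def)
  obtain R where R: "R > 0" "\<And>x. x \<in> closure {x. f x \<noteq> 0} \<Longrightarrow> norm x \<le> R"
    using compact_imp_bounded[OF K] by (auto simp: bounded_pos)
  have "compact (f ` closure {x. f x \<noteq> 0})"
    by (rule compact_continuous_image) (use cont K continuous_on_subset in blast)+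
  then obtain B where B: "B > 0" "\<And>x. x \<in> closure {x. f x \<noteq> 0} \<Longrightarrow> norm (f x) \<le> B"
    using compact_imp_bounded by (force simp: bounded_pos)
  have "\<bar>f x\<bar> \<le> B" for x
    using B(1) B(2)[of x] closure_subset[of "{x. f x \<noteq> 0}"] by (cases "f x = 0") auto
  moreover have "norm x \<le> R" if "f x \<noteq> 0" for x
    using R(2)[of x] closure_subset[of "{x. f x \<noteq> 0}"] that by auto
  ultimately show thesis using that cont R(1) B(1) by blast
qed

lemma C_c_add:
  fixes f g :: "'a::euclidean_space \<Rightarrow> real"
  assumes "f \<in> C_c" "g \<in> C_c" shows "(\<lambda>x. f x + t * g x) \<in> C_c"
proof -
  obtain R B where f: "continuous_on UNIV f" "R > 0" "\<And>x. f x \<noteq> 0 \<Longrightarrow> norm x \<le> R"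
    using C_cE[OF assms(1)] by metis
  obtain R' B where g: "continuous_on UNIV g" "R' > 0" "\<And>x. g x \<noteq> 0 \<Longrightarrow> norm x \<le> R'"
    using C_cE[OF assms(2)] by metis
  show ?thesis
  proof (rule C_cI[of _ "max R R'"])
    show "norm x \<le> max R R'" if "f x + t * g x \<noteq> 0" for x
      using that f(3)[of x] g(3)[of x] by (cases "f x = 0") auto
  qed (intro continuous_intros f g)
qed

lemma C_c_zero: "(\<lambda>x. 0) \<in> (C_c :: ('a::euclidean_space \<Rightarrow> real) set)"
  by (rule C_cI[of _ 0]) auto

lemma C_c_diff:
  fixes f g :: "'a::euclidean_space \<Rightarrow> real"
  assumes "f \<in> C_c" "g \<in> C_c" shows "(\<lambda>x. f x - g x) \<in> C_c"
  using C_c_add[OF assms, of "-1"] by simp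

lemma C_c_max:
  fixes f g :: "'a::euclidean_space \<Rightarrow> real"
  assumes "f \<in> C_c" "g \<in> C_c" shows "(\<lambda>x. max (f x) (g x)) \<in> C_c"
proof -
  obtain R B where f: "continuous_on UNIV f" "R > 0" "\<And>x. f x \<noteq> 0 \<Longrightarrow> norm x \<le> R"
    using C_cE[OF assms(1)] by metis
  obtain R' B where g: "continuous_on UNIV g" "R' > 0" "\<And>x. g x \<noteq> 0 \<Longrightarrow> norm x \<le> R'"
    using C_cE[OF assms(2)] by metis
  show ?thesis
  proof (rule C_cI[of _ "max R R'"])
    show "norm x \<le> max R R'" if "max (f x) (g x) \<noteq> 0" for x
      using that f(3)[of x] g(3)[of x] by (auto simp: max_def split: if_splits)
  qed (intro continuous_intros f g)
qed

lemma C_c_uminus: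
  fixes f :: "'a::euclidean_space \<Rightarrow> real"
  assumes "f \<in> C_c" shows "(\<lambda>x. - f x) \<in> C_c"
  using C_c_diff[OF C_c_zero assms] by simp

lemma borel_measurable_C_c:
  fixes f :: "'a::euclidean_space \<Rightarrow> real"
  assumes "f \<in> C_c" shows "f \<in> borel_measurable borel"
  using assms by (auto simp: C_c_def intro: borel_measurable_continuous_onI)

lemma sets_radon: "\<eta> \<in> radon_measures \<Longrightarrow> sets \<eta> = sets borel"
  by (simp add: radon_measures_def)

lemma integrable_radon_C_c:
  fixes f :: "'a::euclidean_space \<Rightarrow> real"
  assumes "\<eta> \<in> radon_measures" "f \<in> C_c"
  shows "integrable \<eta> f"
proof -
  obtain R B where f: "R > 0" "B > 0" "\<And>x. f x \<noteq> 0 \<Longrightarrow> norm x \<le> R" "\<And>x. \<bar>f x\<bar> \<le> B"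
    using C_cE[OF assms(2)] by metis
  have sets: "sets \<eta> = sets borel" by (rule sets_radon[OF assms(1)])
  have meas: "f \<in> borel_measurable \<eta>"
    using borel_measurable_C_c[OF assms(2)] by (simp add: measurable_cong_sets[OF sets refl])
  show ?thesis
  proof (rule integrableI_bounded_set[of "cball 0 R" _ _ B])
    show "emeasure \<eta> (cball 0 R) < \<infinity>"
      using assms(1) by (auto simp: radon_measures_def)
    show "cball 0 R \<in> sets \<eta>" by (simp add: sets)
    show "f \<in> borel_measurable \<eta>" by (rule meas)
    show "AE x\<in>cball 0 R in \<eta>. norm (f x) \<le> B" using f(4) by auto
    show "AE x in \<eta>. x \<notin> cball 0 R \<longrightarrow> f x = 0"
      using f(3) by (intro AE_I2) force
  qed
qed

text \<open>
  Finite maxima of tents with rational data form a countable family that approximates every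
  nonnegative function in \<^const>\<open>C_c\<close> from below. Semicontinuity from below is enough to describe
  the vague topology by countably many sets, since \<open>f\<close> is also a large tent minus a nonnegative
  function.
\<close>

definition tent :: "rat \<times> rat \<times> 'a \<Rightarrow> 'a::euclidean_space \<Rightarrow> real" where
  "tent = (\<lambda>(p, r, c) x. max 0 (real_of_rat p - real_of_rat r * dist x c))"

primrec max_tents :: "(rat \<times> rat \<times> 'a) list \<Rightarrow> 'a::euclidean_space \<Rightarrow> real" where
  "max_tents [] x = 0"
| "max_tents (t # ts) x = max (tent t x) (max_tents ts x)"

definition dense_points :: "'a::euclidean_space set" where
  "dense_points = (SOME D. countable D \<and> (\<forall>S. open S \<longrightarrow> S \<noteq> {} \<longrightarrow> (\<exists>d\<in>D. d \<in> S)))"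

lemma dense_points:
  "countable (dense_points :: 'a::euclidean_space set)"
  "open (S :: 'a set) \<Longrightarrow> S \<noteq> {} \<Longrightarrow> \<exists>d\<in>dense_points. d \<in> S"
proof -
  have "\<exists>D :: 'a set. countable D \<and> (\<forall>S. open S \<longrightarrow> S \<noteq> {} \<longrightarrow> (\<exists>d\<in>D. d \<in> S))"
    using countable_dense_setE[where 'a='a] by metis
  from someI_ex[OF this]
  show "countable (dense_points :: 'a::euclidean_space set)"
    "open (S :: 'a set) \<Longrightarrow> S \<noteq> {} \<Longrightarrow> \<exists>d\<in>dense_points. d \<in> S"
    unfolding dense_points_def by blast+
qed

definition tent_data :: "(rat \<times> rat \<times> 'a::euclidean_space) set" where
  "tent_data = UNIV \<times> {0<..} \<times> dense_points"

definition tent_family :: "('a::euclidean_space \<Rightarrow> real) set" where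
  "tent_family = max_tents ` lists tent_data"

lemma countable_tent_family: "countable (tent_family :: ('a::euclidean_space \<Rightarrow> real) set)"
  unfolding tent_family_def tent_data_def
  by (intro countable_image countable_lists countable_SIGMA) (auto simp: dense_points)

lemma tent_C_c:
  assumes "t \<in> tent_data" shows "tent t \<in> C_c"
proof -
  obtain p r c where t: "t = (p, r, c)" "r > 0"
    using assms by (auto simp: tent_data_def)
  show ?thesis
  proof (rule C_cI[of _ "real_of_rat p / real_of_rat r + norm c"])
    fix x assume "tent t x \<noteq> 0"
    then have "real_of_rat r * dist x c \<le> real_of_rat p"
      by (auto simp: tent_def t)
    then have "dist x c \<le> real_of_rat p / real_of_rat r"
      using t(2) by (simp add: field_simps)
    moreover have "norm x \<le> norm c + dist x c"
      by (metis dist_norm norm_triangle_sub)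
    ultimately show "norm x \<le> real_of_rat p / real_of_rat r + norm c" by linarith
  qed (auto simp: tent_def t intro!: continuous_intros)
qed

lemma tent_family_C_c:
  assumes "g \<in> tent_family" shows "g \<in> C_c"
proof -
  have "max_tents ts \<in> C_c" if "ts \<in> lists tent_data" for ts :: "(rat \<times> rat \<times> 'a) list"
    using that
  proof (induction ts)
    case Nil
    then show ?case using C_c_zero by (simp add: max_tents.simps(1)[abs_def])
  next
    case (Cons t ts)
    then show ?case
      using C_c_max[OF tent_C_c, of t "max_tents ts"] by (simp add: max_tents.simps(2)[abs_def])
  qed
  then show ?thesis using assms by (auto simp: tent_family_def)
qed

text \<open>
  By continuity \<open>f\<close> stays above a rational number just below \<open>f x\<close> on a ball around \<open>x\<close>, and a tent of
  this height vanishes outside the ball if it is steep enough. Moving its centre to a dense point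
  lowers the value at \<open>x\<close> by at most \<open>e / 2\<close>.
\<close>

lemma tent_below_near:
  fixes f :: "'a::euclidean_space \<Rightarrow> real"
  assumes "continuous_on UNIV f" "\<And>x. 0 \<le> f x" "f x > 0" "e > 0"
  obtains t where "t \<in> tent_data" "\<And>y. tent t y \<le> f y" "tent t x > f x - e"
proof -
  obtain p :: rat where p: "max 0 (f x - e/2) < real_of_rat p" "real_of_rat p < f x"
    using of_rat_dense[of "max 0 (f x - e/2)" "f x"] assms by auto
  have "open (f -` {real_of_rat p<..})"
    using assms(1) by (intro open_vimage) auto
  then obtain d where d: "d > 0" "\<And>y. dist y x < d \<Longrightarrow> real_of_rat p < f y"
    using p(2) unfolding open_dist by force
  obtain r :: rat where r: "2 * real_of_rat p / d < real_of_rat r"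
    using of_rat_dense[of "2 * real_of_rat p / d" "2 * real_of_rat p / d + 1"] by auto
  have r0: "real_of_rat r > 0"
    using r p d by (smt (verit, best) divide_pos_pos)
  have "min (d/2) (e / (2 * real_of_rat r)) > 0" using d r0 assms(4) by simp
  then obtain c where c: "c \<in> dense_points" "c \<in> ball x (min (d/2) (e / (2 * real_of_rat r)))"
    using dense_points(2)[of "ball x (min (d/2) (e / (2 * real_of_rat r)))"] by fastforce
  show thesis
  proof
    show "(p, r, c) \<in> tent_data"
      using r0 c by (auto simp: tent_data_def)
    show "tent (p, r, c) y \<le> f y" for y
    proof (cases "dist y c < d/2")
      case True
      then have "dist y x < d"
        using c dist_triangle[of y x c] by (auto simp: dist_commute)
      then have "real_of_rat p < f y" by (rule d)
      moreover have "0 \<le> real_of_rat r * dist y c" using r0 by simp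
      ultimately show ?thesis using assms(2)[of y] by (auto simp: tent_def)
    next
      case False
      have "real_of_rat p \<le> real_of_rat r * (d/2)"
        using r d by (simp add: field_simps)
      also have "\<dots> \<le> real_of_rat r * dist y c"
        using False r0 by (intro mult_left_mono) auto
      finally show ?thesis using assms(2)[of y] by (auto simp: tent_def)
    qed
    have "dist x c < e / (2 * real_of_rat r)" using c by auto
    then have "real_of_rat r * dist x c < e/2"
      using r0 by (simp add: field_simps)
    then show "tent (p, r, c) x > f x - e"
      using p by (auto simp: tent_def)
  qed
qed

lemma max_tents_map:
  "max_tents (map T [0..<Suc n]) x \<le> a \<longleftrightarrow> 0 \<le> a \<and> (\<forall>i\<le>n. tent (T i) x \<le> a)"
proof -
  have "max_tents ts x \<le> a \<longleftrightarrow> 0 \<le> a \<and> (\<forall>t\<in>set ts. tent t x \<le> a)" for ts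
    by (induction ts) auto
  then show ?thesis by (auto simp del: upt_Suc simp: less_Suc_eq_le)
qed

text \<open>
  The running maxima of an enumeration of all tents below \<open>f\<close> converge to \<open>f\<close> pointwise, hence in
  integral by dominated convergence.
\<close>

lemma tent_family_approximates:
  fixes f :: "'a::euclidean_space \<Rightarrow> real"
  assumes \<eta>: "\<eta> \<in> radon_measures" and f: "f \<in> C_c" "\<And>x. 0 \<le> f x" and a: "a < (\<integral>x. f x \<partial>\<eta>)"
  shows "\<exists>g\<in>tent_family. (\<forall>x. g x \<le> f x) \<and> a < (\<integral>x. g x \<partial>\<eta>)"
proof -
  define D where "D = {t \<in> tent_data. \<forall>y. tent t y \<le> f y}"
  have cont: "continuous_on UNIV f" using f by (simp add: C_c_def)
  have "countable (tent_data :: (rat \<times> rat \<times> 'a) set)"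
    unfolding tent_data_def by (intro countable_SIGMA) (auto simp: dense_points)
  then have cD: "countable D" unfolding D_def by (rule countable_subset[rotated]) auto
  obtain c :: 'a where "c \<in> dense_points" using dense_points(2)[of UNIV] by auto
  then have "(0, 1, c) \<in> D" using f(2) by (auto simp: D_def tent_data_def tent_def max_def intro: order_trans[OF _ f(2)])
  then have ne: "D \<noteq> {}" by auto
  define T where "T = from_nat_into D"
  have T: "T i \<in> D" for i unfolding T_def by (rule from_nat_into[OF ne])
  define g where "g n = max_tents (map T [0..<Suc n])" for n
  have gle: "g n x \<le> b \<longleftrightarrow> 0 \<le> b \<and> (\<forall>i\<le>n. tent (T i) x \<le> b)" for n x b
    unfolding g_def by (rule max_tents_map)
  have gD: "g n \<in> tent_family" for n
    unfolding g_def tent_family_def using T by (intro imageI) (auto simp: D_def simp del: upt_Suc)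
  have gf: "g n x \<le> f x" for n x
    using gle[of n x "f x"] T f(2) by (auto simp: D_def)
  have g0: "0 \<le> g n x" for n x
  proof -
    have "0 \<le> max_tents ts x" for ts by (induction ts) auto
    then show ?thesis by (simp add: g_def)
  qed
  have lim: "(\<lambda>n. g n x) \<longlonglongrightarrow> f x" for x
  proof (rule LIMSEQ_I)
    fix e :: real assume e: "e > 0"
    show "\<exists>n0. \<forall>n\<ge>n0. norm (g n x - f x) < e"
    proof (cases "f x > 0")
      case True
      obtain t where t: "t \<in> D" "tent t x > f x - e"
        using tent_below_near[OF cont f(2) True e] unfolding D_def by blast
      obtain i where i: "T i = t" using from_nat_into_surj[OF cD t(1)] by (auto simp: T_def)
      have "tent t x \<le> g n x" if "n \<ge> i" for n
        using gle[of n x "g n x"] i that by auto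
      then have "norm (g n x - f x) < e" if "n \<ge> i" for n
        using t(2) gf[of n x] that by (smt (verit) real_norm_def)
      then show ?thesis by blast
    next
      case False
      then have "f x = 0" using f(2)[of x] by simp
      then have "g n x = f x" for n using gf[of n x] g0[of n x] by auto
      then show ?thesis using e by auto
    qed
  qed
  have "(\<lambda>n. \<integral>x. g n x \<partial>\<eta>) \<longlonglongrightarrow> (\<integral>x. f x \<partial>\<eta>)"
  proof (rule integral_dominated_convergence[where w=f])
    show "f \<in> borel_measurable \<eta>" "integrable \<eta> f"
      using integrable_radon_C_c[OF \<eta> f(1)] by auto
    show "g n \<in> borel_measurable \<eta>" for n
      using integrable_radon_C_c[OF \<eta> tent_family_C_c[OF gD]] by auto
    show "AE x in \<eta>. (\<lambda>n. g n x) \<longlonglongrightarrow> f x" using lim by auto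
    show "AE x in \<eta>. norm (g n x) \<le> f x" for n using gf g0 by auto
  qed
  then have "eventually (\<lambda>n. a < (\<integral>x. g n x \<partial>\<eta>)) sequentially"
    using a by (rule order_tendstoD)
  then obtain n where "a < (\<integral>x. g n x \<partial>\<eta>)" by (auto simp: eventually_sequentially)
  then show ?thesis using gD gf by blast
qed

text \<open>
  A single tent of slope \<open>1\<close> suffices, if its height exceeds the maximum of \<open>f\<close> by more than the
  radius of a ball containing the support.
\<close>

lemma tent_family_dominates:
  fixes f :: "'a::euclidean_space \<Rightarrow> real"
  assumes "f \<in> C_c"
  shows "\<exists>g\<in>tent_family. \<forall>x. f x \<le> g x"
proof -
  obtain R B where f: "R > 0" "B > 0" "\<And>x. f x \<noteq> 0 \<Longrightarrow> norm x \<le> R" "\<And>x. \<bar>f x\<bar> \<le> B"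
    using C_cE[OF assms] by metis
  obtain c :: 'a where c: "c \<in> dense_points" "c \<in> ball 0 1"
    using dense_points(2)[of "ball 0 1"] by auto
  obtain p :: rat where p: "real_of_rat p > B + R + 1"
    using of_rat_dense[of "B + R + 1" "B + R + 2"] by auto
  have "f x \<le> max_tents [(p, 1, c)] x" for x
  proof (cases "f x = 0")
    case False
    have "dist x c \<le> R + 1"
      using f(3)[OF False] c(2) norm_triangle_ineq4[of x c] by (auto simp: dist_norm)
    then show ?thesis using p f(4)[of x] by (auto simp: tent_def)
  qed auto
  moreover have "max_tents [(p, 1, c)] \<in> tent_family"
    unfolding tent_family_def using c(1) by (intro imageI) (auto simp: tent_data_def)
  ultimately show ?thesis by blast
qed

definition vague_subbasis :: "'a::euclidean_space measure set set" where
  "vague_subbasis =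
     (\<lambda>(g, q). {\<eta> \<in> radon_measures. real_of_rat q < (\<integral>x. g x \<partial>\<eta>)}) ` (tent_family \<times> UNIV) \<union>
     (\<lambda>(g, q). {\<eta> \<in> radon_measures. (\<integral>x. g x \<partial>\<eta>) < real_of_rat q}) ` (tent_family \<times> UNIV)"

text \<open>
  Being a neighbourhood of \<open>\<eta>\<close> in the topology generated by the countable subbasis.
\<close>

definition vaguely_near :: "'a::euclidean_space measure \<Rightarrow> 'a measure set \<Rightarrow> bool" where
  "vaguely_near \<eta> W \<longleftrightarrow>
     (\<exists>F. finite F \<and> F \<subseteq> vague_subbasis \<and> \<eta> \<in> radon_measures \<inter> \<Inter>F \<and> radon_measures \<inter> \<Inter>F \<subseteq> W)"

lemma vaguely_near_Int:
  assumes "vaguely_near \<eta> V" "vaguely_near \<eta> W" shows "vaguely_near \<eta> (V \<inter> W)"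
proof -
  obtain F G where "finite F" "F \<subseteq> vague_subbasis" "\<eta> \<in> radon_measures \<inter> \<Inter>F" "radon_measures \<inter> \<Inter>F \<subseteq> V"
    "finite G" "G \<subseteq> vague_subbasis" "\<eta> \<in> radon_measures \<inter> \<Inter>G" "radon_measures \<inter> \<Inter>G \<subseteq> W"
    using assms unfolding vaguely_near_def by auto
  then show ?thesis unfolding vaguely_near_def by (intro exI[of _ "F \<union> G"]) auto
qed

lemma vaguely_near_mono: "vaguely_near \<eta> V \<Longrightarrow> V \<subseteq> W \<Longrightarrow> vaguely_near \<eta> W"
  unfolding vaguely_near_def by (metis order_trans)

lemma vaguely_near_subbasis:
  "V \<in> vague_subbasis \<Longrightarrow> \<eta> \<in> V \<Longrightarrow> \<eta> \<in> radon_measures \<Longrightarrow> vaguely_near \<eta> V"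
  unfolding vaguely_near_def by (intro exI[of _ "{V}"]) auto

text \<open>
  If \<open>g \<le> f\<close> belongs to the countable family and its integral exceeds \<open>a\<close>, then by monotonicity \<open>f\<close>
  inherits the lower bound for all measures near \<open>\<eta>\<close>.
\<close>

lemma vaguely_near_integral_greater:
  fixes f :: "'a::euclidean_space \<Rightarrow> real"
  assumes \<eta>: "\<eta> \<in> radon_measures" and f: "f \<in> C_c" "\<And>x. 0 \<le> f x" and a: "a < (\<integral>x. f x \<partial>\<eta>)"
  shows "vaguely_near \<eta> {\<eta> \<in> radon_measures. a < (\<integral>x. f x \<partial>\<eta>)}"
proof -
  obtain g where g: "g \<in> tent_family" "\<And>x. g x \<le> f x" "a < (\<integral>x. g x \<partial>\<eta>)"
    using tent_family_approximates[OF assms] by auto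
  obtain q where q: "a < real_of_rat q" "real_of_rat q < (\<integral>x. g x \<partial>\<eta>)"
    using of_rat_dense[OF g(3)] by auto
  have "vaguely_near \<eta> {\<eta> \<in> radon_measures. real_of_rat q < (\<integral>x. g x \<partial>\<eta>)}"
    by (rule vaguely_near_subbasis) (use g q \<eta> in \<open>auto simp: vague_subbasis_def\<close>)
  moreover have "(\<integral>x. g x \<partial>\<nu>) \<le> (\<integral>x. f x \<partial>\<nu>)" if "\<nu> \<in> radon_measures" for \<nu>
    by (intro integral_mono integrable_radon_C_c that f tent_family_C_c g)
  ultimately show ?thesis
    by (elim vaguely_near_mono) (use q in force)
qed

text \<open>
  Upper bounds reduce to lower ones, writing \<open>f = g - (g - f)\<close> with \<open>g \<ge> f\<close> in the countable family.
\<close>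

lemma vaguely_near_integral_less:
  fixes f :: "'a::euclidean_space \<Rightarrow> real"
  assumes \<eta>: "\<eta> \<in> radon_measures" and f: "f \<in> C_c" "\<And>x. 0 \<le> f x" and a: "(\<integral>x. f x \<partial>\<eta>) < a"
  shows "vaguely_near \<eta> {\<eta> \<in> radon_measures. (\<integral>x. f x \<partial>\<eta>) < a}"
proof -
  obtain g where g: "g \<in> tent_family" "\<And>x. f x \<le> g x"
    using tent_family_dominates[OF f(1)] by blast
  have gc: "g \<in> C_c" by (rule tent_family_C_c[OF g(1)])
  have h: "(\<lambda>x. g x - f x) \<in> C_c" by (rule C_c_diff[OF gc f(1)])
  have int_h: "(\<integral>x. g x - f x \<partial>\<nu>) = (\<integral>x. g x \<partial>\<nu>) - (\<integral>x. f x \<partial>\<nu>)" if "\<nu> \<in> radon_measures" for \<nu>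
    by (intro Bochner_Integration.integral_diff integrable_radon_C_c that f gc)
  obtain q where q: "(\<integral>x. g x \<partial>\<eta>) < real_of_rat q" "real_of_rat q < (\<integral>x. g x \<partial>\<eta>) + (a - (\<integral>x. f x \<partial>\<eta>))"
    using of_rat_dense[of "\<integral>x. g x \<partial>\<eta>" "(\<integral>x. g x \<partial>\<eta>) + (a - (\<integral>x. f x \<partial>\<eta>))"] a by auto
  have "vaguely_near \<eta> {\<eta> \<in> radon_measures. (\<integral>x. g x \<partial>\<eta>) < real_of_rat q}"
    by (rule vaguely_near_subbasis) (use g q \<eta> in \<open>auto simp: vague_subbasis_def\<close>)
  moreover have "vaguely_near \<eta> {\<eta> \<in> radon_measures. real_of_rat q - a < (\<integral>x. g x - f x \<partial>\<eta>)}"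
    by (rule vaguely_near_integral_greater) (use \<eta> h g q int_h in auto)
  ultimately have "vaguely_near \<eta> ({\<eta> \<in> radon_measures. (\<integral>x. g x \<partial>\<eta>) < real_of_rat q} \<inter>
      {\<eta> \<in> radon_measures. real_of_rat q - a < (\<integral>x. g x - f x \<partial>\<eta>)})"
    by (rule vaguely_near_Int)
  then show ?thesis
    by (elim vaguely_near_mono) (use int_h in auto)
qed

lemma vaguely_near_integral:
  fixes f :: "'a::euclidean_space \<Rightarrow> real"
  assumes \<eta>: "\<eta> \<in> radon_measures" and f: "f \<in> C_c" and U: "open U" "(\<integral>x. f x \<partial>\<eta>) \<in> U"
  shows "vaguely_near \<eta> {\<eta> \<in> radon_measures. (\<integral>x. f x \<partial>\<eta>) \<in> U}"
proof -
  obtain e where e: "e > 0" "\<And>y. dist y (\<integral>x. f x \<partial>\<eta>) < e \<Longrightarrow> y \<in> U"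
    using U unfolding open_dist by auto
  define f1 where "f1 = (\<lambda>x. max (f x) 0)"
  define f2 where "f2 = (\<lambda>x. max (- f x) 0)"
  have f12: "f1 \<in> C_c" "f2 \<in> C_c" "\<And>x. 0 \<le> f1 x" "\<And>x. 0 \<le> f2 x"
    unfolding f1_def f2_def by (auto intro!: C_c_max C_c_zero C_c_uminus f)
  have int_f: "(\<integral>x. f x \<partial>\<nu>) = (\<integral>x. f1 x \<partial>\<nu>) - (\<integral>x. f2 x \<partial>\<nu>)" if "\<nu> \<in> radon_measures" for \<nu>
  proof -
    have "(\<integral>x. f x \<partial>\<nu>) = (\<integral>x. f1 x - f2 x \<partial>\<nu>)"
      by (intro Bochner_Integration.integral_cong) (auto simp: f1_def f2_def)
    also have "\<dots> = (\<integral>x. f1 x \<partial>\<nu>) - (\<integral>x. f2 x \<partial>\<nu>)"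
      by (intro Bochner_Integration.integral_diff integrable_radon_C_c that f12)
    finally show ?thesis .
  qed
  define I where "I = (\<lambda>g :: 'a \<Rightarrow> real. \<integral>x. g x \<partial>\<eta>)"
  have *: "vaguely_near \<eta> {\<eta> \<in> radon_measures. I g - e/2 < (\<integral>x. g x \<partial>\<eta>)}"
    "vaguely_near \<eta> {\<eta> \<in> radon_measures. (\<integral>x. g x \<partial>\<eta>) < I g + e/2}"
    if "g \<in> C_c" "\<And>x. 0 \<le> g x" for g
    by (intro vaguely_near_integral_greater vaguely_near_integral_less \<eta> that;
        use e in \<open>simp add: I_def\<close>)+
  have "vaguely_near \<eta> (({\<eta> \<in> radon_measures. I f1 - e/2 < (\<integral>x. f1 x \<partial>\<eta>)} \<inter>
     {\<eta> \<in> radon_measures. (\<integral>x. f1 x \<partial>\<eta>) < I f1 + e/2}) \<inter>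
     ({\<eta> \<in> radon_measures. I f2 - e/2 < (\<integral>x. f2 x \<partial>\<eta>)} \<inter>
     {\<eta> \<in> radon_measures. (\<integral>x. f2 x \<partial>\<eta>) < I f2 + e/2}))"
    by (intro vaguely_near_Int * f12)
  then show ?thesis
    by (elim vaguely_near_mono)
      (auto intro!: e simp: dist_real_def I_def int_f[OF \<eta>] int_f abs_less_iff)
qed

lemma vaguely_near_open:
  assumes "openin vague_topology W" "\<eta> \<in> W" "\<eta> \<in> radon_measures"
  shows "vaguely_near \<eta> W"
proof -
  have "generate_topology_on {{\<eta> \<in> radon_measures. (\<integral>x. f x \<partial>\<eta>) \<in> U} | f U. f \<in> C_c \<and> open U} W"
    using assms(1) unfolding vague_topology_def openin_topology_generated_by_iff .
  then show ?thesis using assms(2)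
  proof (induction rule: generate_topology_on.induct)
    case (Basis s)
    then show ?case using assms(3) vaguely_near_integral by auto
  next
    case (UN K)
    then obtain k where "k \<in> K" "vaguely_near \<eta> k" by blast
    then show ?case by (blast intro: vaguely_near_mono)
  qed (auto intro: vaguely_near_Int)
qed

definition vague_halfspaces :: "'a::euclidean_space measure set set" where
  "vague_halfspaces = {{\<eta> \<in> radon_measures. a < (\<integral>x. f x \<partial>\<eta>)} | f a. f \<in> C_c \<and> (\<forall>x. 0 \<le> f x)}"

lemma openin_vague_subset: "openin vague_topology W \<Longrightarrow> W \<subseteq> radon_measures"
  using openin_subset[of vague_topology W] unfolding vague_topology_def topology_generated_by_topspace
  by auto

lemma
  shows space_radon_space: "space (radon_space :: 'a::euclidean_space measure measure) = radon_measures"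
    and sets_radon_space_sigma: "sets (radon_space :: 'a measure measure) =
      sigma_sets radon_measures {U. openin vague_topology U}"
proof -
  have "{U. openin vague_topology U} \<subseteq> Pow (radon_measures :: 'a measure set)"
    using openin_vague_subset by blast
  then show "space (radon_space :: 'a measure measure) = radon_measures"
    "sets (radon_space :: 'a measure measure) = sigma_sets radon_measures {U. openin vague_topology U}"
    by (simp_all add: radon_space_def space_measure_of sets_measure_of)
qed

lemma measurable_integral_radon_space:
  fixes f :: "'a::euclidean_space \<Rightarrow> real"
  assumes "f \<in> C_c" shows "(\<lambda>\<eta>. \<integral>x. f x \<partial>\<eta>) \<in> borel_measurable radon_space"
proof (rule borel_measurableI)
  fix S :: "real set" assume "open S"
  then have "openin vague_topology {\<eta> \<in> radon_measures. (\<integral>x. f x \<partial>\<eta>) \<in> S}"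
    unfolding vague_topology_def using assms by (intro topology_generated_by_Basis) auto
  moreover have "(\<lambda>\<eta>. \<integral>x. f x \<partial>\<eta>) -` S \<inter> space radon_space = {\<eta> \<in> radon_measures. (\<integral>x. f x \<partial>\<eta>) \<in> S}"
    by (auto simp: space_radon_space)
  ultimately show "(\<lambda>\<eta>. \<integral>x. f x \<partial>\<eta>) -` S \<inter> space radon_space \<in> sets radon_space"
    by (simp add: sets_radon_space_sigma sigma_sets.Basic)
qed

text \<open>
  The vague topology on the Radon measures of a Euclidean space has a countable subbasis, so its
  Borel sets are already generated by the integrals of nonnegative test functions. This is what lets
  a Fourier transform, which sees only such integrals, determine a measure on all vague Borel sets.
\<close>

theorem sets_radon_space:
  "sets (radon_space :: 'a::euclidean_space measure measure) = sigma_sets radon_measures vague_halfspaces"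
proof (rule antisym)
  interpret S: sigma_algebra radon_measures "sigma_sets radon_measures vague_halfspaces"
    by (rule sigma_algebra_sigma_sets) (auto simp: vague_halfspaces_def)
  have half: "vague_halfspaces \<subseteq> Pow (radon_measures :: 'a measure set)" by (auto simp: vague_halfspaces_def)
  define N where "N = sigma (radon_measures :: 'a measure set) vague_halfspaces"
  have N: "space N = radon_measures" "sets N = sigma_sets radon_measures vague_halfspaces"
    using half by (auto simp: N_def)
  have meas: "(\<lambda>\<eta>. \<integral>x. g x \<partial>\<eta>) \<in> borel_measurable N" if "g \<in> C_c" "\<And>x. 0 \<le> g x" for g :: "'a \<Rightarrow> real"
    by (rule borel_measurableI_greater)
      (use that in \<open>auto simp: N vague_halfspaces_def intro!: sigma_sets.Basic\<close>)
  have fam: "g \<in> C_c" "0 \<le> g x" if "g \<in> tent_family" for g and x :: 'a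
  proof -
    have "0 \<le> max_tents ts x" for ts by (induction ts) auto
    then show "g \<in> C_c" "0 \<le> g x" using that tent_family_C_c by (auto simp: tent_family_def)
  qed
  have sub: "vague_subbasis \<subseteq> sets N"
  proof -
    have "{\<eta> \<in> space N. real_of_rat q < (\<integral>x. g x \<partial>\<eta>)} \<in> sets N"
      "{\<eta> \<in> space N. (\<integral>x. g x \<partial>\<eta>) < real_of_rat q} \<in> sets N" if "g \<in> tent_family" for g :: "'a \<Rightarrow> real" and q
      using meas[OF fam[OF that]] by measurable
    then show ?thesis by (auto simp: vague_subbasis_def N)
  qed
  have count: "countable (vague_subbasis :: 'a measure set set)"
    unfolding vague_subbasis_def
    by (intro countable_Un countable_image countable_SIGMA countable_tent_family) auto
  have "W \<in> sets N" if W: "openin vague_topology W" for W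
  proof -
    define J where "J = {F. finite F \<and> F \<subseteq> vague_subbasis \<and> radon_measures \<inter> \<Inter>F \<subseteq> W}"
    have "countable J"
      using countable_Collect_finite_subset[OF count]
      by (rule countable_subset[rotated]) (auto simp: J_def)
    moreover have "space N \<inter> \<Inter>F \<in> sets N" if "F \<in> J" for F
    proof (cases "F = {}")
      case False
      then have "\<Inter>F \<in> sets N"
        using that sub sets.finite_INT[of F "\<lambda>x. x" N] by (auto simp: J_def)
      then show ?thesis by auto
    qed auto
    ultimately have "(\<Union>F\<in>J. space N \<inter> \<Inter>F) \<in> sets N" by (intro sets.countable_UN'') auto
    moreover have "W = (\<Union>F\<in>J. space N \<inter> \<Inter>F)"
    proof
      show "W \<subseteq> (\<Union>F\<in>J. space N \<inter> \<Inter>F)"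
      proof
        fix \<eta> assume \<eta>: "\<eta> \<in> W"
        then have "\<eta> \<in> radon_measures" using openin_vague_subset[OF W] by auto
        from vaguely_near_open[OF W \<eta> this] show "\<eta> \<in> (\<Union>F\<in>J. space N \<inter> \<Inter>F)"
          unfolding vaguely_near_def J_def N by auto
      qed
    qed (auto simp: J_def N)
    ultimately show ?thesis by simp
  qed
  then have "sigma_sets (space N) {U. openin vague_topology U} \<subseteq> sets N"
    by (intro sets.sigma_sets_subset) auto
  then show "sets radon_space \<subseteq> sigma_sets radon_measures (vague_halfspaces :: 'a measure set set)"
    unfolding sets_radon_space_sigma N .
  have "A \<in> sets radon_space" if half_A: "A \<in> vague_halfspaces" for A :: "'a measure set"
  proof -
    obtain f a where A: "A = {\<eta> \<in> space radon_space. a < (\<integral>x. f x \<partial>\<eta>)}" "f \<in> C_c"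
      using half_A unfolding vague_halfspaces_def space_radon_space by blast
    show ?thesis unfolding A(1) using measurable_integral_radon_space[OF A(2)] by measurable
  qed
  then have "sigma_sets (space radon_space) vague_halfspaces \<subseteq> sets (radon_space :: 'a measure measure)"
    by (intro sets.sigma_sets_subset) auto
  then show "sigma_sets radon_measures vague_halfspaces \<subseteq> sets (radon_space :: 'a measure measure)"
    unfolding space_radon_space .
qed

lemma measurable_radon_spaceI:
  fixes T :: "'b \<Rightarrow> 'a::euclidean_space measure"
  assumes "\<And>\<omega>. \<omega> \<in> space N \<Longrightarrow> T \<omega> \<in> radon_measures"
    and "\<And>f. f \<in> C_c \<Longrightarrow> (\<And>x. 0 \<le> f x) \<Longrightarrow> (\<lambda>\<omega>. \<integral>x. f x \<partial>T \<omega>) \<in> borel_measurable N"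
  shows "T \<in> measurable N radon_space"
proof (rule measurable_sigma_sets[OF sets_radon_space])
  show "vague_halfspaces \<subseteq> Pow (radon_measures :: 'a measure set)" by (auto simp: vague_halfspaces_def)
  show "T \<in> space N \<rightarrow> radon_measures" using assms(1) by auto
  fix A :: "'a measure set" assume "A \<in> vague_halfspaces"
  then obtain f a where A: "A = {\<eta> \<in> radon_measures. a < (\<integral>x. f x \<partial>\<eta>)}" "f \<in> C_c" "\<And>x. 0 \<le> f x"
    by (auto simp: vague_halfspaces_def)
  have "T -` A \<inter> space N = {\<omega> \<in> space N. a < (\<integral>x. f x \<partial>T \<omega>)}" using A assms(1) by auto
  also have "\<dots> \<in> sets N" using assms(2)[OF A(2,3)] by measurable
  finally show "T -` A \<inter> space N \<in> sets N" .
qed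

section \<open>Discrete Radon measures\<close>

lemma space_discrete_radon_space:
  "space (discrete_radon_space :: 'a::euclidean_space measure measure) = discrete_radon_measures"
  by (auto simp: discrete_radon_space_def space_restrict_space space_radon_space discrete_radon_measures_def)

lemma discrete_imp_radon: "\<eta> \<in> discrete_radon_measures \<Longrightarrow> \<eta> \<in> radon_measures"
  by (simp add: discrete_radon_measures_def)

lemma infsum_ennreal_eq_suminf:
  fixes f :: "nat \<Rightarrow> ennreal"
  shows "(\<Sum>\<^sub>\<infinity>n. f n) = (\<Sum>n. f n)"
proof -
  have "(\<Sum>\<^sub>\<infinity>n. f n) = (SUP F\<in>{F. finite F \<and> F \<subseteq> UNIV}. sum f F)"
    by (rule nonneg_infsum_complete) auto
  also have "\<dots> = (SUP n. sum f {..<n})"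
  proof (rule antisym)
    show "(SUP F\<in>{F. finite F \<and> F \<subseteq> UNIV}. sum f F) \<le> (SUP n. sum f {..<n})"
    proof (rule SUP_least)
      fix F :: "nat set" assume "F \<in> {F. finite F \<and> F \<subseteq> UNIV}"
      then obtain n where "F \<subseteq> {..<n}" using finite_nat_iff_bounded by auto
      then have "sum f F \<le> sum f {..<n}" by (intro sum_mono2) auto
      then show "sum f F \<le> (SUP n. sum f {..<n})" by (meson SUP_upper2 UNIV_I)
    qed
  qed (intro SUP_least SUP_upper, auto)
  also have "\<dots> = (\<Sum>n. f n)" by (simp add: suminf_eq_SUP)
  finally show ?thesis .
qed

lemma infsum_ennreal_eq_nn_integral:
  fixes f :: "'a \<Rightarrow> ennreal"
  assumes "countable S"
  shows "(\<Sum>\<^sub>\<infinity>x\<in>S. f x) = (\<integral>\<^sup>+x. f x \<partial>count_space S)"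
proof (cases "finite S")
  case True
  then show ?thesis by (simp add: nn_integral_count_space_finite)
next
  case False
  have bij: "bij_betw (from_nat_into S) UNIV S"
    by (rule bij_betw_from_nat_into[OF assms False])
  have "(\<Sum>\<^sub>\<infinity>x\<in>S. f x) = (\<Sum>\<^sub>\<infinity>n. f (from_nat_into S n))"
    by (rule infsum_reindex_bij_betw[OF bij, symmetric])
  also have "\<dots> = (\<integral>\<^sup>+n. f (from_nat_into S n) \<partial>count_space UNIV)"
    by (simp add: infsum_ennreal_eq_suminf nn_integral_count_space_nat)
  also have "\<dots> = (\<integral>\<^sup>+x. f x \<partial>count_space S)"
    by (rule nn_integral_bij_count_space[OF bij])
  finally show ?thesis .
qed

lemma emeasure_radon_bounded:
  fixes A :: "'a::euclidean_space set"
  assumes \<eta>: "\<eta> \<in> radon_measures" and A: "bounded A"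
  shows "emeasure \<eta> A < \<infinity>"
proof -
  have "emeasure \<eta> A \<le> emeasure \<eta> (closure A)"
    using sets_radon[OF \<eta>] by (intro emeasure_mono closure_subset) auto
  also have "\<dots> < \<infinity>" using \<eta> A by (auto simp: radon_measures_def compact_closure)
  finally show ?thesis .
qed

lemma emeasure_radon_singleton:
  assumes "\<eta> \<in> radon_measures" shows "emeasure \<eta> {x} = ennreal (measure \<eta> {x})"
proof -
  have "emeasure \<eta> {x} < \<infinity>" using assms by (auto simp: radon_measures_def)
  then show ?thesis by (simp add: emeasure_eq_ennreal_measure)
qed

text \<open>
  A Radon measure is discrete iff it lives on a countable set; the weights are then the masses of
  the points. Images of discrete measures are easiest to recognise in this form.
\<close>

lemma discrete_radon_measures_iff:
  "\<eta> \<in> (discrete_radon_measures :: 'a::euclidean_space measure set) \<longleftrightarrow>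
     \<eta> \<in> radon_measures \<and> (\<exists>D. countable D \<and> emeasure \<eta> (- D) = 0)"
proof (intro iffI conjI)
  assume "\<eta> \<in> discrete_radon_measures"
  then obtain S s where *: "\<eta> \<in> radon_measures" "countable S"
    "\<And>A. A \<in> sets borel \<Longrightarrow> emeasure \<eta> A =
          (\<Sum>\<^sub>\<infinity>x\<in>S. ennreal (s x) * emeasure (return borel x) A)"
    unfolding discrete_radon_measures_def by blast
  show "\<eta> \<in> radon_measures" by fact
  have S: "- S \<in> sets borel" by (rule borel_comp, rule sets.countable) (use *(2) in auto)
  have "emeasure \<eta> (- S) = (\<Sum>\<^sub>\<infinity>x\<in>S. ennreal (s x) * emeasure (return borel x) (- S))"
    by (rule *(3)[OF S])
  also have "\<dots> = 0" using S by (intro infsum_0) auto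
  finally show "\<exists>D. countable D \<and> emeasure \<eta> (- D) = 0" using *(2) by blast
next
  assume "\<eta> \<in> radon_measures \<and> (\<exists>D. countable D \<and> emeasure \<eta> (- D) = 0)"
  then obtain D where \<eta>: "\<eta> \<in> radon_measures" and D: "countable D" "emeasure \<eta> (- D) = 0" by blast
  have sets: "sets \<eta> = sets borel" by (rule sets_radon[OF \<eta>])
  have cm: "A \<in> sets \<eta>" if "countable A" for A unfolding sets by (rule sets.countable) (use that in auto)
  define S where "S = {x \<in> D. measure \<eta> {x} > 0}"
  have cS: "countable S" unfolding S_def by (rule countable_subset[OF _ D(1)]) auto
  have "emeasure \<eta> A = (\<Sum>\<^sub>\<infinity>x\<in>S. ennreal (measure \<eta> {x}) * emeasure (return borel x) A)"
    if A: "A \<in> sets borel" for A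
  proof -
    have "A \<inter> D \<in> sets \<eta>" by (rule cm) (use D(1) in auto)
    have mD: "- D \<in> sets \<eta>" using cm[OF D(1)] sets by (simp add: borel_comp)
    have "emeasure \<eta> A = emeasure \<eta> (A \<inter> D)"
    proof (rule emeasure_eq_AE)
      have "AE x in \<eta>. x \<notin> - D" by (rule AE_not_in) (use D mD in \<open>auto simp: null_sets_def\<close>)
      then show "AE x in \<eta>. (x \<in> A) = (x \<in> A \<inter> D)" by auto
      show "A \<in> sets \<eta>" using A sets by simp
    qed fact
    also have "\<dots> = (\<integral>\<^sup>+x. emeasure \<eta> {x} \<partial>count_space (A \<inter> D))"
      by (rule emeasure_countable_singleton) (use D(1) sets in auto)
    also have "\<dots> = (\<integral>\<^sup>+x. ennreal (measure \<eta> {x}) * emeasure (return borel x) A \<partial>count_space S)"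
    proof -
      have "(\<integral>\<^sup>+x. emeasure \<eta> {x} \<partial>count_space (A \<inter> D)) =
          (\<integral>\<^sup>+x. emeasure \<eta> {x} * indicator (A \<inter> D) x \<partial>count_space UNIV)"
        by (simp add: nn_integral_count_space_indicator)
      also have "\<dots> = (\<integral>\<^sup>+x. (ennreal (measure \<eta> {x}) * emeasure (return borel x) A) * indicator S x \<partial>count_space UNIV)"
        using A emeasure_radon_singleton[OF \<eta>]
        by (intro nn_integral_cong) (auto simp: S_def indicator_def less_le)
      also have "\<dots> = (\<integral>\<^sup>+x. ennreal (measure \<eta> {x}) * emeasure (return borel x) A \<partial>count_space S)"
        by (simp add: nn_integral_count_space_indicator)
      finally show ?thesis .
    qed
    also have "\<dots> = (\<Sum>\<^sub>\<infinity>x\<in>S. ennreal (measure \<eta> {x}) * emeasure (return borel x) A)"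
      by (rule infsum_ennreal_eq_nn_integral[OF cS, symmetric])
    finally show ?thesis .
  qed
  then show "\<eta> \<in> discrete_radon_measures"
    unfolding discrete_radon_measures_def using \<eta> cS
    by (intro CollectI conjI exI[of _ S] exI[of _ "\<lambda>x. measure \<eta> {x}"]) (auto simp: S_def)
qed

lemma measurable_discrete_radon_spaceI:
  fixes T :: "'b \<Rightarrow> 'a::euclidean_space measure"
  assumes "\<And>\<omega>. \<omega> \<in> space N \<Longrightarrow> T \<omega> \<in> discrete_radon_measures"
    and "\<And>f. f \<in> C_c \<Longrightarrow> (\<And>x. 0 \<le> f x) \<Longrightarrow> (\<lambda>\<omega>. \<integral>x. f x \<partial>T \<omega>) \<in> borel_measurable N"
  shows "T \<in> measurable N discrete_radon_space"
  unfolding discrete_radon_space_def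
  by (intro measurable_restrict_space2 measurable_radon_spaceI assms)
    (use assms(1) discrete_imp_radon in auto)

lemma measurable_integral_discrete_radon_space:
  fixes f :: "'a::euclidean_space \<Rightarrow> real"
  assumes "f \<in> C_c" shows "(\<lambda>\<eta>. \<integral>x. f x \<partial>\<eta>) \<in> borel_measurable discrete_radon_space"
  unfolding discrete_radon_space_def
  by (intro measurable_restrict_space1 measurable_integral_radon_space assms)

lemma sets_discrete_radon_space:
  "sets (discrete_radon_space :: 'a::euclidean_space measure measure) = sigma_sets discrete_radon_measures
     {{\<eta> \<in> discrete_radon_measures. a < (\<integral>x. f x \<partial>\<eta>)} | f a. f \<in> C_c \<and> (\<forall>x. 0 \<le> f x)}"
proof -
  have id: "(\<lambda>\<eta>. \<eta>) \<in> discrete_radon_measures \<rightarrow> (radon_measures :: 'a measure set)"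
    by (auto simp: discrete_radon_measures_def)
  have "sets (discrete_radon_space :: 'a measure measure) =
      {(\<lambda>\<eta>. \<eta>) -` A \<inter> discrete_radon_measures | A. A \<in> sets radon_space}"
    by (auto simp: discrete_radon_space_def sets_restrict_space)
  also have "\<dots> = sigma_sets discrete_radon_measures
      {(\<lambda>\<eta>. \<eta>) -` A \<inter> discrete_radon_measures | A. A \<in> vague_halfspaces}"
    unfolding sets_radon_space by (rule sigma_sets_vimage_commute[OF id])
  also have "{(\<lambda>\<eta>. \<eta>) -` A \<inter> discrete_radon_measures | A. A \<in> vague_halfspaces} =
     {{\<eta> \<in> discrete_radon_measures. a < (\<integral>x. f x \<partial>\<eta>)} | f a. f \<in> (C_c :: ('a \<Rightarrow> real) set) \<and> (\<forall>x. 0 \<le> f x)}"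
    (is "?L = ?R")
  proof -
    have *: "{\<eta> \<in> radon_measures. a < (\<integral>x. f x \<partial>\<eta>)} \<inter> discrete_radon_measures =
        {\<eta> \<in> discrete_radon_measures. a < (\<integral>x. f x \<partial>\<eta>)}" for a and f :: "'a \<Rightarrow> real"
      by (auto simp: discrete_radon_measures_def)
    show ?thesis
    proof (intro set_eqI iffI)
      fix X :: "'a measure set" assume "X \<in> ?L"
      then obtain f a where "f \<in> C_c" "\<forall>x. 0 \<le> f x"
        "X = {\<eta> \<in> radon_measures. a < (\<integral>x. f x \<partial>\<eta>)} \<inter> discrete_radon_measures"
        unfolding vague_halfspaces_def by auto
      then show "X \<in> ?R" unfolding * by blast
    next
      fix X :: "'a measure set" assume "X \<in> ?R"
      then obtain f a where "f \<in> C_c" "\<forall>x. 0 \<le> f x"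
        "X = {\<eta> \<in> radon_measures. a < (\<integral>x. f x \<partial>\<eta>)} \<inter> discrete_radon_measures"
        unfolding * by blast
      then show "X \<in> ?L" unfolding vague_halfspaces_def by auto
    qed
  qed
  finally show ?thesis .
qed

section \<open>The Fourier transform determines a random discrete measure\<close>

text \<open>
  The ramps from \<open>0\<close> to \<open>1\<close> that start at \<open>a\<close> with slope \<open>n\<close> converge to the step, and Weierstrass gives
  polynomials close to them. The uniform bound is there for dominated convergence.
\<close>

lemma approximate_step_by_polynomials:
  fixes a :: real
  obtains p where "\<And>n. real_polynomial_function (p n :: real \<Rightarrow> real)"
    and "\<And>n y. 0 \<le> y \<Longrightarrow> y \<le> 1 \<Longrightarrow> \<bar>p n y\<bar> \<le> 2"
    and "\<And>y. 0 \<le> y \<Longrightarrow> y \<le> 1 \<Longrightarrow> (\<lambda>n. p n y) \<longlonglongrightarrow> indicator {a<..} y"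
proof -
  define c where "c n y = min 1 (max 0 (real n * (y - a)))" for n y
  have "\<exists>p. real_polynomial_function p \<and> (\<forall>y\<in>{0..1}. \<bar>c n y - p y\<bar> < inverse (real (Suc n)))" for n
  proof -
    have "continuous_on {0..1} (c n)" unfolding c_def by (intro continuous_intros)
    from Stone_Weierstrass_real_polynomial_function[OF _ this, of "inverse (real (Suc n))"]
    show ?thesis by (metis compact_Icc inverse_positive_iff_positive of_nat_0_less_iff zero_less_Suc)
  qed
  then obtain p where p: "\<And>n. real_polynomial_function (p n)"
    "\<And>n y. y \<in> {0..1} \<Longrightarrow> \<bar>c n y - p n y\<bar> < inverse (real (Suc n))"
    by metis
  show thesis
  proof
    show "real_polynomial_function (p n)" for n by fact
    fix y :: real assume y: "0 \<le> y" "y \<le> 1"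
    show "\<bar>p n y\<bar> \<le> 2" for n
    proof -
      have "inverse (real (Suc n)) \<le> 1" by (simp add: field_simps)
      moreover have "0 \<le> c n y" "c n y \<le> 1" by (auto simp: c_def)
      ultimately show ?thesis using p(2)[of y n] y by auto
    qed
    have "(\<lambda>n. c n y) \<longlonglongrightarrow> indicator {a<..} y"
    proof (cases "y > a")
      case True
      obtain n0 where n0: "1 / (y - a) < real n0" using reals_Archimedean2 by blast
      have "c n y = 1" if "n \<ge> n0" for n
      proof -
        have "1 / (y - a) \<le> real n" using n0 that by linarith
        then show ?thesis using True by (simp add: c_def field_simps)
      qed
      then have "eventually (\<lambda>n. c n y = indicator {a<..} y) sequentially"
        using True by (auto simp: eventually_sequentially)
      then show ?thesis by (rule tendsto_eventually)
    next
      case False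
      then have "c n y = indicator {a<..} y" for n
        by (auto simp: c_def mult_nonneg_nonpos)
      then show ?thesis by simp
    qed
    moreover have "(\<lambda>n. p n y - c n y) \<longlonglongrightarrow> 0"
    proof (rule Lim_null_comparison)
      show "eventually (\<lambda>n. norm (p n y - c n y) \<le> inverse (real (Suc n))) sequentially"
        using p(2)[of y] y by (intro always_eventually) (force simp: abs_minus_commute intro: less_imp_le)
    qed (rule LIMSEQ_inverse_real_of_nat)
    ultimately have "(\<lambda>n. c n y + (p n y - c n y)) \<longlonglongrightarrow> indicator {a<..} y + 0"
      by (rule tendsto_add)
    then show "(\<lambda>n. p n y) \<longlonglongrightarrow> indicator {a<..} y" by simp
  qed
qed

text \<open>
  Two finite measures that agree on a multiplicative class of functions agree on the
  \<open>\<sigma>\<close>-algebra it generates: agreement passes to polynomials in each member and hence, by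
  Weierstrass approximation, to the indicators of its superlevel sets, one member at a time.
\<close>

theorem measure_eqI_multiplicative_class:
  fixes \<mu> \<nu> :: "'a measure" and F :: "('a \<Rightarrow> real) set"
  assumes fin: "finite_measure \<mu>" "finite_measure \<nu>" and sets: "sets \<nu> = sets \<mu>"
    and meas: "\<And>f. f \<in> F \<Longrightarrow> f \<in> borel_measurable \<mu>"
    and bnd: "\<And>f x. f \<in> F \<Longrightarrow> x \<in> space \<mu> \<Longrightarrow> 0 \<le> f x \<and> f x \<le> 1"
    and one: "(\<lambda>_. 1) \<in> F" and mult: "\<And>f g. f \<in> F \<Longrightarrow> g \<in> F \<Longrightarrow> (\<lambda>x. f x * g x) \<in> F"
    and eq: "\<And>f. f \<in> F \<Longrightarrow> (\<integral>x. f x \<partial>\<mu>) = (\<integral>x. f x \<partial>\<nu>)"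
    and gen: "sets \<mu> \<subseteq> sigma_sets (space \<mu>) {{x \<in> space \<mu>. a < f x} | f a. f \<in> F}"
  shows "\<mu> = \<nu>"
proof -
  interpret \<mu>: finite_measure \<mu> by fact
  interpret \<nu>: finite_measure \<nu> by fact
  have sp: "space \<nu> = space \<mu>" by (rule sets_eq_imp_space_eq[OF sets])
  have meas': "f \<in> borel_measurable \<nu>" if "f \<in> F" for f
    using meas[OF that] by (simp add: measurable_cong_sets[OF sets refl])
  define X where "X L = {x \<in> space \<mu>. \<forall>(f, a)\<in>set L. a < f x}" for L :: "(('a \<Rightarrow> real) \<times> real) list"
  have X_Cons: "X ((f, a) # L) = X L \<inter> {x \<in> space \<mu>. a < f x}" for f a L
    by (auto simp: X_def)
  have X_sets: "X L \<in> sets \<mu>" if "set L \<subseteq> F \<times> UNIV" for L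
    using that
  proof (induction L)
    case (Cons u L)
    obtain f a where u: "u = (f, a)" by force
    have "f \<in> borel_measurable \<mu>" using Cons u meas by auto
    then have "{x \<in> space \<mu>. a < f x} \<in> sets \<mu>" by measurable
    then show ?case unfolding u X_Cons using Cons by auto
  qed (auto simp: X_def)
  have pow: "(\<lambda>x. f x ^ i * h x) \<in> F" if "f \<in> F" "h \<in> F" for f h i
  proof (induction i)
    case (Suc i)
    then show ?case using mult[OF that(1) Suc] by (simp add: mult.assoc)
  qed (use that in simp)
  have int_F: "integrable \<mu> (\<lambda>x. indicator (X L) x * f x)" "integrable \<nu> (\<lambda>x. indicator (X L) x * f x)"
    if "set L \<subseteq> F \<times> UNIV" "f \<in> F" for L f
  proof -
    have b: "AE x in M. norm (indicator (X L) x * f x) \<le> 1" if "space M = space \<mu>" for M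
      using bnd[OF \<open>f \<in> F\<close>] that by (intro AE_I2) (auto simp: indicator_def abs_mult)
    show "integrable \<mu> (\<lambda>x. indicator (X L) x * f x)"
      by (rule \<mu>.integrable_const_bound[OF b]) (use X_sets[OF that(1)] meas[OF that(2)] in auto)
    show "integrable \<nu> (\<lambda>x. indicator (X L) x * f x)"
      by (rule \<nu>.integrable_const_bound[OF b]) (use X_sets[OF that(1)] meas'[OF that(2)] sp sets in auto)
  qed
\<comment> \<open>one indicator at a time; \<open>h\<close> is arbitrary in \<open>F\<close> to absorb the powers of \<open>f\<close> in the polynomials\<close>
  have main: "(\<integral>x. indicator (X L) x * h x \<partial>\<mu>) = (\<integral>x. indicator (X L) x * h x \<partial>\<nu>)"
    if "set L \<subseteq> F \<times> UNIV" "h \<in> F" for L h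
    using that
  proof (induction L arbitrary: h)
    case Nil
    have "X [] = space \<mu>" by (auto simp: X_def)
    then have "(\<integral>x. indicator (X []) x * h x \<partial>\<mu>) = (\<integral>x. h x \<partial>\<mu>)"
      "(\<integral>x. indicator (X []) x * h x \<partial>\<nu>) = (\<integral>x. h x \<partial>\<nu>)"
      by (auto intro!: Bochner_Integration.integral_cong simp: sp)
    then show ?case using eq[OF Nil(2)] by simp
  next
    case (Cons u L)
    obtain f a where u: "u = (f, a)" by force
    have f: "f \<in> F" and L: "set L \<subseteq> F \<times> UNIV" using Cons.prems u by auto
    obtain p where p: "\<And>n. real_polynomial_function (p n :: real \<Rightarrow> real)"
      "\<And>n y. 0 \<le> y \<Longrightarrow> y \<le> 1 \<Longrightarrow> \<bar>p n y\<bar> \<le> 2"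
      "\<And>y. 0 \<le> y \<Longrightarrow> y \<le> 1 \<Longrightarrow> (\<lambda>n. p n y) \<longlonglongrightarrow> indicator {a<..} y"
      using approximate_step_by_polynomials[where a=a] by blast
    have eqp: "(\<integral>x. indicator (X L) x * (p n (f x) * h x) \<partial>\<mu>) = (\<integral>x. indicator (X L) x * (p n (f x) * h x) \<partial>\<nu>)" for n
    proof -
      obtain b k where pn: "p n = (\<lambda>y. \<Sum>i\<le>k. b i * y ^ i)"
        using p(1)[of n] unfolding real_polynomial_function_iff_sum by blast
      have *: "indicator (X L) x * (p n (f x) * h x) = (\<Sum>i\<le>k. b i * (indicator (X L) x * (f x ^ i * h x)))" for x
        by (simp add: pn sum_distrib_right sum_distrib_left algebra_simps)
      show ?thesis unfolding *
        using Cons.IH[OF L pow[OF f Cons.prems(2)]] int_F[OF L pow[OF f Cons.prems(2)]]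
        by (simp add: Bochner_Integration.integral_sum)
    qed
    have p_meas: "(\<lambda>x. p n (f x)) \<in> borel_measurable M" if "f \<in> borel_measurable M" for n M
    proof -
      have "p n \<in> borel_measurable borel"
        by (intro borel_measurable_continuous_onI continuous_on_polymonial_function)
          (use p(1) real_polynomial_function_eq in auto)
      then show ?thesis using that by measurable
    qed
    have lim: "(\<lambda>n. \<integral>x. indicator (X L) x * (p n (f x) * h x) \<partial>M) \<longlonglongrightarrow> (\<integral>x. indicator (X (u # L)) x * h x \<partial>M)"
      if "finite_measure M" "sets M = sets \<mu>" for M
    proof (rule integral_dominated_convergence[where w="\<lambda>_. 2"])
      interpret M: finite_measure M by fact
      have spM: "space M = space \<mu>" by (rule sets_eq_imp_space_eq[OF that(2)])
      have mM: "g \<in> borel_measurable M" if "g \<in> F" for g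
        using meas[OF that] by (simp add: measurable_cong_sets[OF \<open>sets M = sets \<mu>\<close> refl])
      show "integrable M (\<lambda>_. 2)" by simp
      show "(\<lambda>x. indicator (X (u # L)) x * h x) \<in> borel_measurable M"
        using X_sets[OF Cons.prems(1)] mM[OF Cons.prems(2)] that(2) by (auto intro!: borel_measurable_times)
      show "(\<lambda>x. indicator (X L) x * (p n (f x) * h x)) \<in> borel_measurable M" for n
        using X_sets[OF L] mM[OF Cons.prems(2)] p_meas[OF mM[OF f]] that(2)
        by (auto intro!: borel_measurable_times)
      show "AE x in M. (\<lambda>n. indicator (X L) x * (p n (f x) * h x)) \<longlonglongrightarrow> indicator (X (u # L)) x * h x"
      proof (rule AE_I2)
        fix x assume "x \<in> space M"
        then have x: "x \<in> space \<mu>" using spM by simp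
        have *: "indicator (X (u # L)) x = (indicator (X L) x * indicator {a<..} (f x) :: real)"
          using x by (simp add: u X_Cons indicator_def)
        show "(\<lambda>n. indicator (X L) x * (p n (f x) * h x)) \<longlonglongrightarrow> indicator (X (u # L)) x * h x"
          unfolding * mult.assoc by (intro tendsto_mult tendsto_const p(3)) (use bnd[OF f x] in auto)
      qed
      show "AE x in M. norm (indicator (X L) x * (p n (f x) * h x)) \<le> 2" for n
      proof (rule AE_I2)
        fix x assume "x \<in> space M"
        then have x: "x \<in> space \<mu>" using spM by simp
        have "\<bar>p n (f x)\<bar> * \<bar>h x\<bar> \<le> 2 * 1"
          using bnd[OF f x] bnd[OF Cons.prems(2) x] p(2) by (intro mult_mono) auto
        then show "norm (indicator (X L) x * (p n (f x) * h x)) \<le> 2"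
          by (auto simp: indicator_def abs_mult)
      qed
    qed
    show ?case
      using lim[OF fin(1) refl] lim[OF fin(2) sets] unfolding eqp by (rule LIMSEQ_unique)
  qed
  define E where "E = X ` {L. set L \<subseteq> F \<times> UNIV}"
  show ?thesis
  proof (rule measure_eqI_generator_eq[where E=E and A="\<lambda>_. space \<mu>" and \<Omega>="space \<mu>"])
    show "Int_stable E"
    proof (rule Int_stableI)
      fix A B assume "A \<in> E" "B \<in> E"
      then obtain L L' where L: "A = X L" "set L \<subseteq> F \<times> UNIV" "B = X L'" "set L' \<subseteq> F \<times> UNIV"
        by (auto simp: E_def)
      have "A \<inter> B = X (L @ L')" unfolding L(1,3) X_def set_append by blast
      then show "A \<inter> B \<in> E" unfolding E_def using L(2,4) by (intro image_eqI[of _ _ "L @ L'"]) auto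
    qed
    show "E \<subseteq> Pow (space \<mu>)" by (auto simp: E_def X_def)
    show sE: "sets \<mu> = sigma_sets (space \<mu>) E"
    proof
      have "{{x \<in> space \<mu>. a < f x} | f a. f \<in> F} \<subseteq> E"
      proof clarify
        fix f a assume "f \<in> F"
        then show "{x \<in> space \<mu>. a < f x} \<in> E"
          unfolding E_def by (intro image_eqI[of _ _ "[(f, a)]"]) (auto simp: X_def)
      qed
      then show "sets \<mu> \<subseteq> sigma_sets (space \<mu>) E"
        using gen sigma_sets_mono'[of _ E "space \<mu>"] by blast
      show "sigma_sets (space \<mu>) E \<subseteq> sets \<mu>"
        by (intro sets.sigma_sets_subset) (auto simp: E_def X_sets)
    qed
    then show "sets \<nu> = sigma_sets (space \<mu>) E" using sets by simp
    show "emeasure \<mu> A = emeasure \<nu> A" if "A \<in> E" for A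
    proof -
      obtain L where L: "A = X L" "set L \<subseteq> F \<times> UNIV" using \<open>A \<in> E\<close> by (auto simp: E_def)
      have "measure \<mu> A = measure \<nu> A"
        using main[OF L(2) one] X_sets[OF L(2)] sets L(1) by simp
      then show ?thesis by (simp add: \<mu>.emeasure_eq_measure \<nu>.emeasure_eq_measure)
    qed
    show "range (\<lambda>_. space \<mu>) \<subseteq> E"
      unfolding E_def by (auto intro!: image_eqI[of _ _ "[]"] simp: X_def)
    show "\<And>i. emeasure \<mu> (space \<mu>) \<noteq> \<infinity>" by simp
  qed simp
qed

text \<open>
  Averaging the Fourier transform over Gaussian multiples of a test function turns
  \<open>exp (\<i> \<integral>g d\<eta>)\<close> into \<open>exp (- (\<integral>g d\<eta>)\<^sup>2 / 2)\<close>. These real functions form a multiplicative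
  class, and agreement of the Fourier transforms on all of \<^const>\<open>C_c\<close> passes to their integrals.
\<close>

definition gauss_factor :: "('a \<Rightarrow> real) list \<Rightarrow> 'a measure \<Rightarrow> real" where
  "gauss_factor gs \<eta> = exp (- (\<Sum>g\<leftarrow>gs. (\<integral>x. g x \<partial>\<eta>)\<^sup>2) / 2)"

lemma gauss_factor_append: "gauss_factor (gs @ hs) \<eta> = gauss_factor gs \<eta> * gauss_factor hs \<eta>"
  by (simp add: gauss_factor_def add_divide_distrib flip: exp_add)

lemma gauss_factor_Cons:
  "gauss_factor (g # gs) \<eta> = gauss_factor gs \<eta> * exp (- ((\<integral>x. g x \<partial>\<eta>)\<^sup>2) / 2)"
  by (simp add: gauss_factor_def add_divide_distrib flip: exp_add)

lemma gauss_factor_bounds: "0 \<le> gauss_factor gs \<eta>" "gauss_factor gs \<eta> \<le> 1"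
  by (auto simp: gauss_factor_def intro!: sum_list_nonneg)

lemma measurable_gauss_factor:
  assumes "set gs \<subseteq> C_c" "sets \<mu> = sets (discrete_radon_space :: 'a::euclidean_space measure measure)"
  shows "gauss_factor gs \<in> borel_measurable \<mu>"
proof -
  have "(\<lambda>\<eta>. \<Sum>g\<leftarrow>gs. (\<integral>x. g x \<partial>\<eta>)\<^sup>2) \<in> borel_measurable discrete_radon_space"
    using assms(1)
    by (induction gs) (auto intro!: borel_measurable_add borel_measurable_power measurable_integral_discrete_radon_space)
  then have "gauss_factor gs \<in> borel_measurable discrete_radon_space"
    unfolding gauss_factor_def by measurable
  then show ?thesis by (simp add: measurable_cong_sets[OF assms(2) refl])
qed

text \<open>
  A Gaussian factor is the characteristic function of a standard normal variable \<open>t\<close>, evaluated at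
  \<open>\<integral>g d\<eta>\<close>. By Fubini, integrating out \<open>t\<close> last replaces the test function \<open>f\<close> by \<open>f + t g\<close> and removes one
  factor, so induction on the list applies.
\<close>

lemma fourier_gauss_eq:
  fixes \<mu> \<nu> :: "'a::euclidean_space measure measure"
  assumes \<mu>: "prob_space \<mu>" "sets \<mu> = sets discrete_radon_space"
    and \<nu>: "prob_space \<nu>" "sets \<nu> = sets discrete_radon_space"
    and eq: "\<And>f. f \<in> C_c \<Longrightarrow> (\<integral>\<eta>. exp (\<i> * complex_of_real (\<integral>x. f x \<partial>\<eta>)) \<partial>\<mu>) =
      (\<integral>\<eta>. exp (\<i> * complex_of_real (\<integral>x. f x \<partial>\<eta>)) \<partial>\<nu>)"
    and "set gs \<subseteq> C_c" "f \<in> C_c"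
  shows "(\<integral>\<eta>. exp (\<i> * complex_of_real (\<integral>x. f x \<partial>\<eta>)) * gauss_factor gs \<eta> \<partial>\<mu>) =
      (\<integral>\<eta>. exp (\<i> * complex_of_real (\<integral>x. f x \<partial>\<eta>)) * gauss_factor gs \<eta> \<partial>\<nu>)"
  using assms(6,7)
proof (induction gs arbitrary: f)
  case Nil
  then show ?case using eq by (simp add: gauss_factor_def)
next
  case (Cons g gs)
  have g: "g \<in> C_c" "set gs \<subseteq> C_c" using Cons.prems by auto
  have *: "(\<integral>\<eta>. exp (\<i> * complex_of_real (\<integral>x. f x \<partial>\<eta>)) * gauss_factor (g # gs) \<eta> \<partial>M) =
      (\<integral>t. (\<integral>\<eta>. exp (\<i> * complex_of_real (\<integral>x. f x + t * g x \<partial>\<eta>)) * gauss_factor gs \<eta> \<partial>M) \<partial>std_normal_distribution)"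
    if M: "prob_space M" "sets M = sets discrete_radon_space" for M
  proof -
    interpret M: prob_space M by fact
    interpret N: prob_space std_normal_distribution by (rule real_dist_normal_dist[THEN real_distribution.axioms(1)])
    interpret MN: pair_sigma_finite M std_normal_distribution ..
    interpret P: pair_prob_space M std_normal_distribution ..
    have sp: "space M = discrete_radon_measures"
      using sets_eq_imp_space_eq[OF M(2)] by (simp add: space_discrete_radon_space)
    define A where "A \<eta> = exp (\<i> * complex_of_real (\<integral>x. f x \<partial>\<eta>)) * gauss_factor gs \<eta>" for \<eta>
    have mi: "(\<lambda>\<eta>. \<integral>x. h x \<partial>\<eta>) \<in> borel_measurable M" if "h \<in> C_c" for h :: "'a \<Rightarrow> real"
      using measurable_integral_discrete_radon_space[OF that] by (simp add: measurable_cong_sets[OF M(2) refl])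
    note [measurable] = mi[OF \<open>f \<in> C_c\<close>] mi[OF g(1)] measurable_gauss_factor[OF g(2) M(2)]
    have [measurable]: "A \<in> borel_measurable M" unfolding A_def by measurable
    have normA: "norm (A \<eta>) \<le> 1" for \<eta>
      using gauss_factor_bounds[of gs \<eta>] by (simp add: A_def norm_mult)
    have int: "integrable (M \<Otimes>\<^sub>M std_normal_distribution) (\<lambda>(\<eta>, t). A \<eta> * iexp ((\<integral>x. g x \<partial>\<eta>) * t))"
    proof (rule P.integrable_const_bound[where B=1])
      show "AE x in M \<Otimes>\<^sub>M std_normal_distribution. norm (case x of (\<eta>, t) \<Rightarrow> A \<eta> * iexp ((\<integral>x. g x \<partial>\<eta>) * t)) \<le> 1"
        using normA by (intro AE_I2) (auto simp: norm_mult)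
    qed measurable
    have "(\<integral>\<eta>. exp (\<i> * complex_of_real (\<integral>x. f x \<partial>\<eta>)) * gauss_factor (g # gs) \<eta> \<partial>M) =
        (\<integral>\<eta>. A \<eta> * complex_of_real (exp (- ((\<integral>x. g x \<partial>\<eta>)\<^sup>2) / 2)) \<partial>M)"
      by (intro Bochner_Integration.integral_cong refl)
        (simp add: A_def gauss_factor_Cons)
    also have "\<dots> = (\<integral>\<eta>. (\<integral>t. A \<eta> * iexp ((\<integral>x. g x \<partial>\<eta>) * t) \<partial>std_normal_distribution) \<partial>M)"
      using fun_cong[OF char_std_normal_distribution]
      by (intro Bochner_Integration.integral_cong refl) (simp add: char_def)
    also have "\<dots> = (\<integral>t. (\<integral>\<eta>. A \<eta> * iexp ((\<integral>x. g x \<partial>\<eta>) * t) \<partial>M) \<partial>std_normal_distribution)"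
      by (rule MN.Fubini_integral[OF int, symmetric])
    also have "\<dots> = (\<integral>t. (\<integral>\<eta>. exp (\<i> * complex_of_real (\<integral>x. f x + t * g x \<partial>\<eta>)) * gauss_factor gs \<eta> \<partial>M) \<partial>std_normal_distribution)"
    proof (intro Bochner_Integration.integral_cong refl)
      fix t \<eta> assume "\<eta> \<in> space M"
      then have \<eta>: "\<eta> \<in> radon_measures" using sp discrete_imp_radon by auto
      have "(\<integral>x. f x + t * g x \<partial>\<eta>) = (\<integral>x. f x \<partial>\<eta>) + t * (\<integral>x. g x \<partial>\<eta>)"
        using integrable_radon_C_c[OF \<eta>] \<open>f \<in> C_c\<close> g by simp
      then show "A \<eta> * iexp ((\<integral>x. g x \<partial>\<eta>) * t) =
         exp (\<i> * complex_of_real (\<integral>x. f x + t * g x \<partial>\<eta>)) * gauss_factor gs \<eta>"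
        by (simp add: A_def exp_add algebra_simps)
    qed
    finally show ?thesis .
  qed
  show ?case
    unfolding *[OF \<mu>] *[OF \<nu>]
    by (intro Bochner_Integration.integral_cong refl Cons.IH C_c_add g \<open>f \<in> C_c\<close>)
qed

text \<open>
  For \<open>f \<ge> 0\<close> the Gaussian factor of \<open>f\<close> is a decreasing function of \<open>\<integral>f d\<eta>\<close>, so these factors generate
  the whole \<open>\<sigma>\<close>-algebra.
\<close>

theorem fourier_transform_determines:
  fixes \<mu> \<nu> :: "'a::euclidean_space measure measure"
  assumes \<mu>: "prob_space \<mu>" "sets \<mu> = sets discrete_radon_space"
    and \<nu>: "prob_space \<nu>" "sets \<nu> = sets discrete_radon_space"
    and eq: "\<And>f. f \<in> C_c \<Longrightarrow> (\<integral>\<eta>. exp (\<i> * complex_of_real (\<integral>x. f x \<partial>\<eta>)) \<partial>\<mu>) =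
      (\<integral>\<eta>. exp (\<i> * complex_of_real (\<integral>x. f x \<partial>\<eta>)) \<partial>\<nu>)"
  shows "\<mu> = \<nu>"
proof (rule measure_eqI_multiplicative_class[where F="gauss_factor ` {gs. set gs \<subseteq> C_c}"])
  interpret \<mu>: prob_space \<mu> by fact
  interpret \<nu>: prob_space \<nu> by fact
  show "finite_measure \<mu>" "finite_measure \<nu>" by unfold_locales
  show "sets \<nu> = sets \<mu>" using \<mu> \<nu> by simp
  have sp: "space \<mu> = discrete_radon_measures"
    using sets_eq_imp_space_eq[OF \<mu>(2)] by (simp add: space_discrete_radon_space)
  show "f \<in> borel_measurable \<mu>" if "f \<in> gauss_factor ` {gs. set gs \<subseteq> C_c}" for f
    using that \<mu>(2) measurable_gauss_factor by auto
  show "0 \<le> f x \<and> f x \<le> 1" if "f \<in> gauss_factor ` {gs. set gs \<subseteq> C_c}" for f x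
    using that gauss_factor_bounds by auto
  show "(\<lambda>_. 1) \<in> gauss_factor ` {gs. set gs \<subseteq> (C_c :: ('a \<Rightarrow> real) set)}"
    by (rule image_eqI[of _ _ "[]"]) (auto simp: gauss_factor_def[abs_def])
  show "(\<lambda>x. f x * g x) \<in> gauss_factor ` {gs. set gs \<subseteq> (C_c :: ('a \<Rightarrow> real) set)}"
    if fg: "f \<in> gauss_factor ` {gs. set gs \<subseteq> C_c}" "g \<in> gauss_factor ` {gs. set gs \<subseteq> C_c}" for f g
  proof -
    obtain gs hs where "f = gauss_factor gs" "set gs \<subseteq> C_c" "g = gauss_factor hs" "set hs \<subseteq> C_c"
      using fg by auto
    then show ?thesis by (intro image_eqI[of _ _ "gs @ hs"]) (auto simp: gauss_factor_append fun_eq_iff)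
  qed
  show "(\<integral>x. f x \<partial>\<mu>) = (\<integral>x. f x \<partial>\<nu>)" if f: "f \<in> gauss_factor ` {gs. set gs \<subseteq> C_c}" for f
  proof -
    obtain gs where gs: "f = gauss_factor gs" "set gs \<subseteq> C_c" using f by auto
    have "complex_of_real (\<integral>x. gauss_factor gs x \<partial>\<mu>) = complex_of_real (\<integral>x. gauss_factor gs x \<partial>\<nu>)"
      using fourier_gauss_eq[OF \<mu> \<nu> eq gs(2) C_c_zero] by simp
    then show ?thesis using gs by simp
  qed
  define G where "G = {{x \<in> space \<mu>. a < f x} | f a. f \<in> gauss_factor ` {gs. set gs \<subseteq> (C_c :: ('a \<Rightarrow> real) set)}}"
  define N where "N = sigma (space \<mu>) G"
  have N: "space N = space \<mu>" "sets N = sigma_sets (space \<mu>) G"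
    unfolding N_def by (auto simp: G_def intro!: space_measure_of sets_measure_of)
  have "{\<eta> \<in> discrete_radon_measures. a < (\<integral>x. f x \<partial>\<eta>)} \<in> sets N"
    if f: "f \<in> C_c" "\<And>x. 0 \<le> f x" for f :: "'a \<Rightarrow> real" and a
  proof -
    have [measurable]: "gauss_factor [f] \<in> borel_measurable N"
      by (rule borel_measurableI_greater) (use f in \<open>auto simp: N G_def intro!: sigma_sets.Basic\<close>)
    have pos: "0 \<le> (\<integral>x. f x \<partial>\<eta>)" for \<eta> by (intro integral_nonneg_AE AE_I2 f)
    have "{\<eta> \<in> discrete_radon_measures. a < (\<integral>x. f x \<partial>\<eta>)} =
      (if a < 0 then space N else {\<eta> \<in> space N. gauss_factor [f] \<eta> < exp (- (a\<^sup>2) / 2)})"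
    proof (cases "a < 0")
      case True
      then show ?thesis using pos by (force simp: N sp intro: less_le_trans)
    next
      case False
      then have "a < (\<integral>x. f x \<partial>\<eta>) \<longleftrightarrow> a\<^sup>2 < (\<integral>x. f x \<partial>\<eta>)\<^sup>2" for \<eta>
        using pos[of \<eta>] by (meson not_less power2_less_imp_less power_strict_mono pos2)
      then show ?thesis using False by (auto simp: N sp gauss_factor_def)
    qed
    also have "\<dots> \<in> sets N" by auto
    finally show ?thesis .
  qed
  then have "sigma_sets (space N) {{\<eta> \<in> discrete_radon_measures. a < (\<integral>x. f x \<partial>\<eta>)} | f a. f \<in> (C_c :: ('a \<Rightarrow> real) set) \<and> (\<forall>x. 0 \<le> f x)} \<subseteq> sets N"
    by (intro sets.sigma_sets_subset) auto
  then show "sets \<mu> \<subseteq> sigma_sets (space \<mu>)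
      {{x \<in> space \<mu>. a < f x} | f a. f \<in> gauss_factor ` {gs. set gs \<subseteq> (C_c :: ('a \<Rightarrow> real) set)}}"
    unfolding \<mu>(2) sets_discrete_radon_space using N by (simp add: sp G_def)
qed

section \<open>Change of variables under a diffeomorphism\<close>

text \<open>
  The theorem \<open>has_measure_differentiable_image\<close> concerns coordinates indexed by a well-ordered type. An
  arbitrary finite index type has a copy that carries such an order, and relabelling the coordinates
  preserves Lebesgue measure and determinants.
\<close>

typedef 'a ordered_copy = "UNIV :: 'a set"
  morphisms uncopy copy ..

lemma uncopy_copy[simp]: "uncopy (copy x) = x" and copy_uncopy[simp]: "copy (uncopy y) = y"
  by (simp_all add: copy_inverse uncopy_inverse)

lemma bij_copy: "bij copy" and bij_uncopy: "bij uncopy"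
  by (metis uncopy_copy copy_uncopy bijI')+

instance ordered_copy :: (finite) finite
proof
  have "finite (copy ` (UNIV :: 'a set))" by (rule finite_imageI) (rule finite)
  then show "finite (UNIV :: 'a ordered_copy set)" by (simp only: bij_is_surj[OF bij_copy])
qed

instantiation ordered_copy :: (finite) wellorder
begin

definition less_eq_ordered_copy :: "'a ordered_copy \<Rightarrow> 'a ordered_copy \<Rightarrow> bool" where
  "x \<le> y \<longleftrightarrow> to_nat (uncopy x) \<le> to_nat (uncopy y)"

definition less_ordered_copy :: "'a ordered_copy \<Rightarrow> 'a ordered_copy \<Rightarrow> bool" where
  "x < y \<longleftrightarrow> to_nat (uncopy x) < to_nat (uncopy y)"

instance
proof
  fix x y :: "'a ordered_copy"
  show "x = y" if "x \<le> y" "y \<le> x"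
    using that by (metis copy_uncopy less_eq_ordered_copy_def order_antisym to_nat_split)
next
  fix P :: "'a ordered_copy \<Rightarrow> bool" and a :: "'a ordered_copy"
  assume step: "\<And>x. (\<And>y. y < x \<Longrightarrow> P y) \<Longrightarrow> P x"
  show "P a"
  proof (induction a rule: measure_induct_rule[of "\<lambda>x. to_nat (uncopy x)"])
    case (less x)
    show ?case by (rule step, rule less.IH) (simp only: less_ordered_copy_def)
  qed
qed (auto simp: less_eq_ordered_copy_def less_ordered_copy_def)

end

definition relabel :: "real^'n \<Rightarrow> real^'n ordered_copy" where
  "relabel x = (\<chi> i. x $ uncopy i)"

definition unlabel :: "real^'n ordered_copy \<Rightarrow> real^'n" where
  "unlabel y = (\<chi> i. y $ copy i)"

lemma unlabel_relabel[simp]: "unlabel (relabel x) = x" and relabel_unlabel[simp]: "relabel (unlabel y) = y"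
  by (simp_all add: relabel_def unlabel_def vec_eq_iff)

lemma linear_relabel: "linear relabel" and linear_unlabel: "linear unlabel"
  by (auto intro!: linearI simp: relabel_def unlabel_def vec_eq_iff)

lemma prod_Basis_cart: "(\<Prod>b\<in>Basis. (x :: real^'n) \<bullet> b) = (\<Prod>i\<in>UNIV. x $ i)"
proof -
  have "(Basis :: (real^'n) set) = (\<lambda>i. axis i 1) ` UNIV" by (auto simp: Basis_vec_def)
  moreover have inj: "inj (\<lambda>i :: 'n. axis i (1::real))" by (auto simp: inj_on_def axis_eq_axis)
  ultimately have "(\<Prod>b\<in>Basis. x \<bullet> b) = (\<Prod>i\<in>UNIV. x \<bullet> axis i 1)"
    using prod.reindex[OF inj, of "\<lambda>b. x \<bullet> b"] by (simp add: comp_def)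
  then show ?thesis by (simp add: inner_axis)
qed

lemma relabel_measurable[measurable]: "relabel \<in> borel_measurable borel"
  by (intro borel_measurable_continuous_onI linear_continuous_on linear_conv_bounded_linear[THEN iffD1] linear_relabel)

lemma unlabel_measurable[measurable]: "unlabel \<in> borel_measurable borel"
  by (intro borel_measurable_continuous_onI linear_continuous_on linear_conv_bounded_linear[THEN iffD1] linear_unlabel)

lemma distr_lborel_relabel: "distr lborel borel (relabel :: real^'n::finite \<Rightarrow> _) = lborel"
proof (rule lborel_eqI[symmetric])
  fix l u :: "real^'n ordered_copy" assume le: "\<And>b. b \<in> Basis \<Longrightarrow> l \<bullet> b \<le> u \<bullet> b"
  have le': "l $ i \<le> u $ i" for i
    using le[of "axis i 1"] by (auto simp: inner_axis Basis_vec_def)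
  have "relabel -` box l u = box (unlabel l) (unlabel u)"
    by (auto simp: mem_box_cart relabel_def unlabel_def) (metis copy_uncopy uncopy_copy)+
  then have "emeasure (distr lborel borel relabel) (box l u) = emeasure lborel (box (unlabel l) (unlabel u))"
    by (subst emeasure_distr) auto
  also have "\<dots> = ennreal (\<Prod>b\<in>Basis. (unlabel u - unlabel l) \<bullet> b)"
  proof (rule emeasure_lborel_box)
    fix b :: "real^'n" assume "b \<in> Basis"
    then obtain i where "b = axis i 1" by (auto simp: Basis_vec_def)
    then show "unlabel l \<bullet> b \<le> unlabel u \<bullet> b" using le' by (simp add: inner_axis unlabel_def)
  qed
  also have "(\<Prod>b\<in>Basis. (unlabel u - unlabel l) \<bullet> b) = (\<Prod>i\<in>UNIV. (u - l) $ copy i)"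
    unfolding prod_Basis_cart by (simp add: unlabel_def)
  also have "\<dots> = (\<Prod>i\<in>UNIV. (u - l) $ i)"
    by (rule prod.reindex_bij_betw[OF bij_copy])
  finally show "emeasure (distr lborel borel relabel) (box l u) = ennreal (\<Prod>b\<in>Basis. (u - l) \<bullet> b)"
    by (simp add: prod_Basis_cart)
qed simp

lemma swapidseq_relabel: "swapidseq n p \<Longrightarrow> swapidseq n (copy \<circ> p \<circ> uncopy)"
proof (induction rule: swapidseq.induct)
  case id
  have "copy \<circ> id \<circ> uncopy = (id :: 'a ordered_copy \<Rightarrow> 'a ordered_copy)"
    by (rule ext) simp
  then show ?case by (simp only: swapidseq.id)
next
  case (comp_Suc n p a b)
  have "copy \<circ> (Transposition.transpose a b \<circ> p) \<circ> uncopy = Transposition.transpose (copy a) (copy b) \<circ> (copy \<circ> p \<circ> uncopy)"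
    by (auto simp: fun_eq_iff Transposition.transpose_def) (metis uncopy_copy)+
  moreover have "copy a \<noteq> copy b" using comp_Suc by (metis uncopy_copy)
  ultimately show ?case by (metis swapidseq.comp_Suc comp_Suc.IH)
qed

lemma sign_relabel:
  fixes p :: "'n::finite \<Rightarrow> 'n"
  assumes "p permutes UNIV" shows "sign (copy \<circ> p \<circ> uncopy) = sign p"
proof -
  obtain n where n: "swapidseq n p"
    using permutation_permutes[of p] assms finite unfolding permutation_def by blast
  show ?thesis
    using evenperm_unique[OF n refl] evenperm_unique[OF swapidseq_relabel[OF n] refl] by (simp add: sign_def)
qed

text \<open>
  Relabelling conjugates the permutations in the Leibniz formula, which preserves their signs.
\<close>

lemma det_relabel:
  fixes A :: "real^'n^'n"
  shows "det (\<chi> i j. A $ uncopy i $ uncopy j) = det A"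
proof -
  let ?B = "\<chi> i j. A $ uncopy i $ uncopy j"
  let ?c = "\<lambda>p. copy \<circ> p \<circ> uncopy"
  have bij: "bij_betw ?c {p. p permutes UNIV} {p. p permutes UNIV}"
  proof (rule bij_betwI[where g="\<lambda>p. uncopy \<circ> p \<circ> copy"])
    show "?c \<in> {p. p permutes UNIV} \<rightarrow> {p. p permutes UNIV}"
      by (auto intro!: bij_imp_permutes bij_comp bij_copy bij_uncopy intro: permutes_bij)
    show "(\<lambda>p. uncopy \<circ> p \<circ> copy) \<in> {p. p permutes UNIV} \<rightarrow> {p. p permutes UNIV}"
      by (auto intro!: bij_imp_permutes bij_comp bij_copy bij_uncopy intro: permutes_bij)
  qed (auto simp: fun_eq_iff)
  have "det ?B = (\<Sum>p\<in>{p. p permutes UNIV}. of_int (sign (?c p)) * (\<Prod>i\<in>UNIV. ?B $ i $ ?c p i))"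
    unfolding det_def by (rule sum.reindex_bij_betw[OF bij, symmetric])
  also have "\<dots> = det A"
    unfolding det_def
  proof (intro sum.cong refl)
    fix p :: "'n \<Rightarrow> 'n" assume p: "p \<in> {p. p permutes UNIV}"
    have "(\<Prod>i\<in>UNIV. ?B $ i $ ?c p i) = (\<Prod>i\<in>UNIV. A $ uncopy i $ p (uncopy i))" by simp
    also have "\<dots> = (\<Prod>i\<in>UNIV. A $ i $ p i)"
      by (rule prod.reindex_bij_betw[OF bij_uncopy])
    finally show "of_int (sign (?c p)) * (\<Prod>i\<in>UNIV. ?B $ i $ ?c p i) = of_int (sign p) * (\<Prod>i\<in>UNIV. A $ i $ p i)"
      using p by (simp add: sign_relabel)
  qed
  finally show ?thesis .
qed

lemma emeasure_image_wellordered: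
  fixes g :: "real^'m::{finite,wellorder} \<Rightarrow> real^'m::_"
  assumes S: "S \<in> sets borel" and gS: "g ` S \<in> sets borel" "bounded (g ` S)"
    and der: "\<And>x. (g has_derivative g' x) (at x)" and inj: "inj g"
    and meas: "(\<lambda>x. \<bar>det (matrix (g' x))\<bar>) \<in> borel_measurable borel"
  shows "emeasure lborel (g ` S) = (\<integral>\<^sup>+x. ennreal \<bar>det (matrix (g' x))\<bar> * indicator S x \<partial>lborel)"
proof -
  have lm: "g ` S \<in> lmeasurable"
    using gS by (intro bounded_set_imp_lmeasurable) auto
  have "((\<lambda>x. \<bar>det (matrix (g' x))\<bar>) has_integral measure lebesgue (g ` S)) S"
  proof (rule has_measure_differentiable_image[THEN iffD1])
    show "S \<in> sets lebesgue" using S by simp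
    show "(g has_derivative g' x) (at x within S)" for x
      using der by (rule has_derivative_at_withinI)
    show "inj_on g S" using inj by (rule inj_on_subset) auto
    show "g ` S \<in> lmeasurable \<and> measure lebesgue (g ` S) = measure lebesgue (g ` S)" using lm by simp
  qed
  from nn_integral_has_integral_lebesgue[OF _ this]
  have "(\<integral>\<^sup>+x. ennreal (indicator S x * \<bar>det (matrix (g' x))\<bar>) \<partial>lborel) = ennreal (measure lebesgue (g ` S))"
    by simp
  also have "\<dots> = emeasure lebesgue (g ` S)"
    by (rule emeasure_eq_measure2[OF lm, symmetric])
  also have "\<dots> = emeasure lborel (g ` S)" using gS(1) by (simp add: main_part_sets)
  finally have "emeasure lborel (g ` S) = (\<integral>\<^sup>+x. ennreal (indicator S x * \<bar>det (matrix (g' x))\<bar>) \<partial>lborel)" by simp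
  also have "\<dots> = (\<integral>\<^sup>+x. ennreal \<bar>det (matrix (g' x))\<bar> * indicator S x \<partial>lborel)"
    by (intro nn_integral_cong) (auto simp: indicator_def)
  finally show ?thesis .
qed

lemma emeasure_image:
  fixes g :: "real^'n \<Rightarrow> real^'n"
  assumes S: "S \<in> sets borel" and gS: "g ` S \<in> sets borel" "bounded (g ` S)"
    and der: "\<And>x. (g has_derivative g' x) (at x)" and inj: "inj g"
    and meas: "(\<lambda>x. \<bar>det (matrix (g' x))\<bar>) \<in> borel_measurable borel"
  shows "emeasure lborel (g ` S) = (\<integral>\<^sup>+x. ennreal \<bar>det (matrix (g' x))\<bar> * indicator S x \<partial>lborel)"
proof -
  define G where "G = relabel \<circ> g \<circ> unlabel"
  define G' where "G' = (\<lambda>y. relabel \<circ> g' (unlabel y) \<circ> unlabel)"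
  have img: "relabel ` A = unlabel -` A" for A :: "(real^'n) set"
    by (auto simp: image_iff) (metis relabel_unlabel unlabel_relabel)+
  have pre: "relabel -` relabel ` A = A" for A :: "(real^'n) set"
    by (auto simp: image_iff) (metis unlabel_relabel)?
  have img_borel: "relabel ` A \<in> sets borel" if "A \<in> sets borel" for A :: "(real^'n) set"
    unfolding img using measurable_sets[OF unlabel_measurable that] by simp
  have em: "emeasure lborel (relabel ` A) = emeasure lborel A" if A: "A \<in> sets borel" for A :: "(real^'n) set"
    by (subst distr_lborel_relabel[symmetric], subst emeasure_distr) (use img_borel[OF A] pre in auto)
  have detG: "det (matrix (G' y)) = det (matrix (g' (unlabel y)))" for y
  proof -
    have ax: "unlabel (axis j 1) = axis (uncopy j) 1" for j
      by (auto simp: unlabel_def vec_eq_iff axis_def)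
    have "matrix (G' y) = (\<chi> i j. matrix (g' (unlabel y)) $ uncopy i $ uncopy j)"
      by (simp add: matrix_def G'_def relabel_def ax)
    then show ?thesis by (simp add: det_relabel)
  qed
  have G_img: "G ` relabel ` S = relabel ` g ` S"
    by (simp add: G_def image_image)
  have "emeasure lborel (g ` S) = emeasure lborel (G ` relabel ` S)"
    unfolding G_img by (rule em[symmetric, OF gS(1)])
  also have "\<dots> = (\<integral>\<^sup>+y. ennreal \<bar>det (matrix (G' y))\<bar> * indicator (relabel ` S) y \<partial>lborel)"
  proof (rule emeasure_image_wellordered)
    show "relabel ` S \<in> sets borel" by (rule img_borel[OF S])
    show "G ` relabel ` S \<in> sets borel" unfolding G_img by (rule img_borel[OF gS(1)])
    show "bounded (G ` relabel ` S)" unfolding G_img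
      by (rule bounded_linear_image[OF gS(2)]) (simp add: linear_conv_bounded_linear[symmetric] linear_relabel)
    show "(G has_derivative G' y) (at y)" for y
    proof -
      have 1: "(unlabel has_derivative unlabel) (at y)"
        by (intro bounded_linear_imp_has_derivative) (simp add: linear_conv_bounded_linear[symmetric] linear_unlabel)
      have 2: "(relabel has_derivative relabel) (at z)" for z
        by (intro bounded_linear_imp_has_derivative) (simp add: linear_conv_bounded_linear[symmetric] linear_relabel)
      show ?thesis unfolding G_def G'_def
        by (rule diff_chain_at[OF 1 diff_chain_at[OF der 2]])
    qed
    show "inj G" using inj unfolding G_def inj_def by (metis comp_apply relabel_unlabel unlabel_relabel)
    show "(\<lambda>y. \<bar>det (matrix (G' y))\<bar>) \<in> borel_measurable borel"
      unfolding detG using measurable_compose[OF unlabel_measurable meas] by simp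
  qed
  also have "\<dots> = (\<integral>\<^sup>+y. ennreal \<bar>det (matrix (g' (unlabel y)))\<bar> * indicator S (unlabel y) \<partial>distr lborel borel relabel)"
    unfolding detG distr_lborel_relabel by (intro nn_integral_cong) (simp add: img indicator_def)
  also have "\<dots> = (\<integral>\<^sup>+x. ennreal \<bar>det (matrix (g' x))\<bar> * indicator S x \<partial>lborel)"
    using measurable_compose[OF unlabel_measurable meas] S
    by (subst nn_integral_distr) (auto intro!: borel_measurable_times_ennreal measurable_compose[OF unlabel_measurable])
  finally show ?thesis .
qed

lemma C_infinity_differentiable: "C_infinity f \<Longrightarrow> f differentiable at x"
  unfolding C_infinity_def by (drule spec[of _ "Suc 0"]) simp

lemma C_infinity_continuous: "C_infinity f \<Longrightarrow> continuous_on UNIV f"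
  unfolding C_infinity_def by (drule spec[of _ 0]) simp

lemma C_infinity_derivative_continuous:
  assumes "C_infinity f" shows "continuous_on UNIV (\<lambda>x. frechet_derivative f (at x) v)"
proof -
  have "C_k (Suc 0) f" using assms unfolding C_infinity_def by blast
  then show ?thesis by simp
qed

lemma Diff0_inv: "\<phi> \<in> Diff0 \<Longrightarrow> inv \<phi> \<in> Diff0"
  unfolding Diff0_def
  by (auto simp: bij_imp_bij_inv inv_inv_eq) (metis bij_is_inj inv_f_f)

lemma Diff0_continuous: "\<phi> \<in> Diff0 \<Longrightarrow> continuous_on UNIV \<phi>"
  by (auto simp: Diff0_def intro: C_infinity_continuous)

lemma Diff0_bij: "\<phi> \<in> Diff0 \<Longrightarrow> bij \<phi>"
  by (auto simp: Diff0_def)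

lemma Diff0_measurable: "\<phi> \<in> Diff0 \<Longrightarrow> \<phi> \<in> borel_measurable borel"
  by (intro borel_measurable_continuous_onI Diff0_continuous)

lemma Diff0_has_derivative:
  assumes "\<phi> \<in> Diff0" shows "(\<phi> has_derivative frechet_derivative \<phi> (at x)) (at x)"
  using assms C_infinity_differentiable frechet_derivative_works by (auto simp: Diff0_def)

lemma borel_measurable_Jac:
  assumes "\<phi> \<in> Diff0" shows "Jac \<phi> \<in> borel_measurable borel"
proof -
  have "(\<lambda>x. frechet_derivative (inv \<phi>) (at x) v $ i) \<in> borel_measurable borel" for v i
    by (intro borel_measurable_continuous_onI continuous_on_component C_infinity_derivative_continuous)
      (use assms in \<open>auto simp: Diff0_def\<close>)
  then show ?thesis
    unfolding Jac_def[abs_def] det_def matrix_def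
    by (auto intro!: borel_measurable_abs borel_measurable_sum borel_measurable_times borel_measurable_prod)
qed

lemma Jac_pos:
  assumes \<phi>: "\<phi> \<in> Diff0" shows "Jac \<phi> x > 0"
proof -
  let ?A = "frechet_derivative (inv \<phi>) (at x)" and ?B = "frechet_derivative \<phi> (at (inv \<phi> x))"
  have A: "(inv \<phi> has_derivative ?A) (at x)" by (rule Diff0_has_derivative[OF Diff0_inv[OF \<phi>]])
  have B: "(\<phi> has_derivative ?B) (at (inv \<phi> x))" by (rule Diff0_has_derivative[OF \<phi>])
  have "\<phi> \<circ> inv \<phi> = id" using Diff0_bij[OF \<phi>] by (metis bij_is_surj surj_iff)
  then have "(id has_derivative ?B \<circ> ?A) (at x)" using diff_chain_at[OF A B] by simp
  then have BA: "?B \<circ> ?A = id" using has_derivative_id has_derivative_unique by blast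
  have "matrix ?B ** matrix ?A = mat 1"
    using matrix_compose[OF has_derivative_linear[OF A] has_derivative_linear[OF B]] BA
    by (simp add: matrix_id_mat_1)
  then have "det (matrix ?B) * det (matrix ?A) = 1" by (metis det_I det_mul)
  then have "det (matrix ?A) \<noteq> 0" by auto
  then show ?thesis by (simp add: Jac_def)
qed

text \<open>
  The volume of an image is given by the Jacobian of \<open>\<phi>\<^sup>-\<^sup>1\<close> as long as the image is bounded; an arbitrary
  Borel set is exhausted by sets with bounded preimages.
\<close>

theorem distr_lborel_Diff0:
  fixes \<phi> :: "real^'n \<Rightarrow> real^'n"
  assumes \<phi>: "\<phi> \<in> Diff0"
  shows "distr lborel borel \<phi> = density lborel (\<lambda>x. ennreal (Jac \<phi> x))"
proof (rule measure_eqI)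
  let ?g = "inv \<phi>"
  note [measurable] = Diff0_measurable[OF \<phi>] Diff0_measurable[OF Diff0_inv[OF \<phi>]] borel_measurable_Jac[OF \<phi>]
  have img: "?g ` A = \<phi> -` A" for A using Diff0_bij[OF \<phi>] by (metis bij_vimage_eq_inv_image)
  let ?M = "distr lborel borel \<phi>" and ?N = "density lborel (\<lambda>x. ennreal (Jac \<phi> x))"
  have main: "emeasure ?M S = emeasure ?N S" if S[measurable]: "S \<in> sets borel" and b: "bounded (?g ` S)" for S
  proof -
    have "emeasure ?M S = emeasure lborel (?g ` S)" by (subst emeasure_distr) (auto simp: img)
    also have "\<dots> = (\<integral>\<^sup>+x. ennreal \<bar>det (matrix (frechet_derivative ?g (at x)))\<bar> * indicator S x \<partial>lborel)"
    proof (rule emeasure_image[OF S _ b])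
      show "?g ` S \<in> sets borel" unfolding img using measurable_sets[OF Diff0_measurable[OF \<phi>] S] by simp
      show "inj ?g" using Diff0_bij[OF Diff0_inv[OF \<phi>]] by (rule bij_is_inj)
      show "(\<lambda>x. \<bar>det (matrix (frechet_derivative ?g (at x)))\<bar>) \<in> borel_measurable borel"
        using borel_measurable_Jac[OF \<phi>] unfolding Jac_def[abs_def] .
    qed (rule Diff0_has_derivative[OF Diff0_inv[OF \<phi>]])
    also have "\<dots> = emeasure ?N S" by (subst emeasure_density) (auto simp flip: Jac_def)
    finally show ?thesis .
  qed
  fix S :: "(real^'n) set" assume "S \<in> sets ?M"
  then have S[measurable]: "S \<in> sets borel" by simp
  define T where "T n = S \<inter> {x. norm (?g x) \<le> real n}" for n
  have T: "T n \<in> sets borel" for n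
    unfolding T_def by measurable
  have TS: "(\<Union>n. T n) = S" by (auto simp: T_def real_arch_simple)
  have inc: "incseq T" by (auto simp: incseq_def T_def)
  have "emeasure ?M S = (SUP n. emeasure ?M (T n))"
    using SUP_emeasure_incseq[of T ?M] T inc by (simp add: TS image_subset_iff)
  also have "\<dots> = (SUP n. emeasure ?N (T n))"
    using main[OF T] by (intro SUP_cong refl) (auto simp: T_def bounded_iff)
  also have "\<dots> = emeasure ?N S"
    using SUP_emeasure_incseq[of T ?N] T inc by (simp add: TS image_subset_iff)
  finally show "emeasure ?M S = emeasure ?N S" .
qed simp

section \<open>Poisson clouds\<close>

text \<open>The Poisson distribution, including the degenerate rate \<open>0\<close>.\<close>

definition poisson0_pmf :: "real \<Rightarrow> nat pmf" where
  "poisson0_pmf c = (if c = 0 then return_pmf 0 else poisson_pmf c)"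

lemma pmf_poisson0:
  assumes "0 \<le> c" shows "pmf (poisson0_pmf c) n = c ^ n / fact n * exp (- c)"
  using assms by (cases n) (auto simp: poisson0_pmf_def)

lemma poisson0_generating_function:
  fixes z :: "'b::{real_normed_field,banach,second_countable_topology}"
  assumes "0 \<le> c"
  shows "integrable (measure_pmf (poisson0_pmf c)) (\<lambda>n. z ^ n)"
    and "(\<integral>n. z ^ n \<partial>measure_pmf (poisson0_pmf c)) = exp (of_real c * (z - 1))"
proof -
  let ?g = "\<lambda>n. pmf (poisson0_pmf c) n *\<^sub>R z ^ n"
  have g: "?g n = exp (- c) *\<^sub>R ((of_real c * z) ^ n /\<^sub>R fact n)" for n
    using assms by (simp add: pmf_poisson0 power_mult_distrib scaleR_conv_of_real field_simps)
  have sg: "?g sums (exp (- c) *\<^sub>R exp (of_real c * z))"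
    unfolding g by (intro sums_scaleR_right exp_converges)
  have ng: "summable (\<lambda>n. norm (?g n))"
    unfolding g norm_scaleR using summable_exp[of "\<bar>c\<bar> * norm z"]
    by (intro summable_mult) (simp add: norm_power norm_mult)
  have int: "integrable (count_space UNIV) ?g"
    by (simp only: integrable_count_space_nat_iff ng)
  have d: "measure_pmf (poisson0_pmf c) = density (count_space UNIV) (\<lambda>n. ennreal (pmf (poisson0_pmf c) n))"
    by (rule measure_pmf_eq_density)
  show "integrable (measure_pmf (poisson0_pmf c)) (\<lambda>n. z ^ n)"
    unfolding d by (subst integrable_density) (use int in auto)
  have "(\<integral>n. z ^ n \<partial>measure_pmf (poisson0_pmf c)) = (\<integral>n. ?g n \<partial>count_space UNIV)"
    unfolding d by (subst integral_density) auto
  also have "\<dots> = exp (- c) *\<^sub>R exp (of_real c * z)"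
    using sums_integral_count_space_nat[OF int] sg by (rule sums_unique2)
  also have "\<dots> = exp (of_real (- c)) * exp (of_real c * z)"
    by (simp only: scaleR_conv_of_real exp_of_real)
  also have "\<dots> = exp (of_real c * (z - 1))"
    by (subst exp_add_commuting[symmetric]) (auto simp: algebra_simps)
  finally show "(\<integral>n. z ^ n \<partial>measure_pmf (poisson0_pmf c)) = exp (of_real c * (z - 1))" .
qed

lemma poisson0_mean:
  assumes "0 \<le> c"
  shows "(\<integral>\<^sup>+n. of_nat n \<partial>measure_pmf (poisson0_pmf c)) = ennreal c"
proof -
  let ?g = "\<lambda>n. exp (- c) * (real n * (c ^ n / fact n))"
  have "(\<lambda>n. c * (c ^ n / fact n)) sums (c * exp c)"
    using sums_mult[OF exp_converges[of c], of c] by (simp add: field_simps)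
  then have "(\<lambda>n. real (Suc n) * (c ^ Suc n / fact (Suc n))) sums (c * exp c)"
    by (simp add: field_simps del: of_nat_Suc)
  then have "(\<lambda>n. real n * (c ^ n / fact n)) sums (c * exp c)"
    by (subst (asm) sums_Suc_iff) simp
  then have "?g sums (exp (- c) * (c * exp c))" by (rule sums_mult)
  moreover have "exp (- c) * (c * exp c) = c" by (simp add: exp_minus)
  ultimately have s: "?g sums c" by metis
  have "(\<integral>\<^sup>+n. of_nat n \<partial>measure_pmf (poisson0_pmf c)) =
      (\<integral>\<^sup>+n. ennreal (pmf (poisson0_pmf c) n) * of_nat n \<partial>count_space UNIV)"
    by (rule nn_integral_measure_pmf)
  also have "\<dots> = (\<Sum>n. ennreal (?g n))"
    using assms by (auto simp: nn_integral_count_space_nat pmf_poisson0 ennreal_of_nat_eq_real_of_nat mult.commute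
        simp flip: ennreal_mult' intro!: suminf_cong arg_cong[where f=ennreal])
  also have "\<dots> = ennreal c"
    using s assms by (intro suminf_ennreal_eq) auto
  finally show ?thesis .
qed

lemma (in product_prob_space) integral_prod_components:
  fixes f :: "'i \<Rightarrow> 'a \<Rightarrow> 'c::{real_normed_field,banach,second_countable_topology}"
  assumes J: "finite J" "J \<subseteq> I" and f: "\<And>i. i \<in> J \<Longrightarrow> integrable (M i) (f i)"
  shows "integrable (PiM I M) (\<lambda>\<omega>. \<Prod>i\<in>J. f i (\<omega> i))"
    and "(\<integral>\<omega>. (\<Prod>i\<in>J. f i (\<omega> i)) \<partial>PiM I M) = (\<Prod>i\<in>J. integral\<^sup>L (M i) (f i))"
proof -
  have d: "distr (PiM I M) (PiM J M) (\<lambda>x. restrict x J) = PiM J M"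
    by (rule distr_PiM_restrict_finite[OF J])
  have r[measurable]: "(\<lambda>x. restrict x J) \<in> measurable (PiM I M) (PiM J M)"
    by (rule measurable_restrict_subset[OF J(2)])
  have i: "integrable (PiM J M) (\<lambda>\<omega>. \<Prod>i\<in>J. f i (\<omega> i))"
    by (rule product_integrable_prod[OF J(1) f])
  have *: "(\<Prod>i\<in>J. f i (restrict \<omega> J i)) = (\<Prod>i\<in>J. f i (\<omega> i))" for \<omega>
    by (intro prod.cong) auto
  show "integrable (PiM I M) (\<lambda>\<omega>. \<Prod>i\<in>J. f i (\<omega> i))"
    using integrable_distr[OF r, of "\<lambda>\<omega>. \<Prod>i\<in>J. f i (\<omega> i)"] i unfolding d * by simp
  have "(\<integral>\<omega>. (\<Prod>i\<in>J. f i (\<omega> i)) \<partial>PiM J M) = (\<integral>\<omega>. (\<Prod>i\<in>J. f i (restrict \<omega> J i)) \<partial>PiM I M)"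
    using integral_distr[OF r borel_measurable_integrable[OF i]] unfolding d .
  then show "(\<integral>\<omega>. (\<Prod>i\<in>J. f i (\<omega> i)) \<partial>PiM I M) = (\<Prod>i\<in>J. integral\<^sup>L (M i) (f i))"
    unfolding * using product_integral_prod[OF J(1) f] by simp
qed

text \<open>
  A Poisson point process with intensity \<open>\<Sum>k. c k \<cdot> q k\<close>: for every \<open>k\<close>, a Poisson number \<open>N k\<close>
  of mean \<open>c k\<close> of independent points with law \<open>q k\<close>. The points are drawn for all indices
  \<open>(k, j)\<close>, and those with \<open>j < N k\<close> are kept; so the counts are independent of the positions.
\<close>

locale poisson_cloud =
  fixes c :: "nat \<Rightarrow> real" and q :: "nat \<Rightarrow> 'z measure" and M :: "'z measure"
  assumes c_nonneg: "\<And>k. 0 \<le> c k"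
    and q_prob: "\<And>k. prob_space (q k)"
    and q_sets: "\<And>k. sets (q k) = sets M"
begin

definition counts :: "(nat \<Rightarrow> nat) measure" where
  "counts = PiM UNIV (\<lambda>k. measure_pmf (poisson0_pmf (c k)))"

definition marks :: "(nat \<times> nat \<Rightarrow> 'z) measure" where
  "marks = PiM UNIV (\<lambda>i. q (fst i))"

definition \<Omega> :: "((nat \<Rightarrow> nat) \<times> (nat \<times> nat \<Rightarrow> 'z)) measure" where
  "\<Omega> = counts \<Otimes>\<^sub>M marks"

sublocale CC: product_prob_space "\<lambda>k. measure_pmf (poisson0_pmf (c k))" UNIV
  by unfold_locales

sublocale QQ: product_prob_space "\<lambda>i :: nat \<times> nat. q (fst i)" UNIV
proof -
  interpret q: prob_space "q k" for k by (rule q_prob)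
  show "product_prob_space (\<lambda>i :: nat \<times> nat. q (fst i))"
    by unfold_locales
qed

sublocale C: prob_space counts unfolding counts_def by (rule CC.prob_space_axioms)
sublocale Q: prob_space marks unfolding marks_def by (rule QQ.prob_space_axioms)
sublocale CQ: pair_prob_space counts marks ..
sublocale P: prob_space \<Omega> unfolding \<Omega>_def by (rule CQ.prob_space_axioms)

lemma measurable_q: "f \<in> measurable (q k) N \<longleftrightarrow> f \<in> measurable M N"
  by (simp add: measurable_cong_sets[OF q_sets refl])

lemma measurable_count[measurable]: "(\<lambda>\<omega>. fst \<omega> k) \<in> measurable \<Omega> (count_space UNIV)"
proof -
  have "(\<lambda>N. N k) \<in> measurable counts (measure_pmf (poisson0_pmf (c k)))"
    unfolding counts_def by (rule measurable_component_singleton) simp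
  then have "(\<lambda>N. N k) \<in> measurable counts (count_space UNIV)"
    by (simp add: measurable_cong_sets[OF refl sets_measure_pmf_count_space])
  then show ?thesis unfolding \<Omega>_def by measurable
qed

lemma measurable_mark[measurable]: "(\<lambda>\<omega>. snd \<omega> i) \<in> measurable \<Omega> M"
proof -
  have "(\<lambda>Z. Z i) \<in> measurable marks (q (fst i))"
    unfolding marks_def by (rule measurable_component_singleton) simp
  then have "(\<lambda>Z. Z i) \<in> measurable marks M"
    by (simp add: measurable_cong_sets[OF refl q_sets])
  then show ?thesis unfolding \<Omega>_def by measurable
qed

lemma space_\<Omega>_mark: "\<omega> \<in> space \<Omega> \<Longrightarrow> snd \<omega> i \<in> space M"
  using measurable_space[OF measurable_mark] .

lemma AE_marks:
  assumes "AE Z in marks. P Z" shows "AE \<omega> in \<Omega>. P (snd \<omega>)"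
proof -
  obtain N where N: "N \<in> null_sets marks" "{Z \<in> space marks. \<not> P Z} \<subseteq> N"
    using assms by (auto elim: AE_E simp: null_sets_def)
  have "space counts \<times> N \<in> null_sets (counts \<Otimes>\<^sub>M marks)"
    using N by (auto simp: null_sets_def Q.emeasure_pair_measure_Times)
  then show ?thesis unfolding \<Omega>_def
    by (rule AE_I') (use N in \<open>auto simp: space_pair_measure\<close>)
qed

subsection \<open>Multiplicative functionals\<close>

definition cloud_prod :: "nat \<Rightarrow> (nat \<Rightarrow> 'z \<Rightarrow> 'c::comm_monoid_mult) \<Rightarrow> (nat \<Rightarrow> nat) \<times> (nat \<times> nat \<Rightarrow> 'z) \<Rightarrow> 'c" where
  "cloud_prod n w \<omega> = (\<Prod>k<n. \<Prod>j<fst \<omega> k. w k (snd \<omega> (k, j)))"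

lemma measurable_cloud_prod:
  fixes w :: "nat \<Rightarrow> 'z \<Rightarrow> 'c::{real_normed_field,second_countable_topology}"
  assumes "\<And>k. w k \<in> borel_measurable M"
  shows "cloud_prod n w \<in> borel_measurable \<Omega>"
proof -
  have "(\<lambda>\<omega>. \<Prod>j<fst \<omega> k. w k (snd \<omega> (k, j))) \<in> borel_measurable \<Omega>" for k
  proof (rule measurable_compose_countable[where f="\<lambda>m \<omega>. \<Prod>j<m. w k (snd \<omega> (k, j))" and g="\<lambda>\<omega>. fst \<omega> k"])
    show "(\<lambda>\<omega>. \<Prod>j<m. w k (snd \<omega> (k, j))) \<in> borel_measurable \<Omega>" for m
      using assms by measurable
  qed measurable
  then show ?thesis unfolding cloud_prod_def[abs_def] by measurable
qed

text \<open>
  Given the counts, the factors are independent, which leaves a power of \<open>\<integral>w k dq\<close> with a Poisson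
  exponent; the generating function of the Poisson distribution turns it into an exponential.
\<close>

theorem
  fixes w :: "nat \<Rightarrow> 'z \<Rightarrow> 'c::{real_normed_field,banach,second_countable_topology}"
  assumes w: "\<And>k. integrable (q k) (w k)"
  shows integrable_cloud_prod: "integrable \<Omega> (cloud_prod n w)"
    and integral_cloud_prod: "(\<integral>\<omega>. cloud_prod n w \<omega> \<partial>\<Omega>) =
      (\<Prod>k<n. exp (of_real (c k) * ((\<integral>z. w k z \<partial>q k) - 1)))"
proof -
  have wM: "w k \<in> borel_measurable M" for k
    using borel_measurable_integrable[OF w[of k]] by (simp add: measurable_q)
  have inner: "integrable marks (\<lambda>Z. cloud_prod n v (N, Z))"
    "(\<integral>Z. cloud_prod n v (N, Z) \<partial>marks) = (\<Prod>k<n. (\<integral>z. v k z \<partial>q k) ^ N k)"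
    if v: "\<And>k. integrable (q k) (v k)" for N and v :: "nat \<Rightarrow> 'z \<Rightarrow> 'd::{real_normed_field,banach,second_countable_topology}"
  proof -
    define J where "J = Sigma {..<n} (\<lambda>k. {..<N k})"
    have J: "finite J" by (auto simp: J_def)
    have eq: "cloud_prod n v (N, Z) = (\<Prod>i\<in>J. v (fst i) (Z i))" for Z
      by (simp add: cloud_prod_def J_def prod.Sigma case_prod_beta)
    have fJ: "integrable (q (fst i)) (v (fst i))" for i :: "nat \<times> nat" by (rule v)
    show "integrable marks (\<lambda>Z. cloud_prod n v (N, Z))"
      unfolding eq marks_def by (rule QQ.integral_prod_components[OF J _ fJ]) auto
    have "(\<integral>Z. cloud_prod n v (N, Z) \<partial>marks) = (\<Prod>i\<in>J. \<integral>z. v (fst i) z \<partial>q (fst i))"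
      unfolding eq marks_def by (rule QQ.integral_prod_components[OF J _ fJ]) auto
    also have "\<dots> = (\<Prod>k<n. \<Prod>j<N k. \<integral>z. v k z \<partial>q k)"
      unfolding J_def by (subst prod.Sigma) (auto simp: case_prod_beta)
    finally show "(\<integral>Z. cloud_prod n v (N, Z) \<partial>marks) = (\<Prod>k<n. (\<integral>z. v k z \<partial>q k) ^ N k)"
      by simp
  qed
  have outer: "integrable counts (\<lambda>N. \<Prod>k<n. a k ^ N k)"
    "(\<integral>N. (\<Prod>k<n. a k ^ N k) \<partial>counts) = (\<Prod>k<n. exp (of_real (c k) * (a k - 1)))"
    for a :: "nat \<Rightarrow> 'd::{real_normed_field,banach,second_countable_topology}"
    using CC.integral_prod_components[of "{..<n}" "\<lambda>k N. a k ^ N"]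
    unfolding counts_def by (auto simp only: poisson0_generating_function[OF c_nonneg])
  have nrm: "norm (cloud_prod n w \<omega>) = cloud_prod n (\<lambda>k z. norm (w k z)) \<omega>" for \<omega>
    by (simp add: cloud_prod_def prod_norm)
  show int: "integrable \<Omega> (cloud_prod n w)"
    unfolding \<Omega>_def
  proof (rule CQ.Fubini_integrable)
    show "cloud_prod n w \<in> borel_measurable (counts \<Otimes>\<^sub>M marks)"
      using measurable_cloud_prod[of w n] wM by (simp add: \<Omega>_def)
    show "integrable counts (\<lambda>N. \<integral>Z. norm (cloud_prod n w (N, Z)) \<partial>marks)"
      unfolding nrm by (subst inner(2)) (use w outer in auto)
    show "AE N in counts. integrable marks (\<lambda>Z. cloud_prod n w (N, Z))"
      using inner(1)[OF w] by auto
  qed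
  have "(\<integral>\<omega>. cloud_prod n w \<omega> \<partial>\<Omega>) = (\<integral>N. (\<integral>Z. cloud_prod n w (N, Z) \<partial>marks) \<partial>counts)"
    using CQ.integral_fst'[of "cloud_prod n w"] int by (simp add: \<Omega>_def)
  also have "\<dots> = (\<Prod>k<n. exp (of_real (c k) * ((\<integral>z. w k z \<partial>q k) - 1)))"
    unfolding inner(2)[OF w] by (rule outer(2))
  finally show "(\<integral>\<omega>. cloud_prod n w \<omega> \<partial>\<Omega>) = (\<Prod>k<n. exp (of_real (c k) * ((\<integral>z. w k z \<partial>q k) - 1)))" .
qed

subsection \<open>Additive functionals\<close>

definition cloud_sum :: "('z \<Rightarrow> ennreal) \<Rightarrow> (nat \<Rightarrow> nat) \<times> (nat \<times> nat \<Rightarrow> 'z) \<Rightarrow> ennreal" where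
  "cloud_sum h \<omega> = (\<Sum>k. \<Sum>j<fst \<omega> k. h (snd \<omega> (k, j)))"

lemma measurable_cloud_part:
  fixes h :: "'z \<Rightarrow> 'c::{second_countable_topology,topological_comm_monoid_add}"
  assumes "h \<in> borel_measurable M"
  shows "(\<lambda>\<omega>. \<Sum>j<fst \<omega> k. h (snd \<omega> (k, j))) \<in> borel_measurable \<Omega>"
proof (rule measurable_compose_countable[where f="\<lambda>m \<omega>. \<Sum>j<m. h (snd \<omega> (k, j))" and g="\<lambda>\<omega>. fst \<omega> k"])
  show "(\<lambda>\<omega>. \<Sum>j<m. h (snd \<omega> (k, j))) \<in> borel_measurable \<Omega>" for m
    by (intro borel_measurable_sum measurable_compose[OF measurable_mark assms])
qed measurable

lemma measurable_cloud_sum: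
  assumes "h \<in> borel_measurable M" shows "cloud_sum h \<in> borel_measurable \<Omega>"
proof -
  note [measurable] = measurable_cloud_part[OF assms]
  show ?thesis unfolding cloud_sum_def[abs_def] by measurable
qed

text \<open>
  Campbell's formula for the intensity \<open>\<Sum>k. c k \<cdot> q k\<close>.
\<close>

theorem nn_integral_cloud_sum:
  assumes h: "h \<in> borel_measurable M"
  shows "(\<integral>\<^sup>+\<omega>. cloud_sum h \<omega> \<partial>\<Omega>) = (\<Sum>k. ennreal (c k) * (\<integral>\<^sup>+z. h z \<partial>q k))"
proof -
  have part: "(\<integral>\<^sup>+\<omega>. (\<Sum>j<fst \<omega> k. h (snd \<omega> (k, j))) \<partial>\<Omega>) = ennreal (c k) * (\<integral>\<^sup>+z. h z \<partial>q k)" for k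
  proof -
    have mark: "(\<lambda>Z. Z i) \<in> measurable marks (q (fst i))" for i
      unfolding marks_def by (rule measurable_component_singleton) simp
    have hq: "h \<in> borel_measurable (q l)" for l using h by (simp add: measurable_q)
    have one: "(\<integral>\<^sup>+Z. h (Z (k, j)) \<partial>marks) = (\<integral>\<^sup>+z. h z \<partial>q k)" for j
    proof -
      have "distr marks (q (fst (k, j))) (\<lambda>Z. Z (k, j)) = q (fst (k, j))"
        unfolding marks_def by (rule QQ.PiM_component) simp
      then show ?thesis using nn_integral_distr[OF mark[of "(k, j)"], of h] hq by simp
    qed
    have "(\<integral>\<^sup>+\<omega>. (\<Sum>j<fst \<omega> k. h (snd \<omega> (k, j))) \<partial>\<Omega>) =
        (\<integral>\<^sup>+N. (\<integral>\<^sup>+Z. (\<Sum>j<N k. h (Z (k, j))) \<partial>marks) \<partial>counts)"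
      using Q.nn_integral_fst[of "\<lambda>\<omega>. \<Sum>j<fst \<omega> k. h (snd \<omega> (k, j))" counts] measurable_cloud_part[OF h, of k]
      by (simp add: \<Omega>_def)
    also have "\<dots> = (\<integral>\<^sup>+N. of_nat (N k) * (\<integral>\<^sup>+z. h z \<partial>q k) \<partial>counts)"
      by (intro nn_integral_cong, subst nn_integral_sum)
        (use measurable_compose[OF mark hq] in \<open>auto simp: one\<close>)
    also have "\<dots> = (\<integral>\<^sup>+m. of_nat m * (\<integral>\<^sup>+z. h z \<partial>q k) \<partial>measure_pmf (poisson0_pmf (c k)))"
    proof -
      have d: "distr counts (measure_pmf (poisson0_pmf (c k))) (\<lambda>N. N k) = measure_pmf (poisson0_pmf (c k))"
        unfolding counts_def by (rule CC.PiM_component) simp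
      have m: "(\<lambda>N. N k) \<in> measurable counts (measure_pmf (poisson0_pmf (c k)))"
        unfolding counts_def by (rule measurable_component_singleton) simp
      show ?thesis by (subst d[symmetric], subst nn_integral_distr[OF m]) auto
    qed
    also have "\<dots> = ennreal (c k) * (\<integral>\<^sup>+z. h z \<partial>q k)"
      by (subst nn_integral_multc) (auto simp: poisson0_mean c_nonneg)
    finally show ?thesis .
  qed
  show ?thesis
    unfolding cloud_sum_def
    by (subst nn_integral_suminf) (auto intro!: measurable_cloud_part h simp: part)
qed

text \<open>
  Two positions are independent and have laws without atoms, so Fubini's theorem excludes coincidences.
  Distinctness makes the atoms of the random measure correspond one to one to the points of the cloud,
  so that sums over points become functions of the measure.
\<close>

theorem AE_distinct_marks:
  fixes \<xi> :: "'z \<Rightarrow> 'x::euclidean_space"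
  assumes \<xi>[measurable]: "\<xi> \<in> borel_measurable M" and diffuse: "\<And>k y. AE z in q k. \<xi> z \<noteq> y"
  shows "AE \<omega> in \<Omega>. \<forall>i i'. i \<noteq> i' \<longrightarrow> \<xi> (snd \<omega> i) \<noteq> \<xi> (snd \<omega> i')"
proof -
  have "AE Z in marks. \<xi> (Z i) \<noteq> \<xi> (Z i')" if "i \<noteq> i'" for i i'
  proof -
    define J where "J = insert i {i'}"
    have J: "finite J" "i \<in> J" "i' \<in> J" "J \<subseteq> UNIV" by (auto simp: J_def)
    have comp: "(\<lambda>Z. Z j) \<in> measurable (PiM J (\<lambda>i. q (fst i))) M" if "j \<in> J" for j
      using measurable_component_singleton[OF that, of "\<lambda>i. q (fst i)"]
      by (simp add: measurable_cong_sets[OF refl q_sets])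
    note [measurable] = comp[OF J(2)] comp[OF J(3)]
    let ?g = "\<lambda>Z. indicator {0} (\<xi> (Z i) - \<xi> (Z i')) :: ennreal"
    have g: "?g \<in> borel_measurable (PiM J (\<lambda>i. q (fst i)))" by measurable
    have "(\<integral>\<^sup>+Z. ?g Z \<partial>PiM J (\<lambda>i. q (fst i))) =
       (\<integral>\<^sup>+Z. (\<integral>\<^sup>+z. ?g (Z(i := z)) \<partial>q (fst i)) \<partial>PiM {i'} (\<lambda>i. q (fst i)))"
      unfolding J_def
      by (rule QQ.product_nn_integral_insert) (use g that in \<open>auto simp: J_def\<close>)
    also have "\<dots> = (\<integral>\<^sup>+Z. 0 \<partial>PiM {i'} (\<lambda>i. q (fst i)))"
    proof (intro nn_integral_cong)
      fix Z
      have "AE z in q (fst i). \<xi> z \<noteq> \<xi> (Z i')" by (rule diffuse)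
      then have "(\<integral>\<^sup>+z. ?g (Z(i := z)) \<partial>q (fst i)) = (\<integral>\<^sup>+z. 0 \<partial>q (fst i))"
        using that by (intro nn_integral_cong_AE) (auto simp: indicator_def)
      then show "(\<integral>\<^sup>+z. ?g (Z(i := z)) \<partial>q (fst i)) = 0" by simp
    qed
    finally have "(\<integral>\<^sup>+Z. ?g Z \<partial>PiM J (\<lambda>i. q (fst i))) = 0" by simp
    then have "AE Z in PiM J (\<lambda>i. q (fst i)). ?g Z = 0"
      by (subst (asm) nn_integral_0_iff_AE[OF g])
    then have "AE Z in PiM J (\<lambda>i. q (fst i)). \<xi> (Z i) \<noteq> \<xi> (Z i')"
      by eventually_elim (auto simp: indicator_def)
    then have "AE Z in distr marks (PiM J (\<lambda>i. q (fst i))) (\<lambda>Z. restrict Z J). \<xi> (Z i) \<noteq> \<xi> (Z i')"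
      unfolding marks_def QQ.distr_PiM_restrict_finite[OF J(1,4)] .
    then have "AE Z in marks. \<xi> (restrict Z J i) \<noteq> \<xi> (restrict Z J i')"
      by (rule AE_distrD[rotated]) (auto simp: marks_def intro!: measurable_restrict_subset)
    then show ?thesis using J by simp
  qed
  then have "AE Z in marks. \<forall>i i'. i \<noteq> i' \<longrightarrow> \<xi> (Z i) \<noteq> \<xi> (Z i')"
    by (simp add: AE_all_countable)
  then show ?thesis by (rule AE_marks)
qed

end

section \<open>Decomposing an intensity\<close>

text \<open>
  A \<open>\<sigma>\<close>-finite measure is cut into pieces of finite mass, and each piece is a multiple of a
  probability measure. For a piece of mass \<open>0\<close> any law will do; taking that of a nonzero piece
  keeps every law absolutely continuous with respect to \<open>m\<close>.
\<close>

locale cut_intensity =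
  fixes m :: "'z measure" and B :: "nat \<Rightarrow> 'z set"
  assumes B_sets[measurable]: "\<And>k. B k \<in> sets m" and B_disjoint: "disjoint_family B"
    and B_space: "(\<Union>k. B k) = space m" and B_finite: "\<And>k. emeasure m (B k) < \<infinity>"
    and nonzero: "emeasure m (space m) \<noteq> 0"
begin

definition "c k = measure m (B k)"

definition "k0 = (SOME k. c k \<noteq> 0)"

definition "q k = (if c k = 0 then uniform_measure m (B k0) else uniform_measure m (B k))"

lemma emeasure_B: "emeasure m (B k) = ennreal (c k)"
  using B_finite[of k] by (simp add: c_def emeasure_eq_ennreal_measure)

lemma set_integrable_one:
  "set_integrable m (B j) (\<lambda>z. 1 :: 'c::{real_normed_field,banach,second_countable_topology})"
  using B_finite[of j] by (simp add: set_integrable_def integrable_indicator_iff)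

lemma c_k0: "c k0 \<noteq> 0"
proof -
  have "\<exists>k. c k \<noteq> 0"
  proof (rule ccontr)
    assume "\<nexists>k. c k \<noteq> 0"
    then have "emeasure m (\<Union>k. B k) = 0"
      using B_sets by (intro emeasure_UN_eq_0) (auto simp: emeasure_B)
    then show False using nonzero by (simp add: B_space)
  qed
  then show ?thesis unfolding k0_def by (rule someI_ex)
qed

definition "piece k = (if c k = 0 then k0 else k)"

lemma q_eq: "q k = uniform_measure m (B (piece k))" and c_piece: "c (piece k) \<noteq> 0"
  using c_k0 by (auto simp: q_def piece_def)

lemma c_nonneg: "0 \<le> c k" by (simp add: c_def)

sublocale poisson_cloud c q m
proof (rule poisson_cloud.intro)
  show "0 \<le> c k" for k by (rule c_nonneg)
  show "prob_space (q k)" for k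
    unfolding q_eq by (intro prob_space_uniform_measure) (use c_piece[of k] c_nonneg in \<open>auto simp: emeasure_B\<close>)
  show "sets (q k) = sets m" for k by (simp add: q_eq)
qed

lemma nn_integral_q:
  assumes h: "h \<in> borel_measurable m"
  shows "ennreal (c k) * (\<integral>\<^sup>+z. h z \<partial>q k) = (\<integral>\<^sup>+z. h z * indicator (B k) z \<partial>m)"
proof (cases "c k = 0")
  case True
  then have "AE z in m. z \<notin> B k"
    using emeasure_B[of k] by (intro AE_not_in) (auto simp: null_sets_def)
  then have "(\<integral>\<^sup>+z. h z * indicator (B k) z \<partial>m) = (\<integral>\<^sup>+z. 0 \<partial>m)"
    by (intro nn_integral_cong_AE) (auto simp: indicator_def)
  then show ?thesis using True by simp
next
  case False
  then have "(\<integral>\<^sup>+z. h z \<partial>q k) = (\<integral>\<^sup>+z. h z * indicator (B k) z \<partial>m) / ennreal (c k)"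
    using h by (simp add: q_def nn_integral_uniform_measure emeasure_B)
  then show ?thesis using False c_nonneg[of k]
    by (simp add: ennreal_times_divide mult.commute[of "ennreal (c k)"] mult_divide_eq_ennreal)
qed

lemma suminf_nn_integral_q:
  assumes h: "h \<in> borel_measurable m"
  shows "(\<Sum>k. ennreal (c k) * (\<integral>\<^sup>+z. h z \<partial>q k)) = (\<integral>\<^sup>+z. h z \<partial>m)"
proof -
  have "(\<Sum>k. ennreal (c k) * (\<integral>\<^sup>+z. h z \<partial>q k)) = (\<integral>\<^sup>+z. (\<Sum>k. h z * indicator (B k) z) \<partial>m)"
    unfolding nn_integral_q[OF h] using h by (intro nn_integral_suminf[symmetric]) auto
  also have "\<dots> = (\<integral>\<^sup>+z. h z \<partial>m)"
  proof (intro nn_integral_cong)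
    fix z assume "z \<in> space m"
    then obtain k where "z \<in> B k" using B_space by auto
    then show "(\<Sum>k. h z * indicator (B k) z) = h z"
      using suminf_cmult_indicator[OF B_disjoint, of z k "\<lambda>_. h z"] by simp
  qed
  finally show ?thesis .
qed

lemma campbell:
  "h \<in> borel_measurable m \<Longrightarrow> (\<integral>\<^sup>+\<omega>. cloud_sum h \<omega> \<partial>\<Omega>) = (\<integral>\<^sup>+z. h z \<partial>m)"
  by (simp add: nn_integral_cloud_sum suminf_nn_integral_q)

text \<open>
  The exponents of the product formula for the laws \<open>q k\<close> become integrals with respect to \<open>m\<close>. This
  includes pieces of mass \<open>0\<close>, where \<open>q k\<close> lives elsewhere but both sides vanish.
\<close>

lemma
  fixes h :: "'z \<Rightarrow> 'c::{real_normed_field,banach,second_countable_topology}"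
  assumes h: "\<And>j. set_integrable m (B j) h"
  shows integrable_q: "integrable (q k) h"
    and integral_q: "of_real (c k) * ((\<integral>z. h z \<partial>q k) - 1) = (LINT z:B k|m. h z - 1)"
proof -
  have qd: "q k = density m (\<lambda>z. ennreal (indicator (B (piece k)) z / c (piece k)))"
    unfolding q_eq uniform_measure_def
    using c_piece[of k] c_nonneg[of "piece k"]
    by (intro arg_cong2[where f=density] ext refl)
       (auto simp: emeasure_B indicator_def divide_ennreal simp flip: ennreal_1)
  have hm: "h \<in> borel_measurable m"
  proof -
    have "(\<lambda>z. indicator (B j) z *\<^sub>R h z) \<in> borel_measurable m" for j
      using h[of j] by (auto simp: set_integrable_def)
    then have "(\<lambda>z. (\<Sum>j<n. indicator (B j) z *\<^sub>R h z)) \<in> borel_measurable m" for n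
      by measurable
    then show ?thesis
    proof (rule borel_measurable_LIMSEQ_metric)
      fix z assume "z \<in> space m"
      then obtain j where j: "z \<in> B j" using B_space by auto
      then have "(\<Sum>j<n. indicator (B j) z *\<^sub>R h z) = h z" if "n > j" for n
      proof -
        have "(\<Sum>j<n. indicator (B j) z *\<^sub>R h z) = (\<Sum>i<n. if i = j then h z else 0)"
          using B_disjoint j by (intro sum.cong refl) (auto simp: disjoint_family_on_def indicator_def)
        then show ?thesis using that by simp
      qed
      then have "eventually (\<lambda>n. (\<Sum>j<n. indicator (B j) z *\<^sub>R h z) = h z) sequentially"
        unfolding eventually_sequentially by (intro exI[of _ "Suc j"]) auto
      then show "(\<lambda>n. \<Sum>j<n. indicator (B j) z *\<^sub>R h z) \<longlonglongrightarrow> h z" by (rule tendsto_eventually)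
    qed
  qed
  have eq: "(indicator (B (piece k)) z / c (piece k)) *\<^sub>R h z = (1 / c (piece k)) *\<^sub>R (indicator (B (piece k)) z *\<^sub>R h z)" for z
    by simp
  show int: "integrable (q k) h"
    unfolding qd using hm h[of "piece k"] c_nonneg
    by (subst integrable_density) (auto simp: eq set_integrable_def simp del: scaleR_scaleR)
  have "of_real (c k) * (\<integral>z. h z \<partial>q k) = (LINT z:B k|m. h z)"
  proof (cases "c k = 0")
    case True
    then have "AE z in m. z \<notin> B k"
      using emeasure_B[of k] by (intro AE_not_in) (auto simp: null_sets_def)
    then have "(LINT z:B k|m. h z) = (\<integral>z. 0 \<partial>m)"
      unfolding set_lebesgue_integral_def using hm by (intro integral_cong_AE) (auto simp: indicator_def)
    then show ?thesis using True by simp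
  next
    case False
    then have p: "piece k = k" by (simp add: piece_def)
    have "(\<integral>z. h z \<partial>q k) = (\<integral>z. (indicator (B k) z / c k) *\<^sub>R h z \<partial>m)"
      unfolding qd p using hm c_nonneg by (subst integral_density) auto
    also have "\<dots> = (1 / c k) *\<^sub>R (LINT z:B k|m. h z)"
      unfolding set_lebesgue_integral_def using eq p by (subst integral_scaleR_right[symmetric]) auto
    finally show ?thesis using False by (simp add: scaleR_conv_of_real)
  qed
  moreover have "(LINT z:B k|m. h z - 1) = (LINT z:B k|m. h z) - (LINT z:B k|m. 1)"
    by (rule set_integral_diff(2)[OF h set_integrable_one])
  moreover have "(LINT z:B k|m. (1::'c)) = of_real (c k)"
    unfolding set_lebesgue_integral_def
    using has_bochner_integral_integral_eq[OF has_bochner_integral_indicator[of "B k" m "1::'c"]] B_finite[of k]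
    by (simp add: c_def scaleR_conv_of_real)
  ultimately show "of_real (c k) * ((\<integral>z. h z \<partial>q k) - 1) = (LINT z:B k|m. h z - 1)"
    by (simp add: algebra_simps)
qed

theorem
  fixes w :: "nat \<Rightarrow> 'z \<Rightarrow> 'c::{real_normed_field,banach,second_countable_topology}"
  assumes w: "\<And>k j. set_integrable m (B j) (w k)"
  shows integrable_product_functional: "integrable \<Omega> (cloud_prod n w)"
    and integral_product_functional: "(\<integral>\<omega>. cloud_prod n w \<omega> \<partial>\<Omega>) = exp (\<Sum>k<n. LINT z:B k|m. w k z - 1)"
  using integrable_cloud_prod[of w, OF integrable_q[OF w]] integral_cloud_prod[of w, OF integrable_q[OF w]]
  by (simp_all add: integral_q[OF w] exp_sum)

lemma sum_set_integral_tendsto: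
  fixes h :: "'z \<Rightarrow> 'c::{banach,second_countable_topology}"
  assumes h: "integrable m h"
  shows "(\<lambda>n. \<Sum>k<n. LINT z:B k|m. h z) \<longlonglongrightarrow> (\<integral>z. h z \<partial>m)"
proof -
  have int: "integrable m (\<lambda>z. indicator (B k) z *\<^sub>R h z)" for k
    using h by (intro integrable_mult_indicator) auto
  have eq: "(\<Sum>k<n. LINT z:B k|m. h z) = (\<integral>z. indicator (\<Union>k<n. B k) z *\<^sub>R h z \<partial>m)" for n
  proof -
    have "(\<integral>z. indicator (\<Union>k<n. B k) z *\<^sub>R h z \<partial>m) = (\<integral>z. (\<Sum>k<n. indicator (B k) z *\<^sub>R h z) \<partial>m)"
      using B_disjoint by (intro Bochner_Integration.integral_cong refl)
        (simp add: indicator_UN_disjoint disjoint_family_on_def scaleR_sum_left)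
    also have "\<dots> = (\<Sum>k<n. LINT z:B k|m. h z)"
      unfolding set_lebesgue_integral_def by (rule Bochner_Integration.integral_sum) (rule int)
    finally show ?thesis by simp
  qed
  show ?thesis unfolding eq
  proof (rule integral_dominated_convergence[where w="\<lambda>z. norm (h z)"])
    show "AE z in m. (\<lambda>n. indicator (\<Union>k<n. B k) z *\<^sub>R h z) \<longlonglongrightarrow> h z"
    proof (rule AE_I2)
      fix z assume "z \<in> space m"
      then obtain j where j: "z \<in> B j" using B_space by auto
      then have "eventually (\<lambda>n. indicator (\<Union>k<n. B k) z *\<^sub>R h z = h z) sequentially"
        unfolding eventually_sequentially by (intro exI[of _ "Suc j"]) (auto simp: indicator_def)
      then show "(\<lambda>n. indicator (\<Union>k<n. B k) z *\<^sub>R h z) \<longlonglongrightarrow> h z" by (rule tendsto_eventually)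
    qed
    show "AE z in m. norm (indicator (\<Union>k<n. B k) z *\<^sub>R h z) \<le> norm (h z)" for n
      by (auto simp: indicator_def)
  qed (use h in \<open>auto intro!: borel_measurable_scaleR borel_measurable_indicator\<close>)
qed

lemma AE_q: "AE z in m. P z \<Longrightarrow> AE z in q k. P z"
  unfolding q_eq
  by (rule AE_uniform_measureI) (auto elim: AE_mp)

end

text \<open>
  The pieces come from \<open>\<sigma>\<close>-finiteness of the measure with density \<open>1 + \<rho>\<close>, so both \<open>m\<close> and \<open>\<rho> m\<close> are
  finite on each of them.
\<close>

lemma exists_cut_intensity:
  fixes m :: "'z measure" and \<rho> :: "'z \<Rightarrow> real"
  assumes sf: "sigma_finite_measure m" and nz: "emeasure m (space m) \<noteq> 0"
    and \<rho>[measurable]: "\<rho> \<in> borel_measurable m" and \<rho>0: "\<And>z. z \<in> space m \<Longrightarrow> 0 \<le> \<rho> z"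
  shows "\<exists>B. cut_intensity m B \<and> (\<forall>k. set_integrable m (B k) \<rho>)"
proof -
  interpret sigma_finite_measure m by fact
  have "sigma_finite_measure (density m (\<lambda>z. ennreal (1 + \<rho> z)))"
    by (subst sigma_finite_iff_density_finite) auto
  then interpret D: sigma_finite_measure "density m (\<lambda>z. ennreal (1 + \<rho> z))" .
  obtain B :: "nat \<Rightarrow> 'z set" where B: "range B \<subseteq> sets (density m (\<lambda>z. ennreal (1 + \<rho> z)))"
    "(\<Union>i. B i) = space (density m (\<lambda>z. ennreal (1 + \<rho> z)))"
    "\<And>i. emeasure (density m (\<lambda>z. ennreal (1 + \<rho> z))) (B i) \<noteq> \<infinity>" "disjoint_family B"
    using D.sigma_finite_disjoint by metis
  have Bm[measurable]: "B k \<in> sets m" for k using B(1) by auto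
  have fin: "(\<integral>\<^sup>+z. ennreal (1 + \<rho> z) * indicator (B k) z \<partial>m) < \<infinity>" for k
    using B(3)[of k] by (simp add: emeasure_density less_top)
  have "emeasure m (B k) < \<infinity>" for k
  proof -
    have "emeasure m (B k) = (\<integral>\<^sup>+z. indicator (B k) z \<partial>m)" by simp
    also have "\<dots> \<le> (\<integral>\<^sup>+z. ennreal (1 + \<rho> z) * indicator (B k) z \<partial>m)"
      using \<rho>0 by (intro nn_integral_mono) (auto simp: indicator_def)
    finally show ?thesis using fin[of k] by simp
  qed
  moreover have "set_integrable m (B k) \<rho>" for k
    unfolding set_integrable_def
  proof (rule integrableI_bounded)
    have "(\<integral>\<^sup>+z. ennreal (norm (indicator (B k) z *\<^sub>R \<rho> z)) \<partial>m) \<le> (\<integral>\<^sup>+z. ennreal (1 + \<rho> z) * indicator (B k) z \<partial>m)"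
      using \<rho>0 by (intro nn_integral_mono) (auto simp: indicator_def intro!: ennreal_leI)
    then show "(\<integral>\<^sup>+z. ennreal (norm (indicator (B k) z *\<^sub>R \<rho> z)) \<partial>m) < \<infinity>" using fin[of k] by simp
  qed simp
  ultimately have "cut_intensity m B \<and> (\<forall>k. set_integrable m (B k) \<rho>)"
    using B nz by (auto simp: cut_intensity_def)
  then show ?thesis by blast
qed

section \<open>Completely random measures built from Poisson clouds\<close>

text \<open>
  The weight \<open>min s 1\<close> admits infinitely many small atoms in a bounded region as long as their expected
  total mass is finite, but only finitely many large ones.
\<close>

definition locally_finite_intensity :: "('a::euclidean_space \<times> real) measure \<Rightarrow> bool" where
  "locally_finite_intensity m \<longleftrightarrow> sets m = sets lborel_marked \<and>
     (\<forall>R::nat. (\<integral>\<^sup>+(x, s). ennreal (min s 1) * indicator (cball 0 R) x \<partial>m) < \<infinity>)"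

lemma space_lborel_marked: "space lborel_marked = UNIV \<times> {0<..}"
  by (simp add: lborel_marked_def space_pair_measure space_restrict_space)

lemma fst_measurable_marked[measurable]:
  "(fst :: 'a::euclidean_space \<times> real \<Rightarrow> 'a) \<in> borel_measurable lborel_marked"
proof -
  have "(fst :: 'a \<times> real \<Rightarrow> 'a) \<in> measurable lborel_marked lborel"
    unfolding lborel_marked_def by measurable
  then show ?thesis by simp
qed

lemma snd_measurable_marked[measurable]:
  "(snd :: 'a::euclidean_space \<times> real \<Rightarrow> real) \<in> borel_measurable lborel_marked"
proof -
  have "(snd :: 'a \<times> real \<Rightarrow> real) \<in> measurable lborel_marked (restrict_space lborel {0<..})"
    unfolding lborel_marked_def by measurable
  then show ?thesis by (simp add: measurable_restrict_space2_iff)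
qed

lemma measurable_truncated_mass:
  "(\<lambda>(x :: 'a::euclidean_space, s). ennreal (min s 1) * indicator (cball 0 (real R)) x) \<in> borel_measurable lborel_marked"
  unfolding case_prod_unfold
  by (intro borel_measurable_times_ennreal
      measurable_compose[OF fst_measurable_marked, of "indicator (cball 0 (real R))"]
      measurable_compose[OF snd_measurable_marked, of "\<lambda>s. ennreal (min s 1)"]
      borel_measurable_indicator) auto

lemma measurable_intensity_density:
  assumes "(\<lambda>(x :: 'a::euclidean_space, s). l x s) \<in> borel_measurable lborel_marked"
  shows "(\<lambda>(x, s). ennreal (l x s / s)) \<in> borel_measurable lborel_marked"
proof -
  have [measurable]: "(\<lambda>z. l (fst z) (snd z)) \<in> borel_measurable lborel_marked"
    using assms by (simp add: case_prod_unfold)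
  show ?thesis unfolding case_prod_unfold by measurable
qed

lemma norm_iexp_minus_1_le: "norm (exp (\<i> * complex_of_real a) - 1) \<le> min 2 \<bar>a\<bar>"
proof -
  have "norm (exp (\<i> * complex_of_real a) - 1) \<le> \<bar>a\<bar>"
    using iexp_approx1[of a 0] by simp
  moreover have "norm (exp (\<i> * complex_of_real a) - 1) \<le> norm (exp (\<i> * complex_of_real a)) + norm (1::complex)"
    by (rule norm_triangle_ineq4)
  ultimately show ?thesis by simp
qed

text \<open>
  The bound \<open>norm (exp (\<i> u) - 1) \<le> min 2 \<bar>u\<bar>\<close> matches the weight \<open>min s 1\<close>.
\<close>

lemma integrable_fourier_exponent:
  fixes f :: "'a::euclidean_space \<Rightarrow> real"
  assumes m: "locally_finite_intensity m" and f: "f \<in> C_c"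
  shows "integrable m (\<lambda>(x, s). exp (\<i> * complex_of_real (s * f x)) - 1)"
proof -
  have sets: "sets m = sets lborel_marked" using m by (simp add: locally_finite_intensity_def)
  have sp: "space m = UNIV \<times> {0<..}"
    using sets_eq_imp_space_eq[OF sets] by (simp add: space_lborel_marked)
  have [measurable]: "fst \<in> borel_measurable m" "snd \<in> borel_measurable m" "f \<in> borel_measurable borel"
    using fst_measurable_marked snd_measurable_marked borel_measurable_C_c[OF f]
    by (simp_all add: measurable_cong_sets[OF sets refl])
  obtain R' B where R': "R' > 0" "B > 0" "\<And>x. f x \<noteq> 0 \<Longrightarrow> norm x \<le> R'" "\<And>x. \<bar>f x\<bar> \<le> B"
    using C_cE[OF f] by metis
  obtain R :: nat where R: "R' \<le> real R" using real_arch_simple by blast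
  have bound: "norm (exp (\<i> * complex_of_real (s * f x)) - 1) \<le> (2 + B) * (min s 1 * indicator (cball 0 R) x)" if "s > 0" for x s
  proof (cases "f x = 0")
    case False
    have "norm (exp (\<i> * complex_of_real (s * f x)) - 1) \<le> min 2 \<bar>s * f x\<bar>"
      by (rule norm_iexp_minus_1_le)
    also have "\<bar>s * f x\<bar> \<le> s * B" using that R'(4)[of x] by (simp add: abs_mult)
    then have "min 2 \<bar>s * f x\<bar> \<le> min 2 (s * B)" by simp
    also have "\<dots> \<le> (2 + B) * min s 1"
      using that R'(2) by (auto simp: min_def algebra_simps)
    finally show ?thesis using R'(3)[OF False] R by simp
  qed (use that R' in auto)
  have "(\<integral>\<^sup>+z. ennreal (norm (case z of (x, s) \<Rightarrow> exp (\<i> * complex_of_real (s * f x)) - 1)) \<partial>m)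
      \<le> (\<integral>\<^sup>+z. ennreal (2 + B) * (case z of (x, s) \<Rightarrow> ennreal (min s 1) * indicator (cball 0 R) x) \<partial>m)"
  proof (intro nn_integral_mono)
    fix z assume "z \<in> space m"
    then obtain x s where z: "z = (x, s)" "s > 0" by (auto simp: sp)
    have "ennreal (norm (exp (\<i> * complex_of_real (s * f x)) - 1)) \<le>
        ennreal ((2 + B) * (min s 1 * indicator (cball 0 R) x))"
      by (intro ennreal_leI bound z)
    also have "\<dots> = ennreal (2 + B) * (ennreal (min s 1) * indicator (cball 0 R) x)"
      using R'(2) z(2) by (simp add: ennreal_mult ennreal_indicator del: ennreal_plus)
    finally show "ennreal (norm (case z of (x, s) \<Rightarrow> exp (\<i> * complex_of_real (s * f x)) - 1))
        \<le> ennreal (2 + B) * (case z of (x, s) \<Rightarrow> ennreal (min s 1) * indicator (cball 0 R) x)"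
      by (simp add: z)
  qed
  also have "\<dots> = ennreal (2 + B) * (\<integral>\<^sup>+(x, s). ennreal (min s 1) * indicator (cball 0 R) x \<partial>m)"
  proof (intro nn_integral_cmult)
    show "(\<lambda>(x, s). ennreal (min s 1) * indicator (cball 0 R) x) \<in> borel_measurable m"
      using measurable_truncated_mass by (simp add: measurable_cong_sets[OF sets refl])
  qed
  also have "\<dots> < \<infinity>"
    using m by (auto simp: locally_finite_intensity_def ennreal_mult_less_top)
  finally have fin: "(\<integral>\<^sup>+z. ennreal (norm (case z of (x, s) \<Rightarrow> exp (\<i> * complex_of_real (s * f x)) - 1)) \<partial>m) < \<infinity>" .
  have "(\<lambda>z. exp (\<i> * complex_of_real (snd z * f (fst z))) - 1) \<in> borel_measurable m" by measurable
  then show ?thesis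
    by (intro integrableI_bounded[OF _ fin]) (simp add: case_prod_beta)
qed

locale marked_cloud = cut_intensity m B for m :: "('a::euclidean_space \<times> real) measure" and B +
  assumes locally_finite: "locally_finite_intensity m"
begin

lemma sets_m: "sets m = sets lborel_marked"
  using locally_finite by (simp add: locally_finite_intensity_def)

lemma space_m: "space m = UNIV \<times> {0<..}"
  using sets_eq_imp_space_eq[OF sets_m] by (simp add: space_lborel_marked)

lemma measurable_coordinates[measurable]: "fst \<in> borel_measurable m" "snd \<in> borel_measurable m"
  using fst_measurable_marked snd_measurable_marked by (simp_all add: measurable_cong_sets[OF sets_m refl])

lemma mark_pos: "\<omega> \<in> space \<Omega> \<Longrightarrow> snd (snd \<omega> i) > 0"
  using space_\<Omega>_mark[of \<omega> i] by (auto simp: space_m)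

definition pts :: "(nat \<Rightarrow> nat) \<times> (nat \<times> nat \<Rightarrow> 'a \<times> real) \<Rightarrow> (nat \<times> nat) set" where
  "pts \<omega> = {i. snd i < fst \<omega> (fst i)}"

text \<open>
  The image of a weighted counting measure on indices, because several points of the cloud may share
  their position; their weights then add up.
\<close>

definition atoms :: "(nat \<Rightarrow> nat) \<times> (nat \<times> nat \<Rightarrow> 'a \<times> real) \<Rightarrow> 'a measure" where
  "atoms \<omega> = distr (density (count_space (pts \<omega>)) (\<lambda>i. ennreal (snd (snd \<omega> i)))) borel (\<lambda>i. fst (snd \<omega> i))"

lemma nn_integral_pts:
  "(\<integral>\<^sup>+i. g i \<partial>count_space (pts \<omega>)) = (\<Sum>k. \<Sum>j<fst \<omega> k. g (k, j))"
proof -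
  have "(\<integral>\<^sup>+i. g i \<partial>count_space (pts \<omega>)) = (\<integral>\<^sup>+i. g i * indicator (pts \<omega>) i \<partial>count_space UNIV)"
    by (simp add: nn_integral_count_space_indicator)
  also have "\<dots> = (\<integral>\<^sup>+k. (\<integral>\<^sup>+j. g (k, j) * indicator (pts \<omega>) (k, j) \<partial>count_space UNIV) \<partial>count_space UNIV)"
    by (rule nn_integral_fst_count_space[symmetric])
  also have "\<dots> = (\<Sum>k. \<integral>\<^sup>+j. g (k, j) * indicator {..<fst \<omega> k} j \<partial>count_space UNIV)"
    by (simp add: nn_integral_count_space_nat pts_def indicator_def)
  also have "\<dots> = (\<Sum>k. \<Sum>j<fst \<omega> k. g (k, j))"
    by (simp add: nn_integral_count_space_indicator[symmetric] nn_integral_count_space_finite)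
  finally show ?thesis .
qed

lemma nn_integral_pts_cloud_sum: "(\<integral>\<^sup>+i. h (snd \<omega> i) \<partial>count_space (pts \<omega>)) = cloud_sum h \<omega>"
  by (simp add: nn_integral_pts cloud_sum_def)

lemma sets_atoms[simp]: "sets (atoms \<omega>) = sets borel" by (simp add: atoms_def)

lemma nn_integral_atoms:
  assumes h: "h \<in> borel_measurable borel"
  shows "(\<integral>\<^sup>+x. h x \<partial>atoms \<omega>) = cloud_sum (\<lambda>(x, s). ennreal s * h x) \<omega>"
  unfolding atoms_def using h
  by (simp add: nn_integral_distr nn_integral_density nn_integral_pts cloud_sum_def case_prod_beta)

lemma emeasure_atoms:
  assumes A: "A \<in> sets borel"
  shows "emeasure (atoms \<omega>) A = cloud_sum (\<lambda>(x, s). ennreal s * indicator A x) \<omega>"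
  using nn_integral_atoms[of "indicator A" \<omega>] A by (simp add: nn_integral_indicator)

lemma measurable_weighted:
  assumes [measurable]: "h \<in> borel_measurable borel"
  shows "(\<lambda>(x, s). ennreal s * h x) \<in> borel_measurable m"
  unfolding case_prod_beta by measurable

lemma atoms_radon_iff:
  "atoms \<omega> \<in> radon_measures \<longleftrightarrow> (\<forall>R::nat. cloud_sum (\<lambda>(x, s). ennreal s * indicator (cball 0 R) x) \<omega> < \<infinity>)"
proof
  assume *: "\<forall>R::nat. cloud_sum (\<lambda>(x, s). ennreal s * indicator (cball 0 R) x) \<omega> < \<infinity>"
  have "emeasure (atoms \<omega>) K < \<infinity>" if K: "compact K" for K
  proof -
    obtain r where r: "\<And>x. x \<in> K \<Longrightarrow> norm x \<le> r" using compact_imp_bounded[OF K] by (auto simp: bounded_iff)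
    obtain R :: nat where "r \<le> real R" using real_arch_simple by blast
    then have "K \<subseteq> cball 0 (real R)" using r by force
    then have "emeasure (atoms \<omega>) K \<le> emeasure (atoms \<omega>) (cball 0 (real R))"
      by (intro emeasure_mono) auto
    also have "\<dots> < \<infinity>" using * by (simp add: emeasure_atoms)
    finally show ?thesis .
  qed
  then show "atoms \<omega> \<in> radon_measures" by (auto simp: radon_measures_def)
next
  assume "atoms \<omega> \<in> radon_measures"
  then have "emeasure (atoms \<omega>) (cball 0 (real R)) < \<infinity>" for R :: nat
    by (auto simp: radon_measures_def)
  then show "\<forall>R::nat. cloud_sum (\<lambda>(x, s). ennreal s * indicator (cball 0 R) x) \<omega> < \<infinity>"
    by (simp add: emeasure_atoms)
qed

text \<open>
  Near every compact set only finitely many atoms have mass at least \<open>1\<close>, and the smaller ones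
  have a finite expected total mass; so the random measure is almost surely Radon.
\<close>

lemma AE_atoms_radon: "AE \<omega> in \<Omega>. atoms \<omega> \<in> radon_measures"
proof -
  have "AE \<omega> in \<Omega>. cloud_sum (\<lambda>(x, s). ennreal s * indicator (cball 0 (real R)) x) \<omega> < \<infinity>" for R :: nat
  proof -
    define h where "h = (\<lambda>(x :: 'a, s). ennreal (min s 1) * indicator (cball 0 (real R)) x)"
    have hm: "h \<in> borel_measurable m"
      unfolding h_def using measurable_truncated_mass by (simp add: measurable_cong_sets[OF sets_m refl])
    have "(\<integral>\<^sup>+\<omega>. cloud_sum h \<omega> \<partial>\<Omega>) < \<infinity>"
      using locally_finite campbell[OF hm] by (auto simp: h_def locally_finite_intensity_def)
    then have "AE \<omega> in \<Omega>. cloud_sum h \<omega> \<noteq> \<infinity>"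
      by (intro nn_integral_noteq_infinite measurable_cloud_sum hm) auto
    then show ?thesis
    proof (rule AE_mp[OF _ AE_I2], intro impI)
      fix \<omega> assume \<omega>: "\<omega> \<in> space \<Omega>" and fin: "cloud_sum h \<omega> \<noteq> \<infinity>"
      let ?I = "count_space (pts \<omega>)"
\<comment> \<open>\<open>h\<close> equals \<open>1\<close> at the large atoms of the ball, so finiteness of its sum bounds their number\<close>
      define big where "big = {i \<in> pts \<omega>. 1 \<le> h (snd \<omega> i)}"
      have "emeasure ?I big \<le> (\<integral>\<^sup>+i. h (snd \<omega> i) \<partial>?I)"
      proof -
        have "emeasure ?I big = (\<integral>\<^sup>+i. indicator big i \<partial>?I)" by (simp add: big_def)
        also have "\<dots> \<le> (\<integral>\<^sup>+i. h (snd \<omega> i) \<partial>?I)"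
          by (intro nn_integral_mono) (auto simp: big_def indicator_def)
        finally show ?thesis .
      qed
      then have "emeasure ?I big \<noteq> \<infinity>"
        using fin by (auto simp: nn_integral_pts_cloud_sum top_unique)
      then have finbig: "finite big"
        using emeasure_count_space[of big "pts \<omega>"] by (auto simp: big_def split: if_splits)
      define g where "g i = ennreal (snd (snd \<omega> i)) * indicator (cball 0 (real R)) (fst (snd \<omega> i))" for i
      have "cloud_sum (\<lambda>(x, s). ennreal s * indicator (cball 0 (real R)) x) \<omega> = (\<integral>\<^sup>+i. g i \<partial>?I)"
        by (simp add: nn_integral_pts cloud_sum_def g_def case_prod_beta)
      also have "\<dots> \<le> (\<integral>\<^sup>+i. g i * indicator big i + h (snd \<omega> i) \<partial>?I)"
      proof (intro nn_integral_mono)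
        fix i assume "i \<in> space ?I"
        then show "g i \<le> g i * indicator big i + h (snd \<omega> i)"
          using mark_pos[OF \<omega>, of i]
          by (auto simp: g_def h_def big_def indicator_def case_prod_beta min_def)
      qed
      also have "\<dots> = (\<integral>\<^sup>+i. g i * indicator big i \<partial>?I) + cloud_sum h \<omega>"
        by (subst nn_integral_add) (auto simp: nn_integral_pts_cloud_sum)
      also have "(\<integral>\<^sup>+i. g i * indicator big i \<partial>?I) = (\<Sum>i\<in>big. g i)"
      proof -
        have "(\<integral>\<^sup>+i. g i * indicator big i \<partial>?I) = (\<Sum>i\<in>big. g i * indicator big i)"
          by (rule nn_integral_count_space'[OF finbig]) (auto simp: big_def)
        then show ?thesis by simp
      qed
      also have "\<dots> + cloud_sum h \<omega> < \<infinity>"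
      proof -
        have "g i < top" for i by (simp add: g_def indicator_def)
        then have "(\<Sum>i\<in>big. g i) < top" using finbig by simp
        then show ?thesis using fin by (simp add: less_top)
      qed
      finally show "cloud_sum (\<lambda>(x, s). ennreal s * indicator (cball 0 (real R)) x) \<omega> < \<infinity>" .
    qed
  qed
  then show ?thesis unfolding atoms_radon_iff by (simp add: AE_all_countable)
qed

text \<open>
  The default value \<open>0\<close> on the exceptional null set makes every realisation a discrete Radon measure.
\<close>

definition \<eta> :: "(nat \<Rightarrow> nat) \<times> (nat \<times> nat \<Rightarrow> 'a \<times> real) \<Rightarrow> 'a measure" where
  "\<eta> \<omega> = (if atoms \<omega> \<in> radon_measures then atoms \<omega> else null_measure borel)"

lemma AE_\<eta>_eq_atoms: "AE \<omega> in \<Omega>. \<eta> \<omega> = atoms \<omega> \<and> atoms \<omega> \<in> radon_measures"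
  using AE_atoms_radon by eventually_elim (simp add: \<eta>_def)

lemma \<eta>_discrete: "\<eta> \<omega> \<in> discrete_radon_measures"
proof (cases "atoms \<omega> \<in> radon_measures")
  case True
  define D where "D = (\<lambda>i. fst (snd \<omega> i)) ` pts \<omega>"
  have D: "countable D" by (simp add: D_def)
  have "- D \<in> sets borel" by (rule borel_comp, rule sets.countable) (use D in auto)
  then have "emeasure (atoms \<omega>) (- D) = (\<integral>\<^sup>+i. ennreal (snd (snd \<omega> i)) * indicator (- D) (fst (snd \<omega> i)) \<partial>count_space (pts \<omega>))"
    by (simp add: emeasure_atoms cloud_sum_def nn_integral_pts case_prod_beta)
  also have "\<dots> = (\<integral>\<^sup>+i. 0 \<partial>count_space (pts \<omega>))"
    by (intro nn_integral_cong) (auto simp: D_def indicator_def)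
  finally have "emeasure (atoms \<omega>) (- D) = 0" by simp
  then show ?thesis using True D by (auto simp: \<eta>_def discrete_radon_measures_iff)
next
  case False
  then show ?thesis by (auto simp: \<eta>_def discrete_radon_measures_iff radon_measures_def intro!: exI[of _ "{}"])
qed

lemma integral_atoms_nonneg:
  assumes f: "f \<in> borel_measurable borel" "\<And>x. 0 \<le> f x"
  shows "(\<integral>x. f x \<partial>atoms \<omega>) = enn2real (cloud_sum (\<lambda>(x, s). ennreal s * ennreal (f x)) \<omega>)"
proof -
  have "(\<integral>x. f x \<partial>atoms \<omega>) = enn2real (\<integral>\<^sup>+x. ennreal (f x) \<partial>atoms \<omega>)"
    using f by (intro integral_eq_nn_integral) (auto simp: measurable_cong_sets[OF sets_atoms refl])
  then show ?thesis using f by (simp add: nn_integral_atoms)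
qed

lemma measurable_\<eta>: "\<eta> \<in> measurable \<Omega> discrete_radon_space"
proof (rule measurable_discrete_radon_spaceI)
  show "\<eta> \<omega> \<in> discrete_radon_measures" for \<omega> by (rule \<eta>_discrete)
  fix f :: "'a \<Rightarrow> real" assume f: "f \<in> C_c" "\<And>x. 0 \<le> f x"
  have [measurable]: "cloud_sum (\<lambda>(x, s). ennreal s * indicator (cball 0 (real R)) x) \<in> borel_measurable \<Omega>" for R :: nat
    by (intro measurable_cloud_sum measurable_weighted borel_measurable_indicator) auto
  have [measurable]: "cloud_sum (\<lambda>(x, s). ennreal s * ennreal (f x)) \<in> borel_measurable \<Omega>"
    using borel_measurable_C_c[OF f(1)] by (intro measurable_cloud_sum measurable_weighted) auto
  have "(\<integral>x. f x \<partial>\<eta> \<omega>) = (if \<forall>R::nat. cloud_sum (\<lambda>(x, s). ennreal s * indicator (cball 0 R) x) \<omega> < \<infinity>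
      then enn2real (cloud_sum (\<lambda>(x, s). ennreal s * ennreal (f x)) \<omega>) else 0)" for \<omega>
    unfolding \<eta>_def atoms_radon_iff
    using integral_atoms_nonneg[OF borel_measurable_C_c[OF f(1)] f(2)] by auto
  then show "(\<lambda>\<omega>. \<integral>x. f x \<partial>\<eta> \<omega>) \<in> borel_measurable \<Omega>"
    by (simp only:) measurable
qed

lemma partial_sums_tendsto_integral:
  assumes rad: "atoms \<omega> \<in> radon_measures" and f: "f \<in> C_c" and \<omega>: "\<omega> \<in> space \<Omega>"
  shows "(\<lambda>n. \<Sum>k<n. \<Sum>j<fst \<omega> k. snd (snd \<omega> (k, j)) * f (fst (snd \<omega> (k, j)))) \<longlonglongrightarrow> (\<integral>x. f x \<partial>atoms \<omega>)"
proof -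
  define S where "S g n = (\<Sum>k<n. \<Sum>j<fst \<omega> k. snd (snd \<omega> (k, j)) * g (fst (snd \<omega> (k, j))))" for g :: "'a \<Rightarrow> real" and n
  have *: "S g \<longlonglongrightarrow> (\<integral>x. g x \<partial>atoms \<omega>)" if g: "g \<in> C_c" "\<And>x. 0 \<le> g x" for g
  proof -
    have gm: "g \<in> borel_measurable borel" by (rule borel_measurable_C_c[OF g(1)])
    define a where "a k = (\<Sum>j<fst \<omega> k. snd (snd \<omega> (k, j)) * g (fst (snd \<omega> (k, j))))" for k
    have a0: "0 \<le> a k" for k
      unfolding a_def by (intro sum_nonneg mult_nonneg_nonneg less_imp_le[OF mark_pos[OF \<omega>]] g(2))
    have cs: "cloud_sum (\<lambda>(x, s). ennreal s * ennreal (g x)) \<omega> = (\<Sum>k. ennreal (a k))"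
      unfolding cloud_sum_def
    proof (intro suminf_cong)
      fix k
      have "(\<Sum>j<fst \<omega> k. case snd \<omega> (k, j) of (x, s) \<Rightarrow> ennreal s * ennreal (g x)) =
          (\<Sum>j<fst \<omega> k. ennreal (snd (snd \<omega> (k, j)) * g (fst (snd \<omega> (k, j)))))"
        by (intro sum.cong refl) (simp add: case_prod_beta ennreal_mult less_imp_le[OF mark_pos[OF \<omega>]] g(2))
      also have "\<dots> = ennreal (a k)"
        unfolding a_def by (intro sum_ennreal mult_nonneg_nonneg less_imp_le[OF mark_pos[OF \<omega>]] g(2))
      finally show "(\<Sum>j<fst \<omega> k. case snd \<omega> (k, j) of (x, s) \<Rightarrow> ennreal s * ennreal (g x)) = ennreal (a k)" .
    qed
    have fin: "(\<Sum>k. ennreal (a k)) \<noteq> \<infinity>"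
    proof -
      have "integrable (atoms \<omega>) g" by (rule integrable_radon_C_c[OF rad g(1)])
      then have "(\<integral>\<^sup>+x. ennreal (norm (g x)) \<partial>atoms \<omega>) < \<infinity>" by (simp add: integrable_iff_bounded)
      then show ?thesis using gm g(2) by (simp add: nn_integral_atoms cs)
    qed
    have "(\<lambda>n. \<Sum>k<n. ennreal (a k)) \<longlonglongrightarrow> (\<Sum>k. ennreal (a k))"
      by (rule summable_LIMSEQ) auto
    then have "(\<lambda>n. enn2real (\<Sum>k<n. ennreal (a k))) \<longlonglongrightarrow> enn2real (\<Sum>k. ennreal (a k))"
      using fin by (intro tendsto_enn2real) (auto simp: ennreal_enn2real_if)
    moreover have "enn2real (\<Sum>k<n. ennreal (a k)) = S g n" for n
      using a0 by (simp add: sum_ennreal S_def a_def sum_nonneg)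
    ultimately show ?thesis
      using integral_atoms_nonneg[OF gm g(2), of \<omega>] by (simp add: cs)
  qed
  define f1 where "f1 = (\<lambda>x. max (f x) 0)"
  define f2 where "f2 = (\<lambda>x. max (- f x) 0)"
  have f12: "f1 \<in> C_c" "f2 \<in> C_c" "\<And>x. 0 \<le> f1 x" "\<And>x. 0 \<le> f2 x"
    unfolding f1_def f2_def by (auto intro!: C_c_max C_c_zero C_c_uminus f)
  have "S f n = S f1 n - S f2 n" for n
    unfolding S_def sum_subtractf[symmetric]
    by (intro sum.cong refl) (auto simp: f1_def f2_def max_def)
  moreover have "(\<integral>x. f x \<partial>atoms \<omega>) = (\<integral>x. f1 x \<partial>atoms \<omega>) - (\<integral>x. f2 x \<partial>atoms \<omega>)"
  proof -
    have "(\<integral>x. f x \<partial>atoms \<omega>) = (\<integral>x. f1 x - f2 x \<partial>atoms \<omega>)"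
      by (intro Bochner_Integration.integral_cong) (auto simp: f1_def f2_def)
    also have "\<dots> = (\<integral>x. f1 x \<partial>atoms \<omega>) - (\<integral>x. f2 x \<partial>atoms \<omega>)"
      by (intro Bochner_Integration.integral_diff integrable_radon_C_c rad f12)
    finally show ?thesis .
  qed
  moreover have "(\<lambda>n. S f1 n - S f2 n) \<longlonglongrightarrow> (\<integral>x. f1 x \<partial>atoms \<omega>) - (\<integral>x. f2 x \<partial>atoms \<omega>)"
    by (intro tendsto_diff * f12)
  ultimately have "(\<lambda>n. S f n) \<longlonglongrightarrow> (\<integral>x. f x \<partial>atoms \<omega>)" by (simp only:)
  then show ?thesis by (simp add: S_def[abs_def])
qed

definition wave :: "('a \<Rightarrow> real) \<Rightarrow> 'a \<times> real \<Rightarrow> complex" where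
  "wave f = (\<lambda>(x, s). exp (\<i> * complex_of_real (s * f x)))"

lemma norm_wave[simp]: "norm (wave f z) = 1"
  by (simp add: wave_def case_prod_beta)

lemma measurable_wave[measurable]: "f \<in> C_c \<Longrightarrow> wave f \<in> borel_measurable m"
  unfolding wave_def case_prod_beta using borel_measurable_C_c[of f] by measurable

lemma norm_cloud_prod_wave[simp]: "norm (cloud_prod n (\<lambda>k. wave f) \<omega>) = 1"
  by (simp add: cloud_prod_def prod_norm[symmetric])

text \<open>
  The product over the first \<open>n\<close> pieces is the exponential of a partial sum of \<open>\<integral>f d\<eta>\<close>.
\<close>

lemma AE_cloud_prod_wave:
  assumes f: "f \<in> C_c"
  shows "AE \<omega> in \<Omega>. (\<lambda>n. cloud_prod n (\<lambda>k. wave f) \<omega>) \<longlonglongrightarrow> exp (\<i> * complex_of_real (\<integral>x. f x \<partial>\<eta> \<omega>))"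
  using AE_\<eta>_eq_atoms AE_space
proof eventually_elim
  case (elim \<omega>)
  have eq: "cloud_prod n (\<lambda>k. wave f) \<omega> =
      exp (\<i> * complex_of_real (\<Sum>k<n. \<Sum>j<fst \<omega> k. snd (snd \<omega> (k, j)) * f (fst (snd \<omega> (k, j)))))" for n
    by (simp add: cloud_prod_def wave_def case_prod_beta exp_sum sum_distrib_left)
  have "atoms \<omega> \<in> radon_measures" "\<eta> \<omega> = atoms \<omega>" using elim by auto
  then show ?case unfolding eq
    by (simp only:) (intro tendsto_exp tendsto_mult tendsto_const tendsto_of_real partial_sums_tendsto_integral f elim)
qed

end

section \<open>Finite Hellinger distance gives absolute continuity\<close>

context marked_cloud
begin

lemma of_real_set_integrable:
  "set_integrable m A f \<Longrightarrow> set_integrable m A (\<lambda>z. complex_of_real (f z))"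
  unfolding set_integrable_def
  by (drule integrable_of_real[where 'a=complex]) (simp add: scaleR_conv_of_real)

lemma set_integrable_wave_times:
  assumes f: "f \<in> C_c" and g: "set_integrable m (B j) g"
  shows "set_integrable m (B j) (\<lambda>z. complex_of_real (g z) * wave f z)"
proof -
  have "integrable m (\<lambda>z. complex_of_real (indicator (B j) z *\<^sub>R g z) * wave f z)"
  proof (rule Bochner_Integration.integrable_bound)
    show "integrable m (\<lambda>z. indicator (B j) z *\<^sub>R g z)" using g by (simp add: set_integrable_def)
    then have "(\<lambda>z. indicator (B j) z *\<^sub>R g z) \<in> borel_measurable m" by simp
    then show "(\<lambda>z. complex_of_real (indicator (B j) z *\<^sub>R g z) * wave f z) \<in> borel_measurable m"
      using measurable_wave[OF f] by measurable
  qed (auto simp: norm_mult)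
  then show ?thesis by (simp add: set_integrable_def scaleR_conv_of_real mult.assoc)
qed

lemma wave_minus_1: "(\<lambda>(x, s). exp (\<i> * complex_of_real (s * f x)) - 1) = (\<lambda>z. wave f z - 1)"
  by (auto simp: wave_def fun_eq_iff)

lemma integrable_wave_minus_1:
  assumes "f \<in> C_c" shows "integrable m (\<lambda>z. wave f z - 1)"
  using integrable_fourier_exponent[OF locally_finite assms] unfolding wave_minus_1 .

text \<open>
  The product formula gives the Fourier transform of the first \<open>n\<close> pieces exactly; both sides converge
  as \<open>n\<close> grows, by dominated convergence.
\<close>

theorem crm_cloud: "completely_random_measure m (distr \<Omega> discrete_radon_space \<eta>)"
  unfolding completely_random_measure_def
proof (intro conjI ballI)
  show "prob_space (distr \<Omega> discrete_radon_space \<eta>)" by (rule P.prob_space_distr[OF measurable_\<eta>])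
  show "sets (distr \<Omega> discrete_radon_space \<eta>) = sets discrete_radon_space" by simp
  fix f :: "'a \<Rightarrow> real" assume f: "f \<in> C_c"
  let ?G = "\<lambda>\<eta>. exp (\<i> * complex_of_real (\<integral>x. f x \<partial>\<eta>))"
  have Gm: "?G \<in> borel_measurable discrete_radon_space"
    using measurable_integral_discrete_radon_space[OF f] by measurable
  have w: "set_integrable m (B j) (wave f)" for j
    using set_integrable_wave_times[OF f set_integrable_one] by simp
  have wm: "cloud_prod n (\<lambda>k. wave f) \<in> borel_measurable \<Omega>" for n
    by (rule measurable_cloud_prod) (rule measurable_wave[OF f])
  have "(\<lambda>n. \<integral>\<omega>. cloud_prod n (\<lambda>k. wave f) \<omega> \<partial>\<Omega>) \<longlonglongrightarrow> (\<integral>\<omega>. ?G (\<eta> \<omega>) \<partial>\<Omega>)"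
    using AE_cloud_prod_wave[OF f] wm measurable_compose[OF measurable_\<eta> Gm]
    by (intro integral_dominated_convergence[where w="\<lambda>_. 1"]) auto
  moreover have "(\<lambda>n. \<integral>\<omega>. cloud_prod n (\<lambda>k. wave f) \<omega> \<partial>\<Omega>) \<longlonglongrightarrow> exp (\<integral>z. wave f z - 1 \<partial>m)"
    unfolding integral_product_functional[OF w]
    by (intro tendsto_exp sum_set_integral_tendsto integrable_wave_minus_1 f)
  ultimately have "(\<integral>\<omega>. ?G (\<eta> \<omega>) \<partial>\<Omega>) = exp (\<integral>z. wave f z - 1 \<partial>m)"
    by (rule LIMSEQ_unique)
  then show "(\<integral>\<eta>. ?G \<eta> \<partial>distr \<Omega> discrete_radon_space \<eta>) =
      exp (\<integral>(x, s). (exp (\<i> * complex_of_real (s * f x)) - 1) \<partial>m)"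
    unfolding wave_minus_1 by (simp add: integral_distr[OF measurable_\<eta> Gm])
qed

end

text \<open>
  Expanding the square relates the Hellinger integral to the exponents of the products of \<open>\<rho>\<close> and of
  \<open>sqrt \<rho>\<close>. Integrability comes from \<open>sqrt \<rho> \<le> 1 + \<rho>\<close>.
\<close>

lemma
  fixes \<rho> :: "'z \<Rightarrow> real"
  assumes S: "S \<in> sets m" "emeasure m S < \<infinity>" and \<rho>[measurable]: "\<rho> \<in> borel_measurable m"
    and nonneg: "\<And>z. z \<in> space m \<Longrightarrow> 0 \<le> \<rho> z" and int: "set_integrable m S \<rho>"
  shows set_integrable_sqrt_density: "set_integrable m S (\<lambda>z. sqrt (\<rho> z))"
    and set_integrable_hellinger: "set_integrable m S (\<lambda>z. (sqrt (\<rho> z) - 1)\<^sup>2)"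
    and set_integral_hellinger: "(LINT z:S|m. (sqrt (\<rho> z) - 1)\<^sup>2) =
      (LINT z:S|m. \<rho> z - 1) - 2 * (LINT z:S|m. sqrt (\<rho> z) - 1)"
proof -
  note [measurable] = S(1)
  have one: "set_integrable m S (\<lambda>z. 1 :: real)"
    using S by (simp add: set_integrable_def integrable_indicator_iff)
  show sq: "set_integrable m S (\<lambda>z. sqrt (\<rho> z))"
    unfolding set_integrable_def
  proof (rule Bochner_Integration.integrable_bound)
    show "integrable m (\<lambda>z. indicator S z *\<^sub>R 1 + indicator S z *\<^sub>R \<rho> z)"
      using one int unfolding set_integrable_def by (rule Bochner_Integration.integrable_add)
    show "AE z in m. norm (indicator S z *\<^sub>R sqrt (\<rho> z)) \<le> norm (indicator S z *\<^sub>R 1 + indicator S z *\<^sub>R \<rho> z)"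
    proof (rule AE_I2)
      fix z assume "z \<in> space m"
      then have \<rho>: "0 \<le> \<rho> z" by (rule nonneg)
      have "sqrt (\<rho> z) \<le> 1 + \<rho> z" using arith_geo_mean_sqrt[of 1 "\<rho> z"] \<rho> by simp
      then show "norm (indicator S z *\<^sub>R sqrt (\<rho> z)) \<le> norm (indicator S z *\<^sub>R 1 + indicator S z *\<^sub>R \<rho> z)"
        using \<rho> by (auto simp: indicator_def)
    qed
  qed measurable
  have d: "set_integrable m S (\<lambda>z. \<rho> z - 1)" "set_integrable m S (\<lambda>z. 2 * (sqrt (\<rho> z) - 1))"
    by (intro set_integrable_mult_right set_integral_diff(1) sq one int)+
  have eq: "(sqrt (\<rho> z) - 1)\<^sup>2 = (\<rho> z - 1) - 2 * (sqrt (\<rho> z) - 1)" if "z \<in> space m" for z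
    using nonneg[OF that] by (simp add: power2_diff)
  have "set_integrable m S (\<lambda>z. (sqrt (\<rho> z) - 1)\<^sup>2) \<longleftrightarrow>
      set_integrable m S (\<lambda>z. (\<rho> z - 1) - 2 * (sqrt (\<rho> z) - 1))"
    unfolding set_integrable_def by (intro Bochner_Integration.integrable_cong refl) (simp add: eq)
  then show "set_integrable m S (\<lambda>z. (sqrt (\<rho> z) - 1)\<^sup>2)"
    using set_integral_diff(1)[OF d] by simp
  have "(LINT z:S|m. (sqrt (\<rho> z) - 1)\<^sup>2) = (LINT z:S|m. (\<rho> z - 1) - 2 * (sqrt (\<rho> z) - 1))"
    unfolding set_lebesgue_integral_def by (intro Bochner_Integration.integral_cong refl) (simp add: eq)
  also have "\<dots> = (LINT z:S|m. \<rho> z - 1) - 2 * (LINT z:S|m. sqrt (\<rho> z) - 1)"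
    unfolding set_integral_diff(2)[OF d] set_integral_mult_right ..
  finally show "(LINT z:S|m. (sqrt (\<rho> z) - 1)\<^sup>2) =
    (LINT z:S|m. \<rho> z - 1) - 2 * (LINT z:S|m. sqrt (\<rho> z) - 1)" .
qed

text \<open>
  A pointwise substitute for the Cauchy-Schwarz inequality \<open>\<parallel>a\<^sup>2 - b\<^sup>2\<parallel>\<^sub>1 \<le> \<parallel>a - b\<parallel>\<^sub>2 \<parallel>a + b\<parallel>\<^sub>2\<close>, to be used with
  \<open>\<epsilon>\<close> of the order of the \<open>L\<^sup>2\<close> distance of \<open>a\<close> and \<open>b\<close>.
\<close>

lemma abs_diff_squares_le:
  fixes a b \<epsilon> :: real assumes "\<epsilon> > 0"
  shows "\<bar>a\<^sup>2 - b\<^sup>2\<bar> \<le> (a\<^sup>2 + b\<^sup>2 - 2 * (a * b)) / (2 * \<epsilon>) + \<epsilon> * (a\<^sup>2 + b\<^sup>2)"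
proof -
  have "0 \<le> (\<bar>a - b\<bar> - \<epsilon> * \<bar>a + b\<bar>)\<^sup>2" by simp
  then have "2 * \<epsilon> * (\<bar>a - b\<bar> * \<bar>a + b\<bar>) \<le> (a - b)\<^sup>2 + \<epsilon>\<^sup>2 * (a + b)\<^sup>2"
    by (simp add: power2_diff power_mult_distrib algebra_simps)
  also have "(a + b)\<^sup>2 \<le> 2 * (a\<^sup>2 + b\<^sup>2)"
    using sum_squares_bound[of a b] by (simp add: power2_sum)
  then have "(a - b)\<^sup>2 + \<epsilon>\<^sup>2 * (a + b)\<^sup>2 \<le> (a - b)\<^sup>2 + \<epsilon>\<^sup>2 * (2 * (a\<^sup>2 + b\<^sup>2))"
    by (intro add_left_mono mult_left_mono) auto
  also have "\<dots> = 2 * \<epsilon> * ((a\<^sup>2 + b\<^sup>2 - 2 * (a * b)) / (2 * \<epsilon>) + \<epsilon> * (a\<^sup>2 + b\<^sup>2))"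
    using assms by (simp add: field_simps power2_eq_square)
  finally have "\<bar>a - b\<bar> * \<bar>a + b\<bar> \<le> (a\<^sup>2 + b\<^sup>2 - 2 * (a * b)) / (2 * \<epsilon>) + \<epsilon> * (a\<^sup>2 + b\<^sup>2)"
    using assms by simp
  moreover have "\<bar>a\<^sup>2 - b\<^sup>2\<bar> = \<bar>a - b\<bar> * \<bar>a + b\<bar>"
    by (simp add: abs_mult[symmetric] power2_eq_square algebra_simps)
  ultimately show ?thesis by simp
qed

text \<open>
  Kakutani's criterion: the likelihood ratios of the first \<open>n\<close> pieces converge in \<open>L\<^sup>1\<close> because
  their square roots form a Cauchy sequence in \<open>L\<^sup>2\<close>, the squared distances being controlled by
  partial sums of the Hellinger integral.
\<close>

locale hellinger_cloud = marked_cloud m B for m :: "('a::euclidean_space \<times> real) measure" and B +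
  fixes \<rho> :: "'a \<times> real \<Rightarrow> real"
  assumes \<rho>_measurable[measurable]: "\<rho> \<in> borel_measurable m"
    and \<rho>_nonneg: "\<And>z. z \<in> space m \<Longrightarrow> 0 \<le> \<rho> z"
    and \<rho>_integrable: "\<And>k. set_integrable m (B k) \<rho>"
    and locally_finite_\<rho>: "locally_finite_intensity (density m \<rho>)"
    and hellinger: "(\<integral>\<^sup>+z. ennreal ((sqrt (\<rho> z) - 1)\<^sup>2) \<partial>m) < \<infinity>"
begin

text \<open>
  \<open>exp (- a k)\<close> is the normalising constant of the likelihood ratio on the piece \<open>k\<close>, and \<open>e k\<close> is its share
  of the Hellinger integral.
\<close>

definition "a k = (LINT z:B k|m. \<rho> z - 1)"
definition "e k = (LINT z:B k|m. (sqrt (\<rho> z) - 1)\<^sup>2)"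

lemma integrable_hellinger: "integrable m (\<lambda>z. (sqrt (\<rho> z) - 1)\<^sup>2)"
  using hellinger by (intro integrableI_nonneg) auto

lemma summable_e: "summable e"
  using sum_set_integral_tendsto[OF integrable_hellinger]
  unfolding e_def[symmetric] by (auto simp: summable_def sums_def)

lemma
  shows set_integrable_sqrt: "set_integrable m (B k) (\<lambda>z. sqrt (\<rho> z))"
    and integral_sqrt: "(LINT z:B k|m. sqrt (\<rho> z) - 1) = a k / 2 - e k / 2"
  using set_integrable_sqrt_density[OF B_sets B_finite \<rho>_measurable \<rho>_nonneg \<rho>_integrable]
    set_integral_hellinger[OF B_sets B_finite \<rho>_measurable \<rho>_nonneg \<rho>_integrable]
  by (simp_all add: a_def e_def diff_divide_distrib)

text \<open>
  \<open>L n\<close> is the likelihood ratio of the clouds of intensities \<open>\<rho> m\<close> and \<open>m\<close> on the first \<open>n\<close> pieces, and \<open>r n\<close>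
  is its square root.
\<close>

definition "L n \<omega> = cloud_prod n (\<lambda>k. \<rho>) \<omega> * exp (- (\<Sum>k<n. a k))"
definition "r n \<omega> = cloud_prod n (\<lambda>k z. sqrt (\<rho> z)) \<omega> * exp (- (\<Sum>k<n. a k) / 2)"

lemma L_nonneg: "\<omega> \<in> space \<Omega> \<Longrightarrow> 0 \<le> L n \<omega>"
  unfolding L_def cloud_prod_def
  by (intro mult_nonneg_nonneg prod_nonneg ballI \<rho>_nonneg space_\<Omega>_mark) auto

lemma r_square: "\<omega> \<in> space \<Omega> \<Longrightarrow> (r n \<omega>)\<^sup>2 = L n \<omega>"
proof -
  assume \<omega>: "\<omega> \<in> space \<Omega>"
  have "(cloud_prod n (\<lambda>k z. sqrt (\<rho> z)) \<omega>)\<^sup>2 = cloud_prod n (\<lambda>k. \<rho>) \<omega>"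
    by (simp add: cloud_prod_def prod_power_distrib \<rho>_nonneg space_\<Omega>_mark[OF \<omega>])
  moreover have "(exp (- (\<Sum>k<n. a k) / 2))\<^sup>2 = exp (- (\<Sum>k<n. a k))"
    by (simp add: power2_eq_square flip: exp_add)
  ultimately show ?thesis by (simp add: r_def L_def power_mult_distrib)
qed

lemma integrable_L: "integrable \<Omega> (L n)"
  unfolding L_def by (intro integrable_mult_left integrable_product_functional \<rho>_integrable)

lemma integral_L: "(\<integral>\<omega>. L n \<omega> \<partial>\<Omega>) = 1"
  unfolding L_def by (simp add: integral_product_functional[OF \<rho>_integrable] a_def flip: exp_add)

lemma r_prod:
  assumes "n \<le> p" and \<omega>: "\<omega> \<in> space \<Omega>"
  shows "r n \<omega> * r p \<omega> = cloud_prod p (\<lambda>k z. if k < n then \<rho> z else sqrt (\<rho> z)) \<omega> *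
    exp (- (\<Sum>k<n. a k) / 2 - (\<Sum>k<p. a k) / 2)"
proof -
  define X where "X k = (\<Prod>j<fst \<omega> k. sqrt (\<rho> (snd \<omega> (k, j))))" for k
  have sq: "(\<Prod>j<fst \<omega> k. \<rho> (snd \<omega> (k, j))) = X k * X k" for k
    unfolding X_def prod.distrib[symmetric]
    by (intro prod.cong refl) (simp add: \<rho>_nonneg space_\<Omega>_mark[OF \<omega>])
  have "cloud_prod p (\<lambda>k z. if k < n then \<rho> z else sqrt (\<rho> z)) \<omega> = (\<Prod>k<p. (if k < n then X k else 1) * X k)"
    unfolding cloud_prod_def by (intro prod.cong refl) (auto simp: sq X_def)
  also have "\<dots> = (\<Prod>k<p. if k < n then X k else 1) * (\<Prod>k<p. X k)" by (rule prod.distrib)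
  also have "(\<Prod>k<p. if k < n then X k else 1) = (\<Prod>k<n. X k)"
    by (rule prod.mono_neutral_cong_right) (use assms(1) in auto)
  finally have *: "cloud_prod p (\<lambda>k z. if k < n then \<rho> z else sqrt (\<rho> z)) \<omega> =
      cloud_prod n (\<lambda>k z. sqrt (\<rho> z)) \<omega> * cloud_prod p (\<lambda>k z. sqrt (\<rho> z)) \<omega>"
    by (simp only: cloud_prod_def X_def)
  have "exp (- (\<Sum>k<n. a k) / 2 - (\<Sum>k<p. a k) / 2) = exp (- (\<Sum>k<n. a k) / 2) * exp (- (\<Sum>k<p. a k) / 2)"
    by (simp flip: exp_add)
  then show ?thesis unfolding * r_def by (simp only: mult_ac)
qed

text \<open>
  The product \<open>r n \<cdot> r p\<close> has the weight \<open>\<rho>\<close> on the first \<open>n\<close> pieces, where the normalisation cancels its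
  expectation, and \<open>sqrt \<rho>\<close> on the others, where it leaves the Hellinger integral.
\<close>

lemma
  assumes "n \<le> p"
  shows integrable_r_prod: "integrable \<Omega> (\<lambda>\<omega>. r n \<omega> * r p \<omega>)"
    and integral_r_prod: "(\<integral>\<omega>. r n \<omega> * r p \<omega> \<partial>\<Omega>) = exp (- (\<Sum>k\<in>{n..<p}. e k) / 2)"
proof -
  define w where "w k z = (if k < n then \<rho> z else sqrt (\<rho> z))" for k z
  have w: "set_integrable m (B j) (w k)" for j k
    using \<rho>_integrable[of j] set_integrable_sqrt[of j] by (cases "k < n") (simp_all add: w_def[abs_def])
  have split: "(\<Sum>k<p. f k) = (\<Sum>k<n. f k) + (\<Sum>k\<in>{n..<p}. f k)" for f :: "nat \<Rightarrow> real"
    using sum.atLeastLessThan_concat[of 0 n p f] assms by (simp add: atLeast0LessThan)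
  let ?c = "exp (- (\<Sum>k<n. a k) / 2 - (\<Sum>k<p. a k) / 2)"
  have "integrable \<Omega> (\<lambda>\<omega>. cloud_prod p w \<omega> * ?c)"
    by (intro integrable_mult_left integrable_product_functional w)
  then show "integrable \<Omega> (\<lambda>\<omega>. r n \<omega> * r p \<omega>)"
    by (rule Bochner_Integration.integrable_cong[OF refl, THEN iffD2, rotated])
      (simp add: r_prod[OF assms] w_def[abs_def])
  have "(\<integral>\<omega>. r n \<omega> * r p \<omega> \<partial>\<Omega>) = (\<integral>\<omega>. cloud_prod p w \<omega> * ?c \<partial>\<Omega>)"
    by (intro Bochner_Integration.integral_cong refl) (simp add: r_prod[OF assms] w_def[abs_def])
  also have "\<dots> = exp (\<Sum>k<p. LINT z:B k|m. w k z - 1) * ?c"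
    by (simp add: integral_product_functional[OF w])
  also have "(\<Sum>k<p. LINT z:B k|m. w k z - 1) = (\<Sum>k<p. if k < n then a k else a k / 2 - e k / 2)"
    by (intro sum.cong refl) (auto simp: w_def a_def[symmetric] integral_sqrt)
  also have "\<dots> = (\<Sum>k<n. a k) + (\<Sum>k\<in>{n..<p}. a k / 2 - e k / 2)"
    unfolding split by (intro arg_cong2[where f="(+)"] sum.cong refl) auto
  also have "(\<Sum>k\<in>{n..<p}. a k / 2 - e k / 2) = ((\<Sum>k<p. a k) - (\<Sum>k<n. a k)) / 2 - (\<Sum>k\<in>{n..<p}. e k) / 2"
    by (simp add: split sum_subtractf sum_divide_distrib)
  also have "exp ((\<Sum>k<n. a k) + (((\<Sum>k<p. a k) - (\<Sum>k<n. a k)) / 2 - (\<Sum>k\<in>{n..<p}. e k) / 2)) * ?c =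
      exp (- (\<Sum>k\<in>{n..<p}. e k) / 2)"
    unfolding exp_add[symmetric] by (rule arg_cong[where f=exp]) (simp add: field_simps)
  finally show "(\<integral>\<omega>. r n \<omega> * r p \<omega> \<partial>\<Omega>) = exp (- (\<Sum>k\<in>{n..<p}. e k) / 2)" .
qed

lemma L1_distance_L:
  assumes "n \<le> p" "\<epsilon> > 0"
  shows "(\<integral>\<omega>. \<bar>L n \<omega> - L p \<omega>\<bar> \<partial>\<Omega>) \<le> (\<Sum>k\<in>{n..<p}. e k) / (2 * \<epsilon>) + 2 * \<epsilon>"
proof -
  let ?R = "\<lambda>\<omega>. (L n \<omega> + L p \<omega> - 2 * (r n \<omega> * r p \<omega>)) / (2 * \<epsilon>) + \<epsilon> * (L n \<omega> + L p \<omega>)"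
  have i: "integrable \<Omega> (\<lambda>\<omega>. L n \<omega> + L p \<omega> - 2 * (r n \<omega> * r p \<omega>))"
    by (intro Bochner_Integration.integrable_diff Bochner_Integration.integrable_add integrable_mult_right integrable_L integrable_r_prod assms)
  have i2: "integrable \<Omega> (\<lambda>\<omega>. L n \<omega> + L p \<omega>)" by (intro Bochner_Integration.integrable_add integrable_L)
  have iR: "integrable \<Omega> ?R"
    by (intro Bochner_Integration.integrable_add[OF integrable_divide[OF i]] integrable_mult_right i2)
  have "(\<integral>\<omega>. \<bar>L n \<omega> - L p \<omega>\<bar> \<partial>\<Omega>) \<le> (\<integral>\<omega>. ?R \<omega> \<partial>\<Omega>)"
  proof (rule integral_mono_AE[OF _ iR AE_I2])
    show "integrable \<Omega> (\<lambda>\<omega>. \<bar>L n \<omega> - L p \<omega>\<bar>)"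
      by (intro integrable_abs Bochner_Integration.integrable_diff integrable_L)
    show "\<bar>L n \<omega> - L p \<omega>\<bar> \<le> ?R \<omega>" if "\<omega> \<in> space \<Omega>" for \<omega>
      using abs_diff_squares_le[OF assms(2), of "r n \<omega>" "r p \<omega>"] by (simp add: r_square[OF that])
  qed
  also have "(\<integral>\<omega>. ?R \<omega> \<partial>\<Omega>) = (2 - 2 * exp (- (\<Sum>k\<in>{n..<p}. e k) / 2)) / (2 * \<epsilon>) + \<epsilon> * 2"
    using i i2 by (simp add: Bochner_Integration.integral_add[OF integrable_divide[OF i] integrable_mult_right[OF i2]]
        integrable_L integrable_r_prod[OF assms(1)] integral_L integral_r_prod[OF assms(1)])
  also have "2 - 2 * exp (- (\<Sum>k\<in>{n..<p}. e k) / 2) \<le> (\<Sum>k\<in>{n..<p}. e k)"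
    using exp_ge_add_one_self[of "- (\<Sum>k\<in>{n..<p}. e k) / 2"] by simp
  then have "(2 - 2 * exp (- (\<Sum>k\<in>{n..<p}. e k) / 2)) / (2 * \<epsilon>) \<le> (\<Sum>k\<in>{n..<p}. e k) / (2 * \<epsilon>)"
    using assms(2) by (intro divide_right_mono) auto
  finally show ?thesis by simp
qed

lemma L_Cauchy:
  assumes "\<delta> > 0"
  shows "\<exists>N. \<forall>n\<ge>N. \<forall>p\<ge>N. (\<integral>\<omega>. \<bar>L n \<omega> - L p \<omega>\<bar> \<partial>\<Omega>) < \<delta>"
proof -
\<comment> \<open>if the Hellinger sum is below \<open>\<epsilon>\<^sup>2\<close>, the bound on the distance is \<open>\<epsilon> / 2 + 2 \<epsilon> < \<delta>\<close>\<close>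
  define \<epsilon> where "\<epsilon> = \<delta> / 4"
  have \<epsilon>: "\<epsilon> > 0" using assms by (simp add: \<epsilon>_def)
  obtain N where N: "\<And>n p. n \<ge> N \<Longrightarrow> norm (\<Sum>k\<in>{n..<p}. e k) < \<epsilon>\<^sup>2"
    using summable_e \<epsilon> unfolding summable_Cauchy by (meson zero_less_power)
  have *: "(\<integral>\<omega>. \<bar>L n \<omega> - L p \<omega>\<bar> \<partial>\<Omega>) < \<delta>" if "n \<ge> N" "n \<le> p" for n p
  proof -
    have "(\<Sum>k\<in>{n..<p}. e k) / (2 * \<epsilon>) \<le> \<epsilon>\<^sup>2 / (2 * \<epsilon>)"
      using N[OF that(1), of p] \<epsilon> by (intro divide_right_mono) auto
    also have "\<dots> = \<epsilon> / 2" using \<epsilon> by (simp add: power2_eq_square)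
    finally show ?thesis using L1_distance_L[OF that(2) \<epsilon>] assms by (simp add: \<epsilon>_def)
  qed
  have "(\<integral>\<omega>. \<bar>L n \<omega> - L p \<omega>\<bar> \<partial>\<Omega>) < \<delta>" if "n \<ge> N" "p \<ge> N" for n p
    using *[of n p] *[of p n] that by (cases "n \<le> p") (auto simp: abs_minus_commute)
  then show ?thesis by blast
qed

text \<open>
  Completeness of \<open>L\<^sup>1\<close>: a subsequence converges almost surely, and Fatou's lemma gives its convergence
  in \<open>L\<^sup>1\<close>. Taking the maximum with \<open>0\<close> makes the limit nonnegative on the exceptional null set too.
\<close>

lemma L_limit:
  obtains \<Lambda> s where "integrable \<Omega> \<Lambda>" "\<And>\<omega>. 0 \<le> \<Lambda> \<omega>" "strict_mono (s :: nat \<Rightarrow> nat)"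
    "(\<lambda>i. \<integral>\<omega>. \<bar>L (s i) \<omega> - \<Lambda> \<omega>\<bar> \<partial>\<Omega>) \<longlonglongrightarrow> 0"
proof -
  obtain s where s: "strict_mono (s :: nat \<Rightarrow> nat)" "AE \<omega> in \<Omega>. Cauchy (\<lambda>i. L (s i) \<omega>)"
    using cauchy_L1_AE_cauchy_subseq[of \<Omega> L] integrable_L L_Cauchy by (auto simp: real_norm_def)
  define \<Lambda> where "\<Lambda> \<omega> = max 0 (lim (\<lambda>i. L (s i) \<omega>))" for \<omega>
  have Lm[measurable]: "L n \<in> borel_measurable \<Omega>" for n using integrable_L by auto
  have \<Lambda>m[measurable]: "\<Lambda> \<in> borel_measurable \<Omega>"
    unfolding \<Lambda>_def by (intro borel_measurable_max borel_measurable_const borel_measurable_lim_metric Lm)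
  have lim: "AE \<omega> in \<Omega>. (\<lambda>i. L (s i) \<omega>) \<longlonglongrightarrow> \<Lambda> \<omega>"
    using s(2) AE_space
  proof eventually_elim
    case (elim \<omega>)
    then have l: "(\<lambda>i. L (s i) \<omega>) \<longlonglongrightarrow> lim (\<lambda>i. L (s i) \<omega>)"
      by (simp add: Cauchy_convergent_iff convergent_LIMSEQ_iff)
    then have "0 \<le> lim (\<lambda>i. L (s i) \<omega>)"
      by (rule LIMSEQ_le_const) (use L_nonneg[OF elim(2)] in auto)
    then show ?case using l by (simp add: \<Lambda>_def)
  qed
  have close: "(\<integral>\<^sup>+\<omega>. ennreal \<bar>L (s i) \<omega> - \<Lambda> \<omega>\<bar> \<partial>\<Omega>) \<le> ennreal \<delta>"
    if N: "\<And>n p. n \<ge> N \<Longrightarrow> p \<ge> N \<Longrightarrow> (\<integral>\<omega>. \<bar>L n \<omega> - L p \<omega>\<bar> \<partial>\<Omega>) < \<delta>" and i: "i \<ge> N" for N i \<delta>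
  proof -
    have si: "j \<le> s j" for j using s(1) by (rule seq_suble)
    have "(\<integral>\<^sup>+\<omega>. ennreal \<bar>L (s i) \<omega> - \<Lambda> \<omega>\<bar> \<partial>\<Omega>) = (\<integral>\<^sup>+\<omega>. liminf (\<lambda>j. ennreal \<bar>L (s i) \<omega> - L (s j) \<omega>\<bar>) \<partial>\<Omega>)"
    proof (rule nn_integral_cong_AE)
      show "AE \<omega> in \<Omega>. ennreal \<bar>L (s i) \<omega> - \<Lambda> \<omega>\<bar> = liminf (\<lambda>j. ennreal \<bar>L (s i) \<omega> - L (s j) \<omega>\<bar>)"
        using lim
      proof eventually_elim
        case (elim \<omega>)
        then have "(\<lambda>j. ennreal \<bar>L (s i) \<omega> - L (s j) \<omega>\<bar>) \<longlonglongrightarrow> ennreal \<bar>L (s i) \<omega> - \<Lambda> \<omega>\<bar>"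
          by (intro tendsto_ennrealI tendsto_rabs tendsto_diff tendsto_const)
        then show ?case by (intro lim_imp_Liminf[symmetric]) auto
      qed
    qed
    also have "\<dots> \<le> liminf (\<lambda>j. \<integral>\<^sup>+\<omega>. ennreal \<bar>L (s i) \<omega> - L (s j) \<omega>\<bar> \<partial>\<Omega>)"
      by (rule nn_integral_liminf) measurable
    also have "\<dots> \<le> ennreal \<delta>"
    proof -
      have "(\<integral>\<^sup>+\<omega>. ennreal \<bar>L (s i) \<omega> - L (s j) \<omega>\<bar> \<partial>\<Omega>) \<le> ennreal \<delta>" if "j \<ge> N" for j
      proof -
        have "(\<integral>\<^sup>+\<omega>. ennreal \<bar>L (s i) \<omega> - L (s j) \<omega>\<bar> \<partial>\<Omega>) = ennreal (\<integral>\<omega>. \<bar>L (s i) \<omega> - L (s j) \<omega>\<bar> \<partial>\<Omega>)"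
          by (intro nn_integral_eq_integral integrable_abs Bochner_Integration.integrable_diff integrable_L) auto
        also have "\<dots> \<le> ennreal \<delta>"
          using N[of "s i" "s j"] si[of i] si[of j] i that by (intro ennreal_leI) auto
        finally show ?thesis .
      qed
      then show ?thesis
        by (intro Liminf_le) (auto simp: eventually_sequentially)
    qed
    finally show ?thesis .
  qed
  obtain N1 where N1: "\<And>n p. n \<ge> N1 \<Longrightarrow> p \<ge> N1 \<Longrightarrow> (\<integral>\<omega>. \<bar>L n \<omega> - L p \<omega>\<bar> \<partial>\<Omega>) < 1"
    using L_Cauchy[of 1] by auto
  have d: "integrable \<Omega> (\<lambda>\<omega>. L (s N1) \<omega> - \<Lambda> \<omega>)"
  proof (rule integrableI_bounded)
    have "(\<integral>\<^sup>+\<omega>. ennreal \<bar>L (s N1) \<omega> - \<Lambda> \<omega>\<bar> \<partial>\<Omega>) \<le> ennreal 1"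
      by (rule close[of N1]) (use N1 in auto)
    also have "\<dots> < \<infinity>" by simp
    finally show "(\<integral>\<^sup>+\<omega>. ennreal (norm (L (s N1) \<omega> - \<Lambda> \<omega>)) \<partial>\<Omega>) < \<infinity>" by simp
  qed measurable
  have \<Lambda>: "integrable \<Omega> \<Lambda>"
    using Bochner_Integration.integrable_diff[OF integrable_L[of "s N1"] d] by simp
  have "(\<lambda>i. \<integral>\<omega>. \<bar>L (s i) \<omega> - \<Lambda> \<omega>\<bar> \<partial>\<Omega>) \<longlonglongrightarrow> 0"
  proof (rule LIMSEQ_I)
    fix \<delta> :: real assume "\<delta> > 0"
    then obtain N where N: "\<And>n p. n \<ge> N \<Longrightarrow> p \<ge> N \<Longrightarrow> (\<integral>\<omega>. \<bar>L n \<omega> - L p \<omega>\<bar> \<partial>\<Omega>) < \<delta> / 2"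
      using L_Cauchy[of "\<delta> / 2"] by auto
    have "norm ((\<integral>\<omega>. \<bar>L (s i) \<omega> - \<Lambda> \<omega>\<bar> \<partial>\<Omega>) - 0) < \<delta>" if "i \<ge> N" for i
    proof -
      have "ennreal (\<integral>\<omega>. \<bar>L (s i) \<omega> - \<Lambda> \<omega>\<bar> \<partial>\<Omega>) = (\<integral>\<^sup>+\<omega>. ennreal \<bar>L (s i) \<omega> - \<Lambda> \<omega>\<bar> \<partial>\<Omega>)"
        by (intro nn_integral_eq_integral[symmetric] integrable_abs Bochner_Integration.integrable_diff integrable_L \<Lambda>) auto
      also have "\<dots> \<le> ennreal (\<delta> / 2)" by (rule close[of N]) (use N that in auto)
      finally have "(\<integral>\<omega>. \<bar>L (s i) \<omega> - \<Lambda> \<omega>\<bar> \<partial>\<Omega>) \<le> \<delta> / 2" using \<open>\<delta> > 0\<close> by simp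
      moreover have "0 \<le> (\<integral>\<omega>. \<bar>L (s i) \<omega> - \<Lambda> \<omega>\<bar> \<partial>\<Omega>)" by simp
      ultimately show ?thesis using \<open>\<delta> > 0\<close> by simp
    qed
    then show "\<exists>N. \<forall>i\<ge>N. norm ((\<integral>\<omega>. \<bar>L (s i) \<omega> - \<Lambda> \<omega>\<bar> \<partial>\<Omega>) - 0) < \<delta>" by blast
  qed
  then show thesis using that[OF \<Lambda> _ s(1)] by (simp add: \<Lambda>_def)
qed

text \<open>
  Reweighting the cloud by \<open>L n\<close> multiplies the intensity of the first \<open>n\<close> pieces by \<open>\<rho>\<close>.
\<close>

lemma fourier_L_limit:
  assumes f: "f \<in> C_c"
  shows "(\<lambda>n. \<integral>\<omega>. complex_of_real (L n \<omega>) * cloud_prod n (\<lambda>k. wave f) \<omega> \<partial>\<Omega>) \<longlonglongrightarrow>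
    exp (\<integral>(x, s). (exp (\<i> * complex_of_real (s * f x)) - 1) \<partial>density m \<rho>)"
proof -
  define w where "w z = complex_of_real (\<rho> z) * wave f z" for z
  have w: "set_integrable m (B j) w" for j
    unfolding w_def[abs_def] by (rule set_integrable_wave_times[OF f \<rho>_integrable])
  have [measurable]: "wave f \<in> borel_measurable m" by (rule measurable_wave[OF f])
  have int: "integrable m (\<lambda>z. \<rho> z *\<^sub>R (wave f z - 1))"
    using integrable_fourier_exponent[OF locally_finite_\<rho> f] unfolding wave_minus_1
    by (subst (asm) integrable_density) (auto simp: \<rho>_nonneg)
  have "(\<integral>\<omega>. complex_of_real (L n \<omega>) * cloud_prod n (\<lambda>k. wave f) \<omega> \<partial>\<Omega>) =
      exp (\<Sum>k<n. LINT z:B k|m. \<rho> z *\<^sub>R (wave f z - 1))" for n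
  proof -
    have "(\<integral>\<omega>. complex_of_real (L n \<omega>) * cloud_prod n (\<lambda>k. wave f) \<omega> \<partial>\<Omega>) =
        (\<integral>\<omega>. cloud_prod n (\<lambda>k. w) \<omega> * complex_of_real (exp (- (\<Sum>k<n. a k))) \<partial>\<Omega>)"
      by (intro Bochner_Integration.integral_cong refl)
        (simp add: L_def w_def[abs_def] cloud_prod_def prod.distrib)
    also have "\<dots> = exp (\<Sum>k<n. LINT z:B k|m. w z - 1) * complex_of_real (exp (- (\<Sum>k<n. a k)))"
      by (simp add: integral_product_functional[OF w])
    also have "\<dots> = exp (\<Sum>k<n. (LINT z:B k|m. w z - 1) - complex_of_real (a k))"
      by (simp add: exp_of_real[symmetric] sum_subtractf exp_diff exp_minus divide_inverse)
    also have "(\<Sum>k<n. (LINT z:B k|m. w z - 1) - complex_of_real (a k)) = (\<Sum>k<n. LINT z:B k|m. \<rho> z *\<^sub>R (wave f z - 1))"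
    proof (intro sum.cong refl)
      fix k
      have r1: "set_integrable m (B k) (\<lambda>z. \<rho> z - 1)"
        by (intro set_integral_diff(1) \<rho>_integrable set_integrable_one)
      have "complex_of_real (a k) = (LINT z:B k|m. complex_of_real (\<rho> z - 1))"
        unfolding a_def by (rule set_integral_complex_of_real[symmetric])
      then have "(LINT z:B k|m. w z - 1) - complex_of_real (a k) =
          (LINT z:B k|m. (w z - 1) - complex_of_real (\<rho> z - 1))"
        using set_integral_diff(2)[OF set_integral_diff(1)[OF w[of k] set_integrable_one] of_real_set_integrable[OF r1]] by simp
      also have "\<dots> = (LINT z:B k|m. \<rho> z *\<^sub>R (wave f z - 1))"
        unfolding set_lebesgue_integral_def
        by (intro Bochner_Integration.integral_cong refl) (simp add: w_def scaleR_conv_of_real algebra_simps)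
      finally show "(LINT z:B k|m. w z - 1) - complex_of_real (a k) = (LINT z:B k|m. \<rho> z *\<^sub>R (wave f z - 1))" .
    qed
    finally show ?thesis .
  qed
  moreover have "(\<integral>(x, s). (exp (\<i> * complex_of_real (s * f x)) - 1) \<partial>density m \<rho>) = (\<integral>z. \<rho> z *\<^sub>R (wave f z - 1) \<partial>m)"
    unfolding wave_minus_1 by (subst integral_density) (auto simp: \<rho>_nonneg)
  ultimately show ?thesis
    by (simp only:) (intro tendsto_exp sum_set_integral_tendsto int)
qed

text \<open>
  The waves have modulus \<open>1\<close>, so \<open>L\<^sup>1\<close> convergence of the likelihood ratios is enough to pass to the limit
  in the Fourier transforms. The value at \<open>f = 0\<close> shows that \<open>\<Lambda>\<close> is a probability density.
\<close>

theorem crm_density: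
  obtains \<Lambda> where "\<Lambda> \<in> borel_measurable \<Omega>"
    "completely_random_measure (density m \<rho>) (distr (density \<Omega> (\<lambda>\<omega>. ennreal (\<Lambda> \<omega>))) discrete_radon_space \<eta>)"
proof -
  obtain \<Lambda> and s :: "nat \<Rightarrow> nat" where \<Lambda>: "integrable \<Omega> \<Lambda>" "\<And>\<omega>. 0 \<le> \<Lambda> \<omega>" and s: "strict_mono s"
    and lim: "(\<lambda>i. \<integral>\<omega>. \<bar>L (s i) \<omega> - \<Lambda> \<omega>\<bar> \<partial>\<Omega>) \<longlonglongrightarrow> 0"
    using L_limit by blast
  have [measurable]: "\<Lambda> \<in> borel_measurable \<Omega>" using \<Lambda>(1) by auto
  let ?P = "density \<Omega> (\<lambda>\<omega>. ennreal (\<Lambda> \<omega>))"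
  let ?\<mu> = "distr ?P discrete_radon_space \<eta>"
  have \<eta>P: "\<eta> \<in> measurable ?P discrete_radon_space"
    using measurable_\<eta> by (simp add: measurable_cong_sets[OF sets_density refl])
  have ft: "(\<integral>\<eta>. exp (\<i> * complex_of_real (\<integral>x. f x \<partial>\<eta>)) \<partial>?\<mu>) =
      exp (\<integral>(x, s). (exp (\<i> * complex_of_real (s * f x)) - 1) \<partial>density m \<rho>)" if f: "f \<in> C_c" for f
  proof -
    let ?G = "\<lambda>\<eta>. exp (\<i> * complex_of_real (\<integral>x. f x \<partial>\<eta>))"
    have Gm[measurable]: "?G \<in> borel_measurable discrete_radon_space"
      using measurable_integral_discrete_radon_space[OF f] by measurable
    have G\<eta>[measurable]: "(\<lambda>\<omega>. ?G (\<eta> \<omega>)) \<in> borel_measurable \<Omega>"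
      by (rule measurable_compose[OF measurable_\<eta> Gm])
    define W where "W i \<omega> = cloud_prod (s i) (\<lambda>k. wave f) \<omega>" for i \<omega>
    have [measurable]: "W i \<in> borel_measurable \<Omega>" for i
      unfolding W_def[abs_def] by (rule measurable_cloud_prod) (rule measurable_wave[OF f])
    have W1: "norm (W i \<omega>) = 1" for i \<omega> by (simp add: W_def)
    have Wlim: "AE \<omega> in \<Omega>. (\<lambda>i. W i \<omega>) \<longlonglongrightarrow> ?G (\<eta> \<omega>)"
      using AE_cloud_prod_wave[OF f]
    proof eventually_elim
      case (elim \<omega>)
      from LIMSEQ_subseq_LIMSEQ[OF elim s] show ?case by (simp add: W_def o_def)
    qed
    have [measurable]: "L n \<in> borel_measurable \<Omega>" for n using integrable_L by auto
    have i1: "integrable \<Omega> (\<lambda>\<omega>. complex_of_real (\<Lambda> \<omega>) * W i \<omega>)" for i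
      by (rule Bochner_Integration.integrable_bound[OF \<Lambda>(1)]) (auto simp: norm_mult W1)
    have d: "integrable \<Omega> (\<lambda>\<omega>. L (s i) \<omega> - \<Lambda> \<omega>)" for i
      by (intro Bochner_Integration.integrable_diff integrable_L \<Lambda>)
    have i2: "integrable \<Omega> (\<lambda>\<omega>. complex_of_real (L (s i) \<omega> - \<Lambda> \<omega>) * W i \<omega>)" for i
      by (rule Bochner_Integration.integrable_bound[OF d[of i]])
        (auto simp: norm_mult W1 simp del: of_real_diff)
    have A: "(\<lambda>i. \<integral>\<omega>. complex_of_real (\<Lambda> \<omega>) * W i \<omega> \<partial>\<Omega>) \<longlonglongrightarrow> (\<integral>\<omega>. complex_of_real (\<Lambda> \<omega>) * ?G (\<eta> \<omega>) \<partial>\<Omega>)"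
    proof (rule integral_dominated_convergence[where w=\<Lambda>])
      show "AE \<omega> in \<Omega>. (\<lambda>i. complex_of_real (\<Lambda> \<omega>) * W i \<omega>) \<longlonglongrightarrow> complex_of_real (\<Lambda> \<omega>) * ?G (\<eta> \<omega>)"
        using Wlim by eventually_elim (intro tendsto_mult tendsto_const)
    qed (use \<Lambda> in \<open>auto simp: norm_mult W1\<close>)
    have B: "(\<lambda>i. \<integral>\<omega>. complex_of_real (L (s i) \<omega> - \<Lambda> \<omega>) * W i \<omega> \<partial>\<Omega>) \<longlonglongrightarrow> 0"
    proof (rule Lim_null_comparison[OF always_eventually lim], intro allI)
      fix i
      have "norm (\<integral>\<omega>. complex_of_real (L (s i) \<omega> - \<Lambda> \<omega>) * W i \<omega> \<partial>\<Omega>) \<le>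
          (\<integral>\<omega>. norm (complex_of_real (L (s i) \<omega> - \<Lambda> \<omega>) * W i \<omega>) \<partial>\<Omega>)"
        by (rule integral_norm_bound)
      also have "\<dots> = (\<integral>\<omega>. \<bar>L (s i) \<omega> - \<Lambda> \<omega>\<bar> \<partial>\<Omega>)"
        by (intro Bochner_Integration.integral_cong refl) (simp add: norm_mult W1 del: of_real_diff)
      finally show "norm (\<integral>\<omega>. complex_of_real (L (s i) \<omega> - \<Lambda> \<omega>) * W i \<omega> \<partial>\<Omega>) \<le> (\<integral>\<omega>. \<bar>L (s i) \<omega> - \<Lambda> \<omega>\<bar> \<partial>\<Omega>)" .
    qed
    have "(\<lambda>i. \<integral>\<omega>. complex_of_real (L (s i) \<omega>) * W i \<omega> \<partial>\<Omega>) \<longlonglongrightarrow> 0 + (\<integral>\<omega>. complex_of_real (\<Lambda> \<omega>) * ?G (\<eta> \<omega>) \<partial>\<Omega>)"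
    proof -
      have "(\<integral>\<omega>. complex_of_real (L (s i) \<omega>) * W i \<omega> \<partial>\<Omega>) =
        (\<integral>\<omega>. complex_of_real (L (s i) \<omega> - \<Lambda> \<omega>) * W i \<omega> \<partial>\<Omega>) + (\<integral>\<omega>. complex_of_real (\<Lambda> \<omega>) * W i \<omega> \<partial>\<Omega>)" for i
        unfolding Bochner_Integration.integral_add[OF i2 i1, symmetric]
        by (intro Bochner_Integration.integral_cong refl) (simp add: algebra_simps)
      then show ?thesis using tendsto_add[OF B A] by simp
    qed
    moreover have "(\<lambda>i. \<integral>\<omega>. complex_of_real (L (s i) \<omega>) * W i \<omega> \<partial>\<Omega>) \<longlonglongrightarrow>
        exp (\<integral>(x, s). (exp (\<i> * complex_of_real (s * f x)) - 1) \<partial>density m \<rho>)"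
      using LIMSEQ_subseq_LIMSEQ[OF fourier_L_limit[OF f] s] by (simp add: o_def W_def)
    ultimately have "(\<integral>\<omega>. complex_of_real (\<Lambda> \<omega>) * ?G (\<eta> \<omega>) \<partial>\<Omega>) =
        exp (\<integral>(x, s). (exp (\<i> * complex_of_real (s * f x)) - 1) \<partial>density m \<rho>)"
      using LIMSEQ_unique by fastforce
    moreover have "(\<integral>\<eta>. ?G \<eta> \<partial>?\<mu>) = (\<integral>\<omega>. complex_of_real (\<Lambda> \<omega>) * ?G (\<eta> \<omega>) \<partial>\<Omega>)"
      by (simp add: integral_distr[OF \<eta>P Gm] integral_density \<Lambda>(2) scaleR_conv_of_real)
    ultimately show ?thesis by simp
  qed
  have "prob_space ?\<mu>"
  proof -
    have "complex_of_real (\<integral>\<omega>. \<Lambda> \<omega> \<partial>\<Omega>) = (\<integral>\<eta>. 1 \<partial>?\<mu>)"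
      by (simp add: integral_distr[OF \<eta>P] integral_density \<Lambda>(2) scaleR_conv_of_real del: lebesgue_integral_const)
    also have "\<dots> = 1" using ft[OF C_c_zero] by (simp add: case_prod_const)
    finally have "(\<integral>\<omega>. \<Lambda> \<omega> \<partial>\<Omega>) = 1" by simp
    then have "(\<integral>\<^sup>+\<omega>. ennreal (\<Lambda> \<omega>) \<partial>\<Omega>) = 1"
      using nn_integral_eq_integral[OF \<Lambda>(1)] \<Lambda>(2) by simp
    then have "emeasure ?P (space ?P) = 1"
      by (simp add: emeasure_density cong: nn_integral_cong)
    then have "prob_space ?P" by (rule prob_spaceI)
    then show ?thesis by (rule prob_space.prob_space_distr[OF _ \<eta>P])
  qed
  with ft have "completely_random_measure (density m \<rho>) ?\<mu>"
    by (simp add: completely_random_measure_def)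
  then show thesis using that[of \<Lambda>] by simp
qed

end

text \<open>
  By uniqueness both laws are images under \<open>\<eta>\<close> of measures on the probability space of the cloud, one of
  which has a density with respect to the other.
\<close>

theorem crm_absolutely_continuous:
  fixes m :: "('a::euclidean_space \<times> real) measure"
  assumes sf: "sigma_finite_measure m" and nz: "emeasure m (space m) \<noteq> 0"
    and lf: "locally_finite_intensity m" and lf': "locally_finite_intensity (density m (\<lambda>z. ennreal (\<rho> z)))"
    and \<rho>: "\<rho> \<in> borel_measurable m" "\<And>z. z \<in> space m \<Longrightarrow> 0 \<le> \<rho> z"
    and hellinger: "(\<integral>\<^sup>+z. ennreal ((sqrt (\<rho> z) - 1)\<^sup>2) \<partial>m) < \<infinity>"
    and \<mu>: "completely_random_measure m \<mu>"
    and \<mu>': "completely_random_measure (density m (\<lambda>z. ennreal (\<rho> z))) \<mu>'"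
  shows "absolutely_continuous \<mu> \<mu>'"
proof -
  obtain B where B: "cut_intensity m B" "\<And>k. set_integrable m (B k) \<rho>"
    using exists_cut_intensity[OF sf nz \<rho>] by blast
  interpret hellinger_cloud m B \<rho>
    by (intro hellinger_cloud.intro marked_cloud.intro hellinger_cloud_axioms.intro marked_cloud_axioms.intro
        B lf lf' \<rho> hellinger)
  obtain \<Lambda> where [measurable]: "\<Lambda> \<in> borel_measurable \<Omega>"
    and \<Lambda>: "completely_random_measure (density m \<rho>) (distr (density \<Omega> (\<lambda>\<omega>. ennreal (\<Lambda> \<omega>))) discrete_radon_space \<eta>)"
    using crm_density by blast
  let ?P = "density \<Omega> (\<lambda>\<omega>. ennreal (\<Lambda> \<omega>))"
  have 1: "\<mu> = distr \<Omega> discrete_radon_space \<eta>"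
    using \<mu> crm_cloud unfolding completely_random_measure_def by (intro fourier_transform_determines) auto
  have 2: "\<mu>' = distr ?P discrete_radon_space \<eta>"
    using \<mu>' \<Lambda> unfolding completely_random_measure_def by (intro fourier_transform_determines) auto
  have \<eta>P: "\<eta> \<in> measurable ?P discrete_radon_space"
    using measurable_\<eta> by (simp add: measurable_cong_sets[OF sets_density refl])
  have "absolutely_continuous \<Omega> ?P" by (rule absolutely_continuousI_density) measurable
  then show ?thesis
    unfolding 1 2 absolutely_continuous_def
    by (auto simp: null_sets_distr_iff[OF measurable_\<eta>] null_sets_distr_iff[OF \<eta>P] subset_iff)
qed

section \<open>Functionals of the atoms of a random discrete measure\<close>

text \<open>
  The indicator of \<open>U\<close> is a limit of test functions supported in the closure of \<open>U\<close>.
\<close>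

lemma measurable_emeasure_open:
  fixes U :: "'a::euclidean_space set"
  assumes U: "open U" "bounded U"
  shows "(\<lambda>\<eta>. emeasure \<eta> U) \<in> borel_measurable discrete_radon_space"
proof -
  define f where "f n x = min 1 (real n * infdist x (- U))" for n x
  have ne: "- U \<noteq> {}" using U(2) by (metis Compl_empty_eq double_complement not_bounded_UNIV)
  obtain R where R: "\<And>x. x \<in> U \<Longrightarrow> norm x \<le> R" using U(2) by (auto simp: bounded_iff)
  have f_out: "f n x = 0" if "x \<notin> U" for n x
    using that by (simp add: f_def)
  have f_C: "f n \<in> C_c" for n
  proof (rule C_cI[of _ R])
    show "continuous_on UNIV (f n)" unfolding f_def by (intro continuous_intros)
    show "norm x \<le> R" if "f n x \<noteq> 0" for x using that f_out R by blast
  qed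
  have f_bnd: "0 \<le> f n x" "f n x \<le> 1" for n x
    by (auto simp: f_def infdist_nonneg)
  have f_lim: "(\<lambda>n. f n x) \<longlonglongrightarrow> indicator U x" for x
  proof (cases "x \<in> U")
    case True
    then have d: "infdist x (- U) > 0"
      using U(1) ne by (metis Compl_iff closed_Compl in_closed_iff_infdist_zero infdist_nonneg order_less_le)
    obtain n0 where n0: "1 / infdist x (- U) < real n0" using reals_Archimedean2 by blast
    have "f n x = 1" if "n \<ge> n0" for n
    proof -
      have "1 / infdist x (- U) \<le> real n" using n0 that by linarith
      then show ?thesis using d by (simp add: f_def field_simps)
    qed
    then have "eventually (\<lambda>n. f n x = indicator U x) sequentially"
      using True by (auto simp: eventually_sequentially)
    then show ?thesis by (rule tendsto_eventually)
  qed (simp add: f_out)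
  have meas: "(\<lambda>\<eta>. measure \<eta> U) \<in> borel_measurable discrete_radon_space"
  proof (rule borel_measurable_LIMSEQ_real)
    show "(\<lambda>\<eta>. \<integral>x. f n x \<partial>\<eta>) \<in> borel_measurable discrete_radon_space" for n
      by (rule measurable_integral_discrete_radon_space[OF f_C])
    fix \<eta> :: "'a measure" assume "\<eta> \<in> space discrete_radon_space"
    then have \<eta>: "\<eta> \<in> radon_measures" by (simp add: space_discrete_radon_space discrete_imp_radon)
    have sets: "sets \<eta> = sets borel" by (rule sets_radon[OF \<eta>])
    have Us: "U \<in> sets \<eta>" using U(1) sets by simp
    have i: "integrable \<eta> (indicator U :: 'a \<Rightarrow> real)"
      using Us emeasure_radon_bounded[OF \<eta> U(2)] by (simp add: integrable_indicator_iff)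
    have "(\<lambda>n. \<integral>x. f n x \<partial>\<eta>) \<longlonglongrightarrow> (\<integral>x. indicator U x \<partial>\<eta>)"
    proof (rule integral_dominated_convergence[where w="indicator U"])
      show "f n \<in> borel_measurable \<eta>" for n
        using borel_measurable_C_c[OF f_C] by (simp add: measurable_cong_sets[OF sets refl])
      show "AE x in \<eta>. norm (f n x) \<le> indicator U x" for n
        using f_bnd f_out by (intro AE_I2) (auto simp: indicator_def)
    qed (use i f_lim in auto)
    then show "(\<lambda>n. \<integral>x. f n x \<partial>\<eta>) \<longlonglongrightarrow> measure \<eta> U" using Us by simp
  qed
  have "emeasure \<eta> U = ennreal (measure \<eta> U)" if "\<eta> \<in> space discrete_radon_space" for \<eta>
  proof -
    have \<eta>: "\<eta> \<in> radon_measures" using that by (simp add: space_discrete_radon_space discrete_imp_radon)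
    show ?thesis using emeasure_radon_bounded[OF \<eta> U(2)] by (simp add: emeasure_eq_ennreal_measure)
  qed
  then show ?thesis
    using measurable_compose[OF meas measurable_ennreal] by (subst measurable_cong) auto
qed

text \<open>
  A Radon measure restricted to a ball and divided by a number exceeding its mass is a
  subprobability; in this form the evaluation map becomes a measurable kernel.
\<close>

definition window :: "nat \<Rightarrow> 'a::euclidean_space measure \<Rightarrow> 'a measure" where
  "window k \<eta> = density \<eta> (\<lambda>x. indicator (ball 0 (real k)) x / (1 + emeasure \<eta> (ball 0 (real k))))"

lemma borel_measurable_window:
  assumes "sets \<eta> = sets borel"
  shows "(\<lambda>x. indicator (ball 0 (real k)) x / (c :: ennreal)) \<in> borel_measurable \<eta>"
proof -
  have [measurable]: "ball 0 (real k) \<in> sets \<eta>" using assms by simp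
  show ?thesis by measurable
qed

lemma emeasure_window:
  assumes \<eta>: "\<eta> \<in> radon_measures" and A: "A \<in> sets borel"
  shows "emeasure (window k \<eta>) A = emeasure \<eta> (A \<inter> ball 0 (real k)) / (1 + emeasure \<eta> (ball 0 (real k)))"
proof -
  have sets[measurable_cong]: "sets \<eta> = sets borel" by (rule sets_radon[OF \<eta>])
  note [measurable] = A
  let ?c = "1 + emeasure \<eta> (ball 0 (real k))"
  have "emeasure (window k \<eta>) A = (\<integral>\<^sup>+x. indicator (ball 0 (real k)) x / ?c * indicator A x \<partial>\<eta>)"
    unfolding window_def by (rule emeasure_density) (use sets A in \<open>auto intro!: borel_measurable_window\<close>)
  also have "\<dots> = (\<integral>\<^sup>+x. indicator (A \<inter> ball 0 (real k)) x / ?c \<partial>\<eta>)"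
    by (intro nn_integral_cong) (auto simp: indicator_def)
  also have "\<dots> = emeasure \<eta> (A \<inter> ball 0 (real k)) / ?c"
  proof -
    have "A \<inter> ball 0 (real k) \<in> sets \<eta>" using sets A by simp
    then show ?thesis by (subst nn_integral_divide) (rule borel_measurable_indicator, simp_all)
  qed
  finally show ?thesis .
qed

lemma measurable_window: "window k \<in> measurable discrete_radon_space (subprob_algebra borel)"
proof (rule measurable_subprob_algebra_generated[where \<Omega>=UNIV and G="{U. open U}"])
  have rad: "\<eta> \<in> radon_measures" if "\<eta> \<in> space discrete_radon_space" for \<eta> :: "'a measure"
    using that by (simp add: space_discrete_radon_space discrete_imp_radon)
  show "sets (borel :: 'a measure) = sigma_sets UNIV {U. open U}"
    by (simp add: borel_def)
  show "Int_stable {U :: 'a set. open U}" by (auto simp: Int_stable_def)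
  show "sets (window k \<eta>) = sets borel" if "\<eta> \<in> space discrete_radon_space" for \<eta> :: "'a measure"
    using sets_radon[OF rad[OF that]] by (simp add: window_def)
  show "subprob_space (window k \<eta>)" if "\<eta> \<in> space discrete_radon_space" for \<eta> :: "'a measure"
  proof (rule subprob_spaceI)
    have sp: "space (window k \<eta>) = UNIV"
      using sets_eq_imp_space_eq[OF sets_radon[OF rad[OF that]]] by (simp add: window_def)
    have "emeasure (window k \<eta>) UNIV = emeasure \<eta> (ball 0 (real k)) / (1 + emeasure \<eta> (ball 0 (real k)))"
      using emeasure_window[OF rad[OF that], of UNIV k] by simp
    also have "\<dots> \<le> 1" by (rule divide_le_posI_ennreal) (auto simp: add_pos_nonneg)
    finally show "emeasure (window k \<eta>) (space (window k \<eta>)) \<le> 1" by (simp add: sp)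
    show "space (window k \<eta>) \<noteq> {}" by (simp add: sp)
  qed
  have m: "(\<lambda>\<eta>. emeasure (window k \<eta>) U) \<in> borel_measurable discrete_radon_space" if "open U" for U :: "'a set"
  proof -
    have b: "bounded (U \<inter> ball 0 (real k))" by (rule bounded_Int) auto
    have [measurable]: "(\<lambda>\<eta>. emeasure \<eta> (U \<inter> ball 0 (real k))) \<in> borel_measurable discrete_radon_space"
      "(\<lambda>\<eta>. emeasure \<eta> (ball (0::'a) (real k))) \<in> borel_measurable discrete_radon_space"
      using that b by (auto intro!: measurable_emeasure_open)
    have "(\<lambda>\<eta>. emeasure \<eta> (U \<inter> ball 0 (real k)) / (1 + emeasure \<eta> (ball 0 (real k)))) \<in> borel_measurable discrete_radon_space"
      by measurable
    then show ?thesis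
      using that emeasure_window[OF rad, of _ U k] by (subst measurable_cong) auto
  qed
  show "(\<lambda>\<eta>. emeasure (window k \<eta>) A) \<in> borel_measurable discrete_radon_space" if "A \<in> {U. open U}" for A :: "'a set"
    using m that by simp
  show "(\<lambda>\<eta>. emeasure (window k \<eta>) (UNIV :: 'a set)) \<in> borel_measurable discrete_radon_space"
    by (rule m) simp
qed simp

lemma nn_integral_radon_window:
  fixes \<eta> :: "'a::euclidean_space measure"
  assumes \<eta>: "\<eta> \<in> radon_measures" and h: "h \<in> borel_measurable borel"
  shows "(\<integral>\<^sup>+x. h x \<partial>\<eta>) = (SUP k. (1 + emeasure \<eta> (ball 0 (real k))) * (\<integral>\<^sup>+x. h x \<partial>window k \<eta>))"
proof -
  have sets[measurable_cong]: "sets \<eta> = sets borel" by (rule sets_radon[OF \<eta>])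
  note [measurable] = h
  have "(1 + emeasure \<eta> (ball 0 (real k))) * (\<integral>\<^sup>+x. h x \<partial>window k \<eta>) = (\<integral>\<^sup>+x. h x * indicator (ball 0 (real k)) x \<partial>\<eta>)" for k
  proof -
    let ?c = "1 + emeasure \<eta> (ball 0 (real k))"
    have c: "?c \<noteq> 0" "?c \<noteq> \<infinity>" using emeasure_radon_bounded[OF \<eta> bounded_ball[of 0 "real k"]] by auto
    have "(\<integral>\<^sup>+x. h x \<partial>window k \<eta>) = (\<integral>\<^sup>+x. indicator (ball 0 (real k)) x / ?c * h x \<partial>\<eta>)"
      unfolding window_def by (rule nn_integral_density) (auto intro!: borel_measurable_window sets)
    also have "?c * \<dots> = (\<integral>\<^sup>+x. ?c * (indicator (ball 0 (real k)) x / ?c * h x) \<partial>\<eta>)"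
      using h by (intro nn_integral_cmult[symmetric] borel_measurable_times_ennreal borel_measurable_window sets)
        (simp add: measurable_cong_sets[OF sets refl])
    also have "\<dots> = (\<integral>\<^sup>+x. h x * indicator (ball 0 (real k)) x \<partial>\<eta>)"
    proof (intro nn_integral_cong)
      fix x
      have "?c * (1 / ?c) = ?c / ?c" by (simp add: ennreal_times_divide)
      also have "\<dots> = 1" by (rule ennreal_divide_self[OF c(1)]) (use c(2) in \<open>simp add: less_top\<close>)
      finally have "?c * (1 / ?c) = 1" .
      then show "?c * (indicator (ball 0 (real k)) x / ?c * h x) = h x * indicator (ball 0 (real k)) x"
        by (auto simp: indicator_def mult.assoc[symmetric])
    qed
    finally show ?thesis .
  qed
  then have "(SUP k. (1 + emeasure \<eta> (ball 0 (real k))) * (\<integral>\<^sup>+x. h x \<partial>window k \<eta>)) =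
      (SUP k. \<integral>\<^sup>+x. h x * indicator (ball 0 (real k)) x \<partial>\<eta>)" by simp
  also have "\<dots> = (\<integral>\<^sup>+x. (SUP k. h x * indicator (ball 0 (real k)) x) \<partial>\<eta>)"
    by (rule nn_integral_monotone_convergence_SUP[symmetric])
      (auto simp: incseq_def le_fun_def indicator_def)
  also have "\<dots> = (\<integral>\<^sup>+x. h x \<partial>\<eta>)"
  proof (intro nn_integral_cong antisym SUP_least)
    fix x :: 'a
    obtain k where "norm x < real k" using reals_Archimedean2 by blast
    then have "h x \<le> h x * indicator (ball 0 (real k)) x" by simp
    then show "h x \<le> (SUP k. h x * indicator (ball 0 (real k)) x)" by (rule SUP_upper2[rotated]) simp
  qed (auto simp: indicator_def)
  finally show ?thesis by simp
qed

text \<open>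
  Integration against a measurable kernel of subprobabilities is measurable; the windows reduce the
  Radon case to this one.
\<close>

lemma measurable_nn_integral_radon:
  fixes T :: "'b \<Rightarrow> 'a::euclidean_space measure"
  assumes T: "T \<in> measurable N discrete_radon_space"
    and h: "(\<lambda>(y, x). h y x) \<in> borel_measurable (N \<Otimes>\<^sub>M borel)"
  shows "(\<lambda>y. \<integral>\<^sup>+x. h y x \<partial>T y) \<in> borel_measurable N"
proof -
  have "(\<lambda>y. SUP k. (1 + emeasure (T y) (ball 0 (real k))) * (\<integral>\<^sup>+x. h y x \<partial>window k (T y))) \<in> borel_measurable N"
  proof (intro borel_measurable_SUP borel_measurable_times_ennreal borel_measurable_add borel_measurable_const)
    fix k :: nat
    show "(\<lambda>y. emeasure (T y) (ball 0 (real k))) \<in> borel_measurable N"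
      by (rule measurable_compose[OF T measurable_emeasure_open]) auto
    show "(\<lambda>y. \<integral>\<^sup>+x. h y x \<partial>window k (T y)) \<in> borel_measurable N"
      by (rule nn_integral_measurable_subprob_algebra2[OF h measurable_compose[OF T measurable_window]])
  qed simp
  moreover have "(\<integral>\<^sup>+x. h y x \<partial>T y) = (SUP k. (1 + emeasure (T y) (ball 0 (real k))) * (\<integral>\<^sup>+x. h y x \<partial>window k (T y)))"
    if "y \<in> space N" for y
  proof (rule nn_integral_radon_window)
    show "T y \<in> radon_measures"
      using measurable_space[OF T that] by (simp add: space_discrete_radon_space discrete_imp_radon)
    show "h y \<in> borel_measurable borel"
      using measurable_Pair_compose_split[OF h measurable_const measurable_ident, OF that] by simp
  qed
  ultimately show ?thesis by (subst measurable_cong) auto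
qed

lemma measurable_point_mass:
  "(\<lambda>(\<eta>, x). measure \<eta> {x}) \<in> borel_measurable (discrete_radon_space \<Otimes>\<^sub>M (borel :: 'a::euclidean_space measure))"
proof -
  let ?N = "discrete_radon_space \<Otimes>\<^sub>M (borel :: 'a measure)"
  have "(\<lambda>p. \<integral>\<^sup>+y. indicator {0} (y - snd p) \<partial>fst p) \<in> borel_measurable ?N"
    by (rule measurable_nn_integral_radon) measurable
  moreover have "(\<integral>\<^sup>+y. indicator {0} (y - snd p) \<partial>fst p) = emeasure (fst p) {snd p}" if "p \<in> space ?N" for p
  proof -
    have "fst p \<in> radon_measures"
      using that by (auto simp: space_pair_measure space_discrete_radon_space discrete_imp_radon)
    then have "{snd p} \<in> sets (fst p)" by (simp add: sets_radon)
    then have "emeasure (fst p) {snd p} = (\<integral>\<^sup>+y. indicator {snd p} y \<partial>fst p)" by simp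
    also have "\<dots> = (\<integral>\<^sup>+y. indicator {0} (y - snd p) \<partial>fst p)"
      by (intro nn_integral_cong) (auto simp: indicator_def)
    finally show ?thesis by simp
  qed
  ultimately have "(\<lambda>p. emeasure (fst p) {snd p}) \<in> borel_measurable ?N" by (subst measurable_cong) auto
  then show ?thesis unfolding measure_def case_prod_unfold by measurable
qed

text \<open>
  For a discrete \<open>\<eta>\<close>, the sum of \<open>g (x, \<eta> {x})\<close> over the atoms \<open>x\<close> of \<open>\<eta>\<close> is the integral of
  \<open>g (x, \<eta> {x}) / \<eta> {x}\<close> with respect to \<open>\<eta>\<close> itself, which depends measurably on \<open>\<eta>\<close>. Points
  that are not atoms get the harmless weight \<open>1\<close>.
\<close>

definition atom_weight :: "'a measure \<Rightarrow> 'a \<Rightarrow> real" where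
  "atom_weight \<eta> x = (if measure \<eta> {x} > 0 then measure \<eta> {x} else 1)"

definition atom_sum :: "('a \<times> real \<Rightarrow> ennreal) \<Rightarrow> 'a measure \<Rightarrow> ennreal" where
  "atom_sum g \<eta> = (\<integral>\<^sup>+x. g (x, atom_weight \<eta> x) / ennreal (atom_weight \<eta> x) \<partial>\<eta>)"

lemma measurable_atom_weight:
  "(\<lambda>(\<eta>, x). atom_weight \<eta> x) \<in> borel_measurable (discrete_radon_space \<Otimes>\<^sub>M (borel :: 'a::euclidean_space measure))"
proof -
  have [measurable]: "(\<lambda>p. measure (fst p) {snd p}) \<in> borel_measurable (discrete_radon_space \<Otimes>\<^sub>M (borel :: 'a measure))"
    using measurable_point_mass by (simp add: case_prod_unfold)
  show ?thesis unfolding atom_weight_def case_prod_unfold by measurable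
qed

lemma atom_weight_pos: "atom_weight \<eta> x > 0" by (simp add: atom_weight_def)

lemma measurable_at_atom:
  fixes g :: "'a::euclidean_space \<times> real \<Rightarrow> ennreal"
  assumes g: "g \<in> borel_measurable lborel_marked"
  shows "(\<lambda>(\<eta>, x). g (x, atom_weight \<eta> x) / ennreal (atom_weight \<eta> x)) \<in>
    borel_measurable (discrete_radon_space \<Otimes>\<^sub>M (borel :: 'a measure))"
proof -
  let ?N = "discrete_radon_space \<Otimes>\<^sub>M (borel :: 'a measure)"
  have w[measurable]: "(\<lambda>p. atom_weight (fst p) (snd p)) \<in> borel_measurable ?N"
    using measurable_atom_weight by (simp add: case_prod_unfold)
  have w': "(\<lambda>p. atom_weight (fst p) (snd p)) \<in> measurable ?N (restrict_space lborel {0<..})"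
    by (rule measurable_restrict_space2) (use w atom_weight_pos in auto)
  have "(\<lambda>p. (snd p, atom_weight (fst p) (snd p))) \<in> measurable ?N lborel_marked"
    unfolding lborel_marked_def by (rule measurable_Pair[OF _ w']) simp
  from measurable_compose[OF this g] show ?thesis
    unfolding case_prod_unfold by measurable
qed

lemma measurable_atom_sum:
  fixes g :: "'a::euclidean_space \<times> real \<Rightarrow> ennreal"
  assumes g: "g \<in> borel_measurable lborel_marked"
  shows "atom_sum g \<in> borel_measurable discrete_radon_space"
  unfolding atom_sum_def[abs_def]
  by (rule measurable_nn_integral_radon[OF _ measurable_at_atom[OF g]]) simp

text \<open>
  The logarithms of the factors are summed over positive and negative parts separately, so that both
  sums make sense in \<open>[0, \<infinity>]\<close>.
\<close>

definition atom_prod :: "('a \<times> real \<Rightarrow> real) \<Rightarrow> 'a measure \<Rightarrow> real" where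
  "atom_prod w \<eta> = exp (enn2real (atom_sum (\<lambda>z. ennreal (ln (w z))) \<eta>) -
     enn2real (atom_sum (\<lambda>z. ennreal (- ln (w z))) \<eta>))"

lemma measurable_atom_prod:
  fixes w :: "'a::euclidean_space \<times> real \<Rightarrow> real"
  assumes "w \<in> borel_measurable lborel_marked"
  shows "atom_prod w \<in> borel_measurable discrete_radon_space"
proof -
  have [measurable]: "atom_sum (\<lambda>z. ennreal (ln (w z))) \<in> borel_measurable discrete_radon_space"
    "atom_sum (\<lambda>z. ennreal (- ln (w z))) \<in> borel_measurable discrete_radon_space"
    using assms by (auto intro!: measurable_atom_sum)
  show ?thesis unfolding atom_prod_def[abs_def] by measurable
qed

lemma atom_prod_inverse:
  assumes "\<And>z. w z > 0" shows "atom_prod (\<lambda>z. inverse (w z)) \<eta> = inverse (atom_prod w \<eta>)"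
  using assms by (simp add: atom_prod_def ln_inverse exp_diff)

context marked_cloud
begin

text \<open>
  If the positions are distinct, the mass of the random measure at each point of the cloud is exactly
  the weight of that point.
\<close>

lemma atom_sum_atoms:
  assumes g: "g \<in> borel_measurable lborel_marked" and \<omega>: "\<omega> \<in> space \<Omega>" and rad: "atoms \<omega> \<in> radon_measures"
    and distinct: "\<And>i i'. i \<noteq> i' \<Longrightarrow> fst (snd \<omega> i) \<noteq> fst (snd \<omega> i')"
  shows "atom_sum g (atoms \<omega>) = cloud_sum g \<omega>"
proof -
  have disc: "atoms \<omega> \<in> discrete_radon_measures" using \<eta>_discrete[of \<omega>] rad by (simp add: \<eta>_def)
  have "(\<lambda>x. g (x, atom_weight (atoms \<omega>) x) / ennreal (atom_weight (atoms \<omega>) x)) \<in> borel_measurable borel"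
    using measurable_Pair_compose_split[OF measurable_at_atom[OF g] measurable_const measurable_ident, of "atoms \<omega>"] disc
    by (simp add: space_discrete_radon_space)
  then have "atom_sum g (atoms \<omega>) = (\<integral>\<^sup>+i. (case snd \<omega> i of (x, s) \<Rightarrow>
      ennreal s * (g (x, atom_weight (atoms \<omega>) x) / ennreal (atom_weight (atoms \<omega>) x))) \<partial>count_space (pts \<omega>))"
    unfolding atom_sum_def by (simp add: nn_integral_atoms nn_integral_pts cloud_sum_def)
  also have "\<dots> = (\<integral>\<^sup>+i. g (snd \<omega> i) \<partial>count_space (pts \<omega>))"
  proof (intro nn_integral_cong)
    fix i assume i: "i \<in> space (count_space (pts \<omega>))"
    obtain x s where xs: "snd \<omega> i = (x, s)" by force
    have s: "s > 0" using mark_pos[OF \<omega>, of i] xs by simp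
    have "emeasure (atoms \<omega>) {x} = (\<integral>\<^sup>+j. ennreal (snd (snd \<omega> j)) * indicator {x} (fst (snd \<omega> j)) \<partial>count_space (pts \<omega>))"
      by (simp add: emeasure_atoms cloud_sum_def nn_integral_pts case_prod_beta)
    also have "\<dots> = (\<integral>\<^sup>+j. ennreal s * indicator {i} j \<partial>count_space (pts \<omega>))"
      using distinct[of _ i] xs by (intro nn_integral_cong) (force simp: indicator_def)
    also have "\<dots> = ennreal s" using i by (simp add: nn_integral_cmult)
    finally have "measure (atoms \<omega>) {x} = s" using s by (simp add: measure_def)
    then have "atom_weight (atoms \<omega>) x = s" using s by (simp add: atom_weight_def)
    then show "(case snd \<omega> i of (x, s) \<Rightarrow>
      ennreal s * (g (x, atom_weight (atoms \<omega>) x) / ennreal (atom_weight (atoms \<omega>) x))) = g (snd \<omega> i)"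
      using s by (simp add: xs ennreal_times_divide mult.commute[of "ennreal s"] mult_divide_eq_ennreal)
  qed
  finally show ?thesis by (simp add: nn_integral_pts_cloud_sum)
qed

text \<open>
  Under the law of the cloud, a product over the atoms has expectation at most
  \<open>exp (\<integral>(w - 1) dm)\<close>: almost surely only finitely many factors differ from \<open>1\<close>, so the products over
  the first \<open>n\<close> pieces, whose expectations are known, are eventually constant, and Fatou's lemma applies.
\<close>

lemma expectation_atom_prod_le:
  assumes w: "w \<in> borel_measurable m" "\<And>z. w z > 0"
    and fin: "emeasure m {z \<in> space m. w z \<noteq> 1} < \<infinity>" and int: "integrable m (\<lambda>z. w z - 1)"
    and diffuse: "\<And>y. AE z in m. fst z \<noteq> y"
  shows "(\<integral>\<^sup>+\<omega>. ennreal (atom_prod w (\<eta> \<omega>)) \<partial>\<Omega>) \<le> ennreal (exp (\<integral>z. w z - 1 \<partial>m))"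
proof -
  note [measurable] = w(1)
  have wL: "w \<in> borel_measurable lborel_marked" using w(1) by (simp add: measurable_cong_sets[OF sets_m refl])
  let ?D = "{z \<in> space m. w z \<noteq> 1}"
  have D[measurable]: "?D \<in> sets m" by measurable
  have Dm: "indicator ?D \<in> borel_measurable m" by (rule borel_measurable_indicator[OF D])
  have "(\<integral>\<^sup>+\<omega>. cloud_sum (indicator ?D) \<omega> \<partial>\<Omega>) < \<infinity>"
    using fin by (simp add: campbell[OF Dm])
  then have AEfin: "AE \<omega> in \<Omega>. cloud_sum (indicator ?D) \<omega> \<noteq> \<infinity>"
    by (intro nn_integral_noteq_infinite measurable_cloud_sum Dm) auto
  have "AE z in q k. fst z \<noteq> y" for k y by (rule AE_q[OF diffuse])
  then have AEdist: "AE \<omega> in \<Omega>. \<forall>i i'. i \<noteq> i' \<longrightarrow> fst (snd \<omega> i) \<noteq> fst (snd \<omega> i')"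
    by (intro AE_distinct_marks) auto
  have lim: "AE \<omega> in \<Omega>. (\<lambda>n. ennreal (cloud_prod n (\<lambda>k. w) \<omega>)) \<longlonglongrightarrow> ennreal (atom_prod w (\<eta> \<omega>))"
    using AEfin AEdist AE_\<eta>_eq_atoms AE_space
  proof eventually_elim
    case (elim \<omega>)
    then have \<omega>: "\<omega> \<in> space \<Omega>" and \<eta>: "\<eta> \<omega> = atoms \<omega>" and rad: "atoms \<omega> \<in> radon_measures" by auto
    define J where "J = {i \<in> pts \<omega>. w (snd \<omega> i) \<noteq> 1}"
    have "emeasure (count_space (pts \<omega>)) J = (\<integral>\<^sup>+i. indicator ?D (snd \<omega> i) \<partial>count_space (pts \<omega>))"
    proof -
      have "emeasure (count_space (pts \<omega>)) J = (\<integral>\<^sup>+i. indicator J i \<partial>count_space (pts \<omega>))" by (simp add: J_def)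
      also have "\<dots> = (\<integral>\<^sup>+i. indicator ?D (snd \<omega> i) \<partial>count_space (pts \<omega>))"
        using space_\<Omega>_mark[OF \<omega>] by (intro nn_integral_cong) (auto simp: J_def indicator_def)
      finally show ?thesis .
    qed
    then have "emeasure (count_space (pts \<omega>)) J \<noteq> \<infinity>"
      using elim(1) by (simp add: nn_integral_pts_cloud_sum)
    then have J: "finite J" "J \<subseteq> pts \<omega>"
      using emeasure_count_space[of J "pts \<omega>"] by (auto simp: J_def split: if_splits)
    have sum_J: "atom_sum g (atoms \<omega>) = (\<Sum>i\<in>J. g (snd \<omega> i))"
      if g: "g \<in> borel_measurable lborel_marked" and g0: "\<And>z. w z = 1 \<Longrightarrow> g z = 0" for g
    proof -
      have "atom_sum g (atoms \<omega>) = (\<integral>\<^sup>+i. g (snd \<omega> i) \<partial>count_space (pts \<omega>))"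
        using atom_sum_atoms[OF g \<omega> rad] elim(2) by (simp add: nn_integral_pts_cloud_sum)
      also have "\<dots> = (\<Sum>i\<in>J. g (snd \<omega> i))"
        by (rule nn_integral_count_space'[OF J(1)]) (use J(2) g0 in \<open>auto simp: J_def\<close>)
      finally show ?thesis .
    qed
    have pos: "enn2real (\<Sum>i\<in>J. ennreal (h i)) = (\<Sum>i\<in>J. max 0 (h i))" for h :: "nat \<times> nat \<Rightarrow> real"
    proof -
      have "(\<Sum>i\<in>J. ennreal (h i)) = (\<Sum>i\<in>J. ennreal (max 0 (h i)))"
        by (intro sum.cong refl) (auto simp: max_def ennreal_neg)
      also have "\<dots> = ennreal (\<Sum>i\<in>J. max 0 (h i))" by (rule sum_ennreal) auto
      finally show ?thesis by (simp add: sum_nonneg)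
    qed
    have "atom_prod w (\<eta> \<omega>) = exp ((\<Sum>i\<in>J. max 0 (ln (w (snd \<omega> i)))) - (\<Sum>i\<in>J. max 0 (- ln (w (snd \<omega> i)))))"
      unfolding atom_prod_def \<eta> using wL by (subst (1 2) sum_J) (auto simp: pos)
    also have "(\<Sum>i\<in>J. max 0 (ln (w (snd \<omega> i)))) - (\<Sum>i\<in>J. max 0 (- ln (w (snd \<omega> i)))) = (\<Sum>i\<in>J. ln (w (snd \<omega> i)))"
      unfolding sum_subtractf[symmetric] by (intro sum.cong refl) (auto simp: max_def)
    also have "exp \<dots> = (\<Prod>i\<in>J. w (snd \<omega> i))"
      using J(1) w(2) by (simp add: exp_sum)
    finally have atom: "atom_prod w (\<eta> \<omega>) = (\<Prod>i\<in>J. w (snd \<omega> i))" .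
    obtain n0 where n0: "\<And>i. i \<in> J \<Longrightarrow> fst i < n0"
    proof -
      have "finite (fst ` J)" using J(1) by simp
      then obtain n0 where "fst ` J \<subseteq> {..<n0}" using finite_nat_iff_bounded by auto
      then show thesis using that by blast
    qed
    have "cloud_prod n (\<lambda>k. w) \<omega> = (\<Prod>i\<in>J. w (snd \<omega> i))" if "n \<ge> n0" for n
    proof -
      have "cloud_prod n (\<lambda>k. w) \<omega> = (\<Prod>i\<in>Sigma {..<n} (\<lambda>k. {..<fst \<omega> k}). w (snd \<omega> i))"
        unfolding cloud_prod_def by (subst prod.Sigma) (auto simp: case_prod_beta)
      also have "\<dots> = (\<Prod>i\<in>J. w (snd \<omega> i))"
      proof (rule prod.mono_neutral_right)
        show "J \<subseteq> Sigma {..<n} (\<lambda>k. {..<fst \<omega> k})"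
        proof
          fix i assume i: "i \<in> J"
          then have "fst i < n" using n0[OF i] that by simp
          then show "i \<in> Sigma {..<n} (\<lambda>k. {..<fst \<omega> k})" using i by (cases i) (simp add: J_def pts_def)
        qed
      qed (auto simp: J_def pts_def)
      finally show ?thesis .
    qed
    then have "eventually (\<lambda>n. ennreal (cloud_prod n (\<lambda>k. w) \<omega>) = ennreal (atom_prod w (\<eta> \<omega>))) sequentially"
      unfolding eventually_sequentially atom by (intro exI[of _ n0]) auto
    then show ?case by (rule tendsto_eventually)
  qed
  have wB: "set_integrable m (B j) w" for j
  proof -
    have "set_integrable m (B j) (\<lambda>z. w z - 1)"
      unfolding set_integrable_def using int by (intro integrable_mult_indicator) auto
    then have "set_integrable m (B j) (\<lambda>z. (w z - 1) + 1)"
      by (rule set_integral_add) (rule set_integrable_one)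
    then show ?thesis by simp
  qed
  have nn: "(\<integral>\<^sup>+\<omega>. ennreal (cloud_prod n (\<lambda>k. w) \<omega>) \<partial>\<Omega>) = ennreal (exp (\<Sum>k<n. LINT z:B k|m. w z - 1))" for n
    unfolding integral_product_functional[OF wB, symmetric]
    by (intro nn_integral_eq_integral integrable_product_functional wB)
      (auto simp: cloud_prod_def intro!: prod_nonneg less_imp_le[OF w(2)])
  have "(\<integral>\<^sup>+\<omega>. ennreal (atom_prod w (\<eta> \<omega>)) \<partial>\<Omega>) = (\<integral>\<^sup>+\<omega>. liminf (\<lambda>n. ennreal (cloud_prod n (\<lambda>k. w) \<omega>)) \<partial>\<Omega>)"
  proof (rule nn_integral_cong_AE)
    show "AE \<omega> in \<Omega>. ennreal (atom_prod w (\<eta> \<omega>)) = liminf (\<lambda>n. ennreal (cloud_prod n (\<lambda>k. w) \<omega>))"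
      using lim by eventually_elim (rule lim_imp_Liminf[symmetric], auto)
  qed
  also have "\<dots> \<le> liminf (\<lambda>n. \<integral>\<^sup>+\<omega>. ennreal (cloud_prod n (\<lambda>k. w) \<omega>) \<partial>\<Omega>)"
    using measurable_cloud_prod[of "\<lambda>k. w"] w(1) by (intro nn_integral_liminf) auto
  also have "\<dots> = ennreal (exp (\<integral>z. w z - 1 \<partial>m))"
    unfolding nn by (intro lim_imp_Liminf tendsto_ennrealI tendsto_exp sum_set_integral_tendsto int) simp
  finally show ?thesis .
qed

end

section \<open>Infinite Hellinger distance gives mutual singularity\<close>

text \<open>
  Uniqueness of the law transfers the estimate from the cloud to every completely random measure.
\<close>

lemma crm_atom_prod_le:
  fixes m :: "('a::euclidean_space \<times> real) measure"
  assumes sf: "sigma_finite_measure m" and nz: "emeasure m (space m) \<noteq> 0"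
    and lf: "locally_finite_intensity m" and diffuse: "\<And>y. AE z in m. fst z \<noteq> y"
    and \<mu>: "completely_random_measure m \<mu>"
    and w: "w \<in> borel_measurable m" "\<And>z. w z > 0"
    and fin: "emeasure m {z \<in> space m. w z \<noteq> 1} < \<infinity>" and int: "integrable m (\<lambda>z. w z - 1)"
  shows "(\<integral>\<^sup>+\<eta>. ennreal (atom_prod w \<eta>) \<partial>\<mu>) \<le> ennreal (exp (\<integral>z. w z - 1 \<partial>m))"
proof -
  obtain B where B: "cut_intensity m B"
    using exists_cut_intensity[OF sf nz, of "\<lambda>_. 0"] by auto
  interpret marked_cloud m B
    by (intro marked_cloud.intro marked_cloud_axioms.intro B lf)
  have \<mu>_eq: "\<mu> = distr \<Omega> discrete_radon_space \<eta>"
    using \<mu> crm_cloud unfolding completely_random_measure_def by (intro fourier_transform_determines) auto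
  have "w \<in> borel_measurable lborel_marked" using w(1) by (simp add: measurable_cong_sets[OF sets_m refl])
  then have "atom_prod w \<in> borel_measurable discrete_radon_space" by (rule measurable_atom_prod)
  then have "(\<integral>\<^sup>+\<eta>. ennreal (atom_prod w \<eta>) \<partial>\<mu>) = (\<integral>\<^sup>+\<omega>. ennreal (atom_prod w (\<eta> \<omega>)) \<partial>\<Omega>)"
    unfolding \<mu>_eq by (subst nn_integral_distr[OF measurable_\<eta>]) auto
  then show ?thesis using expectation_atom_prod_le[OF w fin int diffuse] by simp
qed

text \<open>
  The likelihood ratio of finitely many pieces, as a function of the atoms, separates the two laws
  up to an error of \<open>exp (- H / 2)\<close>, where \<open>H\<close> is the Hellinger integral over these pieces: by
  Markov's inequality for the square root of the ratio and of its inverse.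
\<close>

lemma separating_event:
  fixes m :: "('a::euclidean_space \<times> real) measure"
  assumes sf: "sigma_finite_measure m" and nz: "emeasure m (space m) \<noteq> 0"
    and lf: "locally_finite_intensity m" and lf': "locally_finite_intensity (density m (\<lambda>z. ennreal (\<rho> z)))"
    and diffuse: "\<And>y. AE z in m. fst z \<noteq> y"
    and \<rho>[measurable]: "\<rho> \<in> borel_measurable m" and \<rho>_pos: "\<And>z. z \<in> space m \<Longrightarrow> 0 < \<rho> z"
    and \<mu>: "completely_random_measure m \<mu>"
    and \<mu>': "completely_random_measure (density m (\<lambda>z. ennreal (\<rho> z))) \<mu>'"
    and S[measurable]: "S \<in> sets m" and S_fin: "emeasure m S < \<infinity>" and S_int: "set_integrable m S \<rho>"
  shows "\<exists>A\<in>sets discrete_radon_space.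
     emeasure \<mu> A \<le> ennreal (exp (- (LINT z:S|m. (sqrt (\<rho> z) - 1)\<^sup>2) / 2)) \<and>
     emeasure \<mu>' (space discrete_radon_space - A) \<le> ennreal (exp (- (LINT z:S|m. (sqrt (\<rho> z) - 1)\<^sup>2) / 2))"
proof -
  interpret sigma_finite_measure m by fact
  let ?m' = "density m (\<lambda>z. ennreal (\<rho> z))"
  let ?E = "LINT z:S|m. (sqrt (\<rho> z) - 1)\<^sup>2"
  have sets: "sets m = sets lborel_marked" using lf by (simp add: locally_finite_intensity_def)
  have sf': "sigma_finite_measure ?m'" by (subst sigma_finite_iff_density_finite) auto
  have nz': "emeasure ?m' (space ?m') \<noteq> 0"
  proof
    assume "emeasure ?m' (space ?m') = 0"
    then have "(\<integral>\<^sup>+z. ennreal (\<rho> z) \<partial>m) = 0"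
      by (simp add: emeasure_density cong: nn_integral_cong)
    then have "AE z in m. ennreal (\<rho> z) = 0" by (subst (asm) nn_integral_0_iff_AE) auto
    then have "AE z in m. False"
      using AE_space by eventually_elim (use \<rho>_pos in \<open>force simp: ennreal_eq_0_iff\<close>)
    then have "emeasure m (space m) = 0"
      using AE_iff_measurable[of "space m" m "\<lambda>_. False"] by auto
    then show False using nz by simp
  qed
  have diffuse': "AE z in ?m'. fst z \<noteq> y" for y
    using diffuse[of y] by (subst AE_density) auto
  have one: "set_integrable m S (\<lambda>z. 1 :: real)"
    using S_fin by (simp add: set_integrable_def integrable_indicator_iff)
  have sq: "set_integrable m S (\<lambda>z. sqrt (\<rho> z))"
    by (rule set_integrable_sqrt_density[OF S S_fin \<rho> less_imp_le[OF \<rho>_pos] S_int])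
  define w where "w z = (if z \<in> S then sqrt (\<rho> z) else 1)" for z
  have S_space: "z \<in> space m" if "z \<in> S" for z using sets.sets_into_space[OF S] that by auto
  have w_pos: "w z > 0" for z using \<rho>_pos S_space by (simp add: w_def)
  have wm[measurable]: "w \<in> borel_measurable m" unfolding w_def by measurable
  have i1: "integrable m (\<lambda>z. w z - 1)" and I1: "(\<integral>z. w z - 1 \<partial>m) = (LINT z:S|m. sqrt (\<rho> z) - 1)"
  proof -
    have eq: "w z - 1 = indicator S z *\<^sub>R (sqrt (\<rho> z) - 1)" for z by (auto simp: w_def indicator_def)
    show "integrable m (\<lambda>z. w z - 1)" unfolding eq
      using set_integral_diff(1)[OF sq one] by (simp add: set_integrable_def)
    show "(\<integral>z. w z - 1 \<partial>m) = (LINT z:S|m. sqrt (\<rho> z) - 1)"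
      unfolding eq set_lebesgue_integral_def ..
  qed
  have i2: "integrable ?m' (\<lambda>z. inverse (w z) - 1)" and I2: "(\<integral>z. inverse (w z) - 1 \<partial>?m') = (LINT z:S|m. sqrt (\<rho> z) - \<rho> z)"
  proof -
    have eq: "\<rho> z *\<^sub>R (inverse (w z) - 1) = indicator S z *\<^sub>R (sqrt (\<rho> z) - \<rho> z)" for z
    proof (cases "z \<in> S")
      case True
      then have "\<rho> z > 0" using \<rho>_pos S_space by simp
      then have "\<rho> z * inverse (sqrt (\<rho> z)) = sqrt (\<rho> z)"
        by (metis divide_inverse real_div_sqrt less_imp_le)
      then show ?thesis using True by (simp add: w_def algebra_simps)
    qed (simp add: w_def)
    have nn: "AE z in m. 0 \<le> \<rho> z" using \<rho>_pos by (auto intro!: AE_I2 less_imp_le)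
    show "integrable ?m' (\<lambda>z. inverse (w z) - 1)"
      using set_integral_diff(1)[OF sq S_int]
      by (subst integrable_density[OF _ _ nn]) (auto simp: eq set_integrable_def simp del: real_scaleR_def)
    show "(\<integral>z. inverse (w z) - 1 \<partial>?m') = (LINT z:S|m. sqrt (\<rho> z) - \<rho> z)"
      by (subst integral_density[OF _ _ nn]) (auto simp: eq set_lebesgue_integral_def simp del: real_scaleR_def)
  qed
  have fin: "emeasure m {z \<in> space m. w z \<noteq> 1} < \<infinity>"
  proof -
    have "emeasure m {z \<in> space m. w z \<noteq> 1} \<le> emeasure m S"
      by (intro emeasure_mono) (auto simp: w_def)
    then show ?thesis using S_fin by simp
  qed
  have fin': "emeasure ?m' {z \<in> space ?m'. inverse (w z) \<noteq> 1} < \<infinity>"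
  proof -
    have "emeasure ?m' {z \<in> space ?m'. inverse (w z) \<noteq> 1} \<le> emeasure ?m' S"
      by (intro emeasure_mono) (auto simp: w_def)
    also have "\<dots> = (\<integral>\<^sup>+z. ennreal (norm (indicator S z *\<^sub>R \<rho> z)) \<partial>m)"
      unfolding emeasure_density[OF measurable_compose[OF \<rho> measurable_ennreal] S]
      using \<rho>_pos by (intro nn_integral_cong) (auto simp: indicator_def less_imp_le)
    also have "\<dots> < \<infinity>" using S_int by (simp add: set_integrable_def integrable_iff_bounded)
    finally show ?thesis .
  qed
  have L1: "(\<integral>\<^sup>+\<eta>. ennreal (atom_prod w \<eta>) \<partial>\<mu>) \<le> ennreal (exp (LINT z:S|m. sqrt (\<rho> z) - 1))"
    using crm_atom_prod_le[OF sf nz lf diffuse \<mu> wm w_pos fin i1] unfolding I1 .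
  have "(\<lambda>z. inverse (w z)) \<in> borel_measurable ?m'" by simp
  from crm_atom_prod_le[OF sf' nz' lf' diffuse' \<mu>' this _ fin' i2]
  have L2: "(\<integral>\<^sup>+\<eta>. ennreal (inverse (atom_prod w \<eta>)) \<partial>\<mu>') \<le> ennreal (exp (LINT z:S|m. sqrt (\<rho> z) - \<rho> z))"
    unfolding I2 using w_pos by (simp add: atom_prod_inverse)
\<comment> \<open>the likelihood ratio on \<open>S\<close> exceeds \<open>1\<close> iff the product of \<open>w\<close> over the atoms exceeds \<open>exp a\<close>\<close>
  define a where "a = (LINT z:S|m. \<rho> z - 1) / 2"
  have d: "set_integrable m S (\<lambda>z. sqrt (\<rho> z) - 1)" "set_integrable m S (\<lambda>z. \<rho> z - 1)" "set_integrable m S (\<lambda>z. sqrt (\<rho> z) - \<rho> z)"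
    by (intro set_integral_diff(1) sq one S_int)+
  have E: "?E = 2 * a - 2 * (LINT z:S|m. sqrt (\<rho> z) - 1)"
    by (simp add: a_def set_integral_hellinger[OF S S_fin \<rho> less_imp_le[OF \<rho>_pos] S_int])
  have "(LINT z:S|m. sqrt (\<rho> z) - \<rho> z) = (LINT z:S|m. (sqrt (\<rho> z) - 1) - (\<rho> z - 1))" by simp
  also have "\<dots> = (LINT z:S|m. sqrt (\<rho> z) - 1) - 2 * a"
    unfolding set_integral_diff(2)[OF d(1,2)] by (simp add: a_def)
  finally have E': "(LINT z:S|m. sqrt (\<rho> z) - \<rho> z) + a = - ?E / 2" and E1: "(LINT z:S|m. sqrt (\<rho> z) - 1) - a = - ?E / 2"
    using E by simp_all
  have ap[measurable]: "atom_prod w \<in> borel_measurable discrete_radon_space"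
    by (rule measurable_atom_prod) (use wm in \<open>simp add: measurable_cong_sets[OF sets refl]\<close>)
  have s\<mu>: "sets \<mu> = sets discrete_radon_space" "sets \<mu>' = sets discrete_radon_space"
    using \<mu> \<mu>' by (auto simp: completely_random_measure_def)
  note [measurable_cong] = s\<mu>
  define A where "A = {\<eta> \<in> space discrete_radon_space. exp a < atom_prod w \<eta>}"
  have A[measurable]: "A \<in> sets discrete_radon_space" unfolding A_def by measurable
  have "emeasure \<mu> A = (\<integral>\<^sup>+\<eta>. indicator A \<eta> \<partial>\<mu>)" using A s\<mu> by simp
  also have "\<dots> \<le> (\<integral>\<^sup>+\<eta>. ennreal (exp (- a)) * ennreal (atom_prod w \<eta>) \<partial>\<mu>)"
  proof (intro nn_integral_mono)
    fix \<eta>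
    show "indicator A \<eta> \<le> ennreal (exp (- a)) * ennreal (atom_prod w \<eta>)"
    proof (cases "\<eta> \<in> A")
      case True
      then have "exp (- a) * exp a \<le> exp (- a) * atom_prod w \<eta>" by (intro mult_left_mono) (auto simp: A_def)
      then have "1 \<le> exp (- a) * atom_prod w \<eta>" by (simp flip: exp_add)
      then show ?thesis using True by (simp flip: ennreal_mult')
    qed simp
  qed
  also have "\<dots> = ennreal (exp (- a)) * (\<integral>\<^sup>+\<eta>. ennreal (atom_prod w \<eta>) \<partial>\<mu>)"
    by (rule nn_integral_cmult) measurable
  also have "\<dots> \<le> ennreal (exp (- a)) * ennreal (exp (LINT z:S|m. sqrt (\<rho> z) - 1))"
    by (rule mult_left_mono[OF L1]) simp
  also have "\<dots> = ennreal (exp (- ?E / 2))"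
    unfolding E1[symmetric] by (simp add: ennreal_mult'[symmetric] exp_add[symmetric])
  finally have 1: "emeasure \<mu> A \<le> ennreal (exp (- ?E / 2))" .
  let ?A' = "space discrete_radon_space - A"
  have A': "?A' \<in> sets discrete_radon_space" by measurable
  have "emeasure \<mu>' ?A' = (\<integral>\<^sup>+\<eta>. indicator ?A' \<eta> \<partial>\<mu>')" using A' s\<mu> by simp
  also have "\<dots> \<le> (\<integral>\<^sup>+\<eta>. ennreal (exp a) * ennreal (inverse (atom_prod w \<eta>)) \<partial>\<mu>')"
  proof (intro nn_integral_mono)
    fix \<eta>
    have pos: "0 < atom_prod w \<eta>" by (simp add: atom_prod_def)
    show "indicator ?A' \<eta> \<le> ennreal (exp a) * ennreal (inverse (atom_prod w \<eta>))"
    proof (cases "\<eta> \<in> ?A'")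
      case True
      then have "1 \<le> exp a * inverse (atom_prod w \<eta>)" using pos by (auto simp: A_def field_simps)
      then show ?thesis using True by (simp flip: ennreal_mult')
    qed simp
  qed
  also have "\<dots> = ennreal (exp a) * (\<integral>\<^sup>+\<eta>. ennreal (inverse (atom_prod w \<eta>)) \<partial>\<mu>')"
    by (rule nn_integral_cmult) measurable
  also have "\<dots> \<le> ennreal (exp a) * ennreal (exp (LINT z:S|m. sqrt (\<rho> z) - \<rho> z))"
    by (rule mult_left_mono[OF L2]) simp
  also have "\<dots> = ennreal (exp (- ?E / 2))"
    unfolding E'[symmetric] by (simp add: ennreal_mult'[symmetric] exp_add[symmetric] add.commute)
  finally have "emeasure \<mu>' ?A' \<le> ennreal (exp (- ?E / 2))" .
  with 1 A show ?thesis by blast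
qed

text \<open>
  If the Hellinger integral is infinite, the separating events can be chosen with errors \<open>2\<^sup>-\<^sup>k\<close>. By the
  Borel-Cantelli lemma almost surely only finitely many of them occur under \<open>\<mu>\<close>, while all
  but finitely many occur under \<open>\<mu>'\<close>.
\<close>

theorem crm_absolutely_continuous_imp_hellinger_finite:
  fixes m :: "('a::euclidean_space \<times> real) measure"
  assumes sf: "sigma_finite_measure m" and nz: "emeasure m (space m) \<noteq> 0"
    and lf: "locally_finite_intensity m" and lf': "locally_finite_intensity (density m (\<lambda>z. ennreal (\<rho> z)))"
    and diffuse: "\<And>y. AE z in m. fst z \<noteq> y"
    and \<rho>[measurable]: "\<rho> \<in> borel_measurable m" and \<rho>_pos: "\<And>z. z \<in> space m \<Longrightarrow> 0 < \<rho> z"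
    and \<mu>: "completely_random_measure m \<mu>"
    and \<mu>': "completely_random_measure (density m (\<lambda>z. ennreal (\<rho> z))) \<mu>'"
    and ac: "absolutely_continuous \<mu> \<mu>'"
  shows "(\<integral>\<^sup>+z. ennreal ((sqrt (\<rho> z) - 1)\<^sup>2) \<partial>m) < \<infinity>"
proof (rule ccontr)
  assume "\<not> (\<integral>\<^sup>+z. ennreal ((sqrt (\<rho> z) - 1)\<^sup>2) \<partial>m) < \<infinity>"
  then have inf: "(\<integral>\<^sup>+z. ennreal ((sqrt (\<rho> z) - 1)\<^sup>2) \<partial>m) = \<infinity>"
    by (metis top.not_eq_extremum infinity_ennreal_def)
  interpret \<mu>: prob_space \<mu> using \<mu> by (simp add: completely_random_measure_def)
  interpret \<mu>': prob_space \<mu>' using \<mu>' by (simp add: completely_random_measure_def)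
  have s\<mu>: "sets \<mu> = sets discrete_radon_space" "sets \<mu>' = sets discrete_radon_space"
    using \<mu> \<mu>' by (auto simp: completely_random_measure_def)
  have sp: "space \<mu>' = space discrete_radon_space" by (rule sets_eq_imp_space_eq[OF s\<mu>(2)])
  obtain B where B: "cut_intensity m B" "\<And>k. set_integrable m (B k) \<rho>"
    using exists_cut_intensity[OF sf nz \<rho>] \<rho>_pos less_imp_le by metis
  interpret cut_intensity m B by (rule B)
  let ?f = "\<lambda>z. (sqrt (\<rho> z) - 1)\<^sup>2"
  define S where "S n = (\<Union>k<n. B k)" for n
  have S[measurable]: "S n \<in> sets m" for n unfolding S_def by measurable
  have S_fin: "emeasure m (S n) < \<infinity>" for n
  proof -
    have "emeasure m (S n) \<le> (\<Sum>k<n. emeasure m (B k))"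
      unfolding S_def by (rule emeasure_subadditive_finite) auto
    also have "\<dots> < \<infinity>" using B_finite by simp
    finally show ?thesis .
  qed
  have S_int: "set_integrable m (S n) \<rho>" for n
    unfolding S_def by (intro set_integrable_UN B) auto
  have f_int: "set_integrable m (S n) ?f" for n
    by (rule set_integrable_hellinger[OF S S_fin \<rho> less_imp_le[OF \<rho>_pos] S_int])
  have "incseq (\<lambda>n z. ennreal (?f z) * indicator (S n) z)"
    by (auto simp: incseq_def le_fun_def indicator_def S_def intro: less_le_trans)
  then have "(\<integral>\<^sup>+z. (SUP n. ennreal (?f z) * indicator (S n) z) \<partial>m) = (SUP n. \<integral>\<^sup>+z. ennreal (?f z) * indicator (S n) z \<partial>m)"
    by (rule nn_integral_monotone_convergence_SUP) measurable
  moreover have "(\<integral>\<^sup>+z. (SUP n. ennreal (?f z) * indicator (S n) z) \<partial>m) = \<infinity>"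
  proof -
    have "(\<integral>\<^sup>+z. (SUP n. ennreal (?f z) * indicator (S n) z) \<partial>m) = (\<integral>\<^sup>+z. ennreal (?f z) \<partial>m)"
    proof (intro nn_integral_cong antisym SUP_least)
      fix z assume "z \<in> space m"
      then obtain k where "z \<in> B k" using B_space by auto
      then have "ennreal (?f z) \<le> ennreal (?f z) * indicator (S (Suc k)) z" by (auto simp: S_def indicator_def)
      then show "ennreal (?f z) \<le> (SUP n. ennreal (?f z) * indicator (S n) z)" by (rule SUP_upper2[rotated]) simp
    qed (auto simp: indicator_def)
    then show ?thesis using inf by simp
  qed
  ultimately have sup: "(SUP n. \<integral>\<^sup>+z. ennreal (?f z) * indicator (S n) z \<partial>m) = \<infinity>" by simp
  have nn_S: "(\<integral>\<^sup>+z. ennreal (?f z) * indicator (S n) z \<partial>m) = ennreal (LINT z:S n|m. ?f z)" for n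
  proof -
    have "(\<integral>\<^sup>+z. ennreal (?f z) * indicator (S n) z \<partial>m) = (\<integral>\<^sup>+z. ennreal (indicator (S n) z *\<^sub>R ?f z) \<partial>m)"
      by (intro nn_integral_cong) (auto simp: indicator_def)
    also have "\<dots> = ennreal (LINT z:S n|m. ?f z)"
      unfolding set_lebesgue_integral_def using f_int[of n]
      by (intro nn_integral_eq_integral) (auto simp: set_integrable_def)
    finally show ?thesis .
  qed
  have large: "\<exists>n. C < (LINT z:S n|m. ?f z)" if "0 \<le> C" for C
  proof -
    have "ennreal C < (SUP n. \<integral>\<^sup>+z. ennreal (?f z) * indicator (S n) z \<partial>m)" unfolding sup by simp
    then obtain n where "ennreal C < ennreal (LINT z:S n|m. ?f z)" unfolding less_SUP_iff nn_S by auto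
    then show ?thesis using that by (intro exI[of _ n]) (simp add: ennreal_less_iff)
  qed
  have "\<exists>A\<in>sets discrete_radon_space. emeasure \<mu> A \<le> ennreal ((1/2) ^ k) \<and>
      emeasure \<mu>' (space discrete_radon_space - A) \<le> ennreal ((1/2) ^ k)" for k
  proof -
\<comment> \<open>then \<open>exp (- E / 2) \<le> 2\<^sup>-\<^sup>k\<close> for the Hellinger integral \<open>E\<close> over \<open>S n\<close>\<close>
    obtain n where n: "2 * (real k * ln 2) < (LINT z:S n|m. ?f z)"
      using large[of "2 * (real k * ln 2)"] by auto
    have "exp (- (LINT z:S n|m. ?f z) / 2) \<le> exp (- (real k * ln 2))" using n by simp
    also have "\<dots> = (1/2) ^ k"
      by (simp add: exp_minus exp_of_nat_mult power_one_over inverse_eq_divide)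
    finally have le: "ennreal (exp (- (LINT z:S n|m. ?f z) / 2)) \<le> ennreal ((1/2) ^ k)" by (rule ennreal_leI)
    show ?thesis
      using separating_event[OF sf nz lf lf' diffuse \<rho> \<rho>_pos \<mu> \<mu>' S S_fin S_int, of n] le
      by (meson order_trans)
  qed
  then obtain A where A: "\<And>k. A k \<in> sets discrete_radon_space"
    "\<And>k. emeasure \<mu> (A k) \<le> ennreal ((1/2) ^ k)"
    "\<And>k. emeasure \<mu>' (space discrete_radon_space - A k) \<le> ennreal ((1/2) ^ k)"
    by metis
  have sm: "summable (\<lambda>k. (1/2 :: real) ^ k)" by (rule summable_geometric) simp
  have "AE \<eta> in \<mu>. eventually (\<lambda>k. \<eta> \<in> space \<mu> - A k) sequentially"
  proof (rule borel_cantelli_AE1)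
    show "summable (\<lambda>k. measure \<mu> (A k))"
    proof (rule summable_comparison_test'[OF sm])
      show "norm (measure \<mu> (A k)) \<le> (1/2) ^ k" for k
        using A(2)[of k] by (simp add: \<mu>.emeasure_eq_measure)
    qed
  qed (use A(1) s\<mu> in \<open>auto simp: less_top[symmetric]\<close>)
  then have 1: "AE \<eta> in \<mu>'. eventually (\<lambda>k. \<eta> \<in> space \<mu> - A k) sequentially"
    by (rule absolutely_continuous_AE[rotated -1]) (use ac s\<mu> in auto)
  have "AE \<eta> in \<mu>'. eventually (\<lambda>k. \<eta> \<in> space \<mu>' - (space discrete_radon_space - A k)) sequentially"
  proof (rule borel_cantelli_AE1)
    show "summable (\<lambda>k. measure \<mu>' (space discrete_radon_space - A k))"
    proof (rule summable_comparison_test'[OF sm])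
      show "norm (measure \<mu>' (space discrete_radon_space - A k)) \<le> (1/2) ^ k" for k
        using A(3)[of k] by (simp add: \<mu>'.emeasure_eq_measure)
    qed
  qed (use A(1) s\<mu> in \<open>auto simp: less_top[symmetric]\<close>)
  with 1 have "AE \<eta> in \<mu>'. False"
  proof eventually_elim
    case (elim \<eta>)
    from eventually_conj[OF this] have "eventually (\<lambda>k. False) sequentially"
      by (rule eventually_mono) (auto simp: sp)
    then show False by simp
  qed
  then show False using \<mu>'.AE_False by simp
qed

section \<open>The action of diffeomorphisms\<close>

lemma C_c_compose_Diff0:
  fixes f :: "'a::euclidean_space \<Rightarrow> real"
  assumes f: "f \<in> C_c" and \<phi>: "\<phi> \<in> Diff0" shows "(\<lambda>x. f (\<phi> x)) \<in> C_c"
proof -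
  obtain R where R: "\<And>x. f x \<noteq> 0 \<Longrightarrow> norm x \<le> R" "continuous_on UNIV f"
    using C_cE[OF f] by metis
  have "compact (inv \<phi> ` cball 0 R)"
    by (rule compact_continuous_image) (use Diff0_continuous[OF Diff0_inv[OF \<phi>]] continuous_on_subset in auto)
  then obtain R' where R': "\<And>y. y \<in> inv \<phi> ` cball 0 R \<Longrightarrow> norm y \<le> R'"
    using compact_imp_bounded by (force simp: bounded_iff)
  show ?thesis
  proof (rule C_cI[of _ R'])
    show "continuous_on UNIV (\<lambda>x. f (\<phi> x))"
      using continuous_on_compose2[OF R(2) Diff0_continuous[OF \<phi>]] by simp
    show "norm x \<le> R'" if "f (\<phi> x) \<noteq> 0" for x
    proof (rule R')
      have "inv \<phi> (\<phi> x) = x" using Diff0_bij[OF \<phi>] by (simp add: bij_is_inj)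
      then show "x \<in> inv \<phi> ` cball 0 R" using R(1)[OF that] by (metis image_eqI mem_cball_0)
    qed
  qed
qed

lemma act_discrete:
  fixes \<eta> :: "'a::euclidean_space measure"
  assumes \<phi>: "\<phi> \<in> Diff0" and \<eta>: "\<eta> \<in> discrete_radon_measures"
  shows "act \<phi> \<eta> \<in> discrete_radon_measures"
proof -
  have rad: "\<eta> \<in> radon_measures" and sets: "sets \<eta> = sets borel"
    using \<eta> discrete_imp_radon sets_radon by auto
  have sp: "space \<eta> = UNIV" using sets_eq_imp_space_eq[OF sets] by simp
  have m: "\<phi> \<in> measurable \<eta> borel"
    using Diff0_measurable[OF \<phi>] by (simp add: measurable_cong_sets[OF sets refl])
  have em: "emeasure (act \<phi> \<eta>) A = emeasure \<eta> (\<phi> -` A)" if "A \<in> sets borel" for A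
    unfolding act_def using emeasure_distr[OF m that] by (simp add: sp)
  have bij: "bij \<phi>" by (rule Diff0_bij[OF \<phi>])
  have "emeasure (act \<phi> \<eta>) K < \<infinity>" if K: "compact K" for K
  proof -
    have "\<phi> -` K = inv \<phi> ` K" using bij by (simp add: bij_vimage_eq_inv_image)
    moreover have "compact (inv \<phi> ` K)"
      by (rule compact_continuous_image) (use K Diff0_continuous[OF Diff0_inv[OF \<phi>]] continuous_on_subset in auto)
    ultimately show ?thesis using rad em[of K] K by (auto simp: radon_measures_def borel_compact)
  qed
  then have rad': "act \<phi> \<eta> \<in> radon_measures" by (auto simp: radon_measures_def act_def)
  obtain D where D: "countable D" "emeasure \<eta> (- D) = 0"
    using \<eta> by (auto simp: discrete_radon_measures_iff)
  have "- (\<phi> ` D) \<in> sets borel" by (rule borel_comp, rule sets.countable) (use D in auto)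
  then have "emeasure (act \<phi> \<eta>) (- (\<phi> ` D)) = emeasure \<eta> (\<phi> -` (- (\<phi> ` D)))" by (rule em)
  also have "\<phi> -` (- (\<phi> ` D)) = - D" using bij by (auto simp: bij_def inj_image_mem_iff)
  finally have "emeasure (act \<phi> \<eta>) (- (\<phi> ` D)) = 0" using D by simp
  then show ?thesis using rad' D(1) by (auto simp: discrete_radon_measures_iff)
qed

lemma integral_act:
  fixes f :: "'a::euclidean_space \<Rightarrow> real"
  assumes \<phi>: "\<phi> \<in> Diff0" and \<eta>: "\<eta> \<in> radon_measures" and f: "f \<in> C_c"
  shows "(\<integral>x. f x \<partial>act \<phi> \<eta>) = (\<integral>x. f (\<phi> x) \<partial>\<eta>)"
proof -
  have "\<phi> \<in> measurable \<eta> borel"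
    using Diff0_measurable[OF \<phi>] by (simp add: measurable_cong_sets[OF sets_radon[OF \<eta>] refl])
  then show ?thesis unfolding act_def by (rule integral_distr) (rule borel_measurable_C_c[OF f])
qed

lemma measurable_act:
  fixes \<phi> :: "'a::euclidean_space \<Rightarrow> 'a"
  assumes \<phi>: "\<phi> \<in> Diff0" shows "act \<phi> \<in> measurable discrete_radon_space discrete_radon_space"
proof (rule measurable_discrete_radon_spaceI)
  show "act \<phi> \<eta> \<in> discrete_radon_measures" if "\<eta> \<in> space discrete_radon_space" for \<eta>
    using act_discrete[OF \<phi>] that by (simp add: space_discrete_radon_space)
  fix f :: "'a \<Rightarrow> real" assume f: "f \<in> C_c"
  show "(\<lambda>\<eta>. \<integral>x. f x \<partial>act \<phi> \<eta>) \<in> borel_measurable discrete_radon_space"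
    using measurable_integral_discrete_radon_space[OF C_c_compose_Diff0[OF f \<phi>]]
    by (subst measurable_cong[OF integral_act[OF \<phi> _ f]])
      (auto simp: space_discrete_radon_space discrete_imp_radon)
qed

lemma act_inv:
  fixes \<phi> :: "'a::euclidean_space \<Rightarrow> 'a"
  assumes \<phi>: "\<phi> \<in> Diff0" and \<eta>: "\<eta> \<in> discrete_radon_measures"
  shows "act \<phi> (act (inv \<phi>) \<eta>) = \<eta>"
proof -
  have sets: "sets \<eta> = sets borel" using \<eta> discrete_imp_radon sets_radon by auto
  have m: "inv \<phi> \<in> measurable \<eta> borel"
    using Diff0_measurable[OF Diff0_inv[OF \<phi>]] by (simp add: measurable_cong_sets[OF sets refl])
  have "act \<phi> (act (inv \<phi>) \<eta>) = distr \<eta> borel (\<phi> \<circ> inv \<phi>)"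
    unfolding act_def by (rule distr_distr[OF Diff0_measurable[OF \<phi>] m])
  also have "\<phi> \<circ> inv \<phi> = (\<lambda>x. x)"
    using Diff0_bij[OF \<phi>] by (auto simp: fun_eq_iff bij_is_surj surj_f_inv_f)
  also have "distr \<eta> borel (\<lambda>x. x) = \<eta>" by (rule distr_id2[OF sets[symmetric]])
  finally show ?thesis .
qed

lemma sets_lborel_marked:
  "sets (lborel_marked :: ('a::euclidean_space \<times> real) measure) = sets (borel \<Otimes>\<^sub>M restrict_space borel {0<..})"
  unfolding lborel_marked_def by (intro sets_pair_measure_cong sets_restrict_space_cong) auto

lemma sigma_finite_positive_reals: "sigma_finite_measure (restrict_space lborel {0 :: real <..})"
  by (rule sigma_finite_measure_restrict_space) (auto intro: sigma_finite_lborel)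

lemma sigma_finite_lborel_marked: "sigma_finite_measure (lborel_marked :: ('a::euclidean_space \<times> real) measure)"
  unfolding lborel_marked_def by (rule sigma_finite_pair_measure[OF sigma_finite_lborel sigma_finite_positive_reals])

lemma AE_lborel_marked_fst: "AE z in (lborel_marked :: ('a::euclidean_space \<times> real) measure). fst z \<noteq> y"
proof (rule AE_I')
  interpret sigma_finite_measure "restrict_space lborel {0 :: real <..}" by (rule sigma_finite_positive_reals)
  have "emeasure lborel_marked ({y} \<times> space (restrict_space lborel {0 :: real <..})) = 0"
    unfolding lborel_marked_def by (subst emeasure_pair_measure_Times[OF _ sets.top]) auto
  then show "{y} \<times> space (restrict_space lborel {0 :: real <..}) \<in> null_sets lborel_marked"
    by (rule null_setsI) (unfold lborel_marked_def, rule pair_measureI[OF _ sets.top], simp)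
qed (auto simp: space_lborel_marked space_restrict_space)

lemma emeasure_lborel_marked_nonzero:
  "emeasure (lborel_marked :: ('a::euclidean_space \<times> real) measure) (space lborel_marked) \<noteq> 0"
proof
  assume 0: "emeasure (lborel_marked :: ('a \<times> real) measure) (space lborel_marked) = 0"
  interpret sigma_finite_measure "restrict_space lborel {0 :: real <..}" by (rule sigma_finite_positive_reals)
  have "{1..2} \<in> sets (restrict_space lborel {0 :: real <..})"
    by (auto simp: sets_restrict_space intro!: image_eqI[of _ _ "{1..2}"])
  then have "emeasure lborel_marked ((UNIV :: 'a set) \<times> {1..2}) = emeasure lborel (UNIV :: 'a set) * emeasure (restrict_space lborel {0 :: real <..}) {1..2}"
    unfolding lborel_marked_def by (subst emeasure_pair_measure_Times) auto
  also have "emeasure (restrict_space lborel {0 :: real <..}) {1..2} = 1"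
    by (subst emeasure_restrict_space) auto
  finally have "emeasure lborel_marked ((UNIV :: 'a set) \<times> {1..2 :: real}) \<noteq> 0" by simp
  moreover have "emeasure lborel_marked ((UNIV :: 'a set) \<times> {1..2 :: real}) \<le> emeasure lborel_marked (space (lborel_marked :: ('a \<times> real) measure))"
    by (rule emeasure_space)
  ultimately show False using 0 by simp
qed

locale positive_intensity =
  fixes l :: "'a::euclidean_space \<Rightarrow> real \<Rightarrow> real"
  assumes l_measurable: "(\<lambda>(x, s). l x s) \<in> borel_measurable lborel_marked"
    and l_pos: "\<And>x s. s > 0 \<Longrightarrow> l x s > 0"
    and l_locally_finite: "locally_finite_intensity (intensity l)"
begin

lemma sets_intensity: "sets (intensity l) = sets lborel_marked"
  and space_intensity: "space (intensity l) = UNIV \<times> {0<..}"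
  by (simp_all add: intensity_def space_lborel_marked)

lemmas measurable_density = measurable_intensity_density[OF l_measurable]

lemma sigma_finite_intensity: "sigma_finite_measure (intensity l)"
proof -
  interpret sigma_finite_measure "lborel_marked :: ('a \<times> real) measure" by (rule sigma_finite_lborel_marked)
  show ?thesis unfolding intensity_def
    by (subst sigma_finite_iff_density_finite[OF measurable_density]) auto
qed

lemma AE_intensity_fst: "AE z in intensity l. fst z \<noteq> y"
  unfolding intensity_def using AE_lborel_marked_fst[of y]
  by (subst AE_density[OF measurable_density]) auto

lemma intensity_nonzero: "emeasure (intensity l) (space (intensity l)) \<noteq> 0"
proof
  assume "emeasure (intensity l) (space (intensity l)) = 0"
  then have "(\<integral>\<^sup>+z. (case z of (x, s) \<Rightarrow> ennreal (l x s / s)) \<partial>lborel_marked) = 0"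
    by (simp add: intensity_def emeasure_density[OF measurable_density] cong: nn_integral_cong)
  then have "AE z in lborel_marked. (case z of (x, s) \<Rightarrow> ennreal (l x s / s)) = 0"
    by (subst (asm) nn_integral_0_iff_AE[OF measurable_density])
  then have "AE z in (lborel_marked :: ('a \<times> real) measure). False"
    using AE_space
  proof eventually_elim
    case (elim z)
    then obtain x s where z: "z = (x, s)" "s > 0" by (auto simp: space_lborel_marked)
    then have "l x s / s > 0" using l_pos by simp
    then show ?case using elim(1) z by (simp add: ennreal_eq_0_iff)
  qed
  then show False using emeasure_lborel_marked_nonzero[where 'a='a]
      AE_iff_measurable[of "space lborel_marked" "lborel_marked :: ('a \<times> real) measure" "\<lambda>_. False"] by auto
qed

end

definition moved_density :: "(real^'n \<Rightarrow> real^'n) \<Rightarrow> (real^'n \<Rightarrow> real \<Rightarrow> real) \<Rightarrow> real^'n \<Rightarrow> real \<Rightarrow> real" where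
  "moved_density \<phi> l x s = l (inv \<phi> x) s * Jac \<phi> x"

locale moved_intensity = positive_intensity l for l :: "real^'n \<Rightarrow> real \<Rightarrow> real" +
  fixes \<phi> :: "real^'n \<Rightarrow> real^'n"
  assumes \<phi>: "\<phi> \<in> Diff0"
begin

abbreviation "move \<equiv> (\<lambda>(x, s :: real). (\<phi> x, s))"

lemma measurable_move: "move \<in> measurable lborel_marked lborel_marked"
proof -
  have "\<phi> \<in> measurable lborel lborel" using Diff0_measurable[OF \<phi>] by simp
  then show ?thesis unfolding lborel_marked_def case_prod_unfold by measurable
qed

lemma measurable_pulled: "(\<lambda>(x, s). l (inv \<phi> x) s) \<in> borel_measurable lborel_marked"
proof -
  have "inv \<phi> \<in> measurable lborel lborel" using Diff0_measurable[OF Diff0_inv[OF \<phi>]] by simp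
  then have "(\<lambda>(x, s). (inv \<phi> x, s)) \<in> measurable lborel_marked (lborel_marked :: ((real^'n) \<times> real) measure)"
    unfolding lborel_marked_def case_prod_unfold by measurable
  from measurable_compose[OF this l_measurable] show ?thesis by (simp add: case_prod_unfold)
qed

lemma measurable_moved_density: "(\<lambda>(x, s). moved_density \<phi> l x s) \<in> borel_measurable lborel_marked"
proof -
  have [measurable]: "(\<lambda>z. l (inv \<phi> (fst z)) (snd z)) \<in> borel_measurable lborel_marked"
    using measurable_pulled by (simp add: case_prod_unfold)
  have [measurable]: "(\<lambda>z. Jac \<phi> (fst z)) \<in> borel_measurable (lborel_marked :: ((real^'n) \<times> real) measure)"
    by (rule measurable_compose[OF fst_measurable_marked borel_measurable_Jac[OF \<phi>]])
  show ?thesis unfolding moved_density_def case_prod_unfold by measurable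
qed

text \<open>
  Fubini's theorem reduces this to the change of variables formula in \<open>X\<close> for each fixed \<open>s\<close>.
\<close>

theorem distr_intensity: "distr (intensity l) lborel_marked move = intensity (moved_density \<phi> l)"
proof (rule measure_eqI)
  interpret L: pair_sigma_finite "lborel :: (real^'n) measure" "restrict_space lborel {0 :: real <..}"
    by (intro pair_sigma_finite.intro sigma_finite_lborel sigma_finite_positive_reals)
  note dm = measurable_intensity_density[OF measurable_moved_density]
  show "sets (distr (intensity l) lborel_marked move) = sets (intensity (moved_density \<phi> l))"
    by (simp add: intensity_def)
  fix A assume "A \<in> sets (distr (intensity l) lborel_marked move)"
  then have A[measurable]: "A \<in> sets lborel_marked" by simp
  define F where "F y s = ennreal (l (inv \<phi> y) s / s) * indicator A (y, s)" for y s
  have Fm: "(\<lambda>(y, s). F y s) \<in> borel_measurable lborel_marked"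
  proof -
    have [measurable]: "(\<lambda>z. l (inv \<phi> (fst z)) (snd z)) \<in> borel_measurable lborel_marked"
      using measurable_pulled by (simp add: case_prod_unfold)
    have "(\<lambda>z. ennreal (l (inv \<phi> (fst z)) (snd z) / snd z) * indicator A z) \<in> borel_measurable lborel_marked"
      by measurable
    then show ?thesis by (simp add: F_def case_prod_unfold)
  qed
  have mm: "move \<in> measurable (intensity l) lborel_marked"
    using measurable_move by (simp add: measurable_cong_sets[OF sets_intensity refl])
  have Fmove: "(\<lambda>(x, s). F (\<phi> x) s) \<in> borel_measurable lborel_marked"
    using measurable_compose[OF measurable_move Fm] by (simp add: case_prod_unfold)
  have "emeasure (distr (intensity l) lborel_marked move) A = (\<integral>\<^sup>+z. indicator A (move z) \<partial>intensity l)"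
    using nn_integral_distr[OF mm, of "indicator A"] by simp
  also have "\<dots> = (\<integral>\<^sup>+z. (case z of (x, s) \<Rightarrow> F (\<phi> x) s) \<partial>lborel_marked)"
  proof -
    have "(\<lambda>z. indicator A (move z)) \<in> borel_measurable (lborel_marked :: ((real^'n) \<times> real) measure)"
      by (rule measurable_compose[OF measurable_move]) simp
    then have "(\<integral>\<^sup>+z. indicator A (move z) \<partial>intensity l) =
        (\<integral>\<^sup>+z. (case z of (x, s) \<Rightarrow> ennreal (l x s / s)) * indicator A (move z) \<partial>lborel_marked)"
      unfolding intensity_def by (rule nn_integral_density[OF measurable_density])
    also have "\<dots> = (\<integral>\<^sup>+z. (case z of (x, s) \<Rightarrow> F (\<phi> x) s) \<partial>lborel_marked)"
      using Diff0_bij[OF \<phi>] by (intro nn_integral_cong) (auto simp: F_def bij_is_inj)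
    finally show ?thesis .
  qed
  also have "\<dots> = (\<integral>\<^sup>+s. (\<integral>\<^sup>+x. F (\<phi> x) s \<partial>lborel) \<partial>restrict_space lborel {0<..})"
    using L.nn_integral_snd[of "\<lambda>(x, s). F (\<phi> x) s"] Fmove by (simp add: lborel_marked_def)
  also have "\<dots> = (\<integral>\<^sup>+s. (\<integral>\<^sup>+y. ennreal (Jac \<phi> y) * F y s \<partial>lborel) \<partial>restrict_space lborel {0<..})"
  proof (rule nn_integral_cong)
    fix s assume s: "s \<in> space (restrict_space lborel {0 :: real <..})"
    have Fs: "(\<lambda>y. F y s) \<in> borel_measurable borel"
      using measurable_Pair_compose_split[OF Fm[unfolded lborel_marked_def] measurable_ident measurable_const[OF s]]
      by simp
    have "(\<integral>\<^sup>+x. F (\<phi> x) s \<partial>lborel) = (\<integral>\<^sup>+y. F y s \<partial>distr lborel borel \<phi>)"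
      using Diff0_measurable[OF \<phi>] Fs by (subst nn_integral_distr) auto
    also have "\<dots> = (\<integral>\<^sup>+y. ennreal (Jac \<phi> y) * F y s \<partial>lborel)"
      unfolding distr_lborel_Diff0[OF \<phi>] using borel_measurable_Jac[OF \<phi>] Fs
      by (subst nn_integral_density) auto
    finally show "(\<integral>\<^sup>+x. F (\<phi> x) s \<partial>lborel) = (\<integral>\<^sup>+y. ennreal (Jac \<phi> y) * F y s \<partial>lborel)" .
  qed
  also have "\<dots> = (\<integral>\<^sup>+z. (case z of (y, s) \<Rightarrow> ennreal (Jac \<phi> y) * F y s) \<partial>lborel_marked)"
  proof -
    have [measurable]: "(\<lambda>z. F (fst z) (snd z)) \<in> borel_measurable lborel_marked"
      using Fm by (simp add: case_prod_unfold)
    have [measurable]: "(\<lambda>z. Jac \<phi> (fst z)) \<in> borel_measurable (lborel_marked :: ((real^'n) \<times> real) measure)"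
      by (rule measurable_compose[OF fst_measurable_marked borel_measurable_Jac[OF \<phi>]])
    have "(\<lambda>z. ennreal (Jac \<phi> (fst z)) * F (fst z) (snd z)) \<in> borel_measurable lborel_marked" by measurable
    then show ?thesis
      using L.nn_integral_snd[of "\<lambda>(y, s). ennreal (Jac \<phi> y) * F y s"] by (simp add: lborel_marked_def case_prod_unfold)
  qed
  also have "\<dots> = (\<integral>\<^sup>+z. (case z of (x, s) \<Rightarrow> ennreal (moved_density \<phi> l x s / s)) * indicator A z \<partial>lborel_marked)"
  proof (intro nn_integral_cong)
    fix z :: "(real^'n) \<times> real" assume "z \<in> space lborel_marked"
    then obtain y s where z: "z = (y, s)" "s > 0" by (auto simp: space_lborel_marked)
    have "ennreal (Jac \<phi> y) * ennreal (l (inv \<phi> y) s / s) = ennreal (moved_density \<phi> l y s / s)"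
      using Jac_pos[OF \<phi>, of y] l_pos[OF z(2), of "inv \<phi> y"] z(2)
      by (subst ennreal_mult[symmetric]) (auto simp: moved_density_def mult.commute)
    then show "(case z of (y, s) \<Rightarrow> ennreal (Jac \<phi> y) * F y s) =
        (case z of (x, s) \<Rightarrow> ennreal (moved_density \<phi> l x s / s)) * indicator A z"
      by (simp add: z F_def mult.assoc[symmetric])
  qed
  also have "\<dots> = emeasure (intensity (moved_density \<phi> l)) A"
    unfolding intensity_def by (rule emeasure_density[OF dm A, symmetric])
  finally show "emeasure (distr (intensity l) lborel_marked move) A = emeasure (intensity (moved_density \<phi> l)) A" .
qed

text \<open>
  A diffeomorphism maps bounded sets into bounded sets, and the weights \<open>s\<close> stay the same.
\<close>

lemma moved_locally_finite: "locally_finite_intensity (intensity (moved_density \<phi> l))"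
  unfolding locally_finite_intensity_def
proof (intro conjI allI)
  show "sets (intensity (moved_density \<phi> l)) = sets lborel_marked" by (simp add: intensity_def)
  fix R :: nat
  have "compact (inv \<phi> ` cball 0 (real R))"
    by (rule compact_continuous_image) (use Diff0_continuous[OF Diff0_inv[OF \<phi>]] continuous_on_subset in auto)
  then obtain r where r: "\<And>y. y \<in> inv \<phi> ` cball 0 (real R) \<Longrightarrow> norm y \<le> r"
    using compact_imp_bounded by (force simp: bounded_iff)
  obtain R' :: nat where R': "r \<le> real R'" using real_arch_simple by blast
  have sub: "norm x \<le> real R'" if "norm (\<phi> x) \<le> real R" for x
  proof -
    have "inv \<phi> (\<phi> x) = x" using Diff0_bij[OF \<phi>] by (simp add: bij_is_inj)
    then have "x \<in> inv \<phi> ` cball 0 (real R)" using that by (metis image_eqI mem_cball_0)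
    then show ?thesis using r R' by force
  qed
  let ?h = "\<lambda>(x :: real^'n, s). ennreal (min s 1) * indicator (cball 0 (real R)) x"
  have hm: "?h \<in> borel_measurable lborel_marked" by (rule measurable_truncated_mass)
  have mm: "move \<in> measurable (intensity l) lborel_marked"
    using measurable_move by (simp add: measurable_cong_sets[OF sets_intensity refl])
  have "(\<integral>\<^sup>+z. ?h z \<partial>intensity (moved_density \<phi> l)) = (\<integral>\<^sup>+z. ?h (move z) \<partial>intensity l)"
    unfolding distr_intensity[symmetric] by (rule nn_integral_distr[OF mm]) (use hm in simp)
  also have "\<dots> \<le> (\<integral>\<^sup>+(x, s). ennreal (min s 1) * indicator (cball 0 (real R')) x \<partial>intensity l)"
    using sub by (intro nn_integral_mono) (auto simp: indicator_def)
  also have "\<dots> < \<infinity>" using l_locally_finite by (simp add: locally_finite_intensity_def)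
  finally show "(\<integral>\<^sup>+(x, s). ennreal (min s 1) * indicator (cball 0 (real R)) x \<partial>intensity (moved_density \<phi> l)) < \<infinity>" .
qed

text \<open>
  The density of the moved intensity with respect to the original one.
\<close>

definition ratio :: "(real^'n) \<times> real \<Rightarrow> real" where
  "ratio = (\<lambda>(x, s). l (inv \<phi> x) s / l x s * Jac \<phi> x)"

lemma measurable_ratio: "ratio \<in> borel_measurable (intensity l)"
proof -
  have [measurable]: "(\<lambda>z. l (inv \<phi> (fst z)) (snd z)) \<in> borel_measurable lborel_marked"
    "(\<lambda>z. l (fst z) (snd z)) \<in> borel_measurable lborel_marked"
    using measurable_pulled l_measurable by (simp_all add: case_prod_unfold)
  have [measurable]: "(\<lambda>z. Jac \<phi> (fst z)) \<in> borel_measurable (lborel_marked :: ((real^'n) \<times> real) measure)"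
    by (rule measurable_compose[OF fst_measurable_marked borel_measurable_Jac[OF \<phi>]])
  have "ratio \<in> borel_measurable lborel_marked" unfolding ratio_def case_prod_unfold by measurable
  then show ?thesis by (simp add: measurable_cong_sets[OF sets_intensity refl])
qed

lemma ratio_pos: "z \<in> space (intensity l) \<Longrightarrow> 0 < ratio z"
  using l_pos Jac_pos[OF \<phi>] by (auto simp: ratio_def space_intensity)

lemma density_ratio: "density (intensity l) (\<lambda>z. ennreal (ratio z)) = intensity (moved_density \<phi> l)"
proof -
  have rm: "(\<lambda>z. ennreal (ratio z)) \<in> borel_measurable lborel_marked"
    using measurable_ratio by (simp add: measurable_cong_sets[OF sets_intensity refl])
  note dm = measurable_intensity_density[OF measurable_moved_density]
  have "density (intensity l) (\<lambda>z. ennreal (ratio z)) =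
      density lborel_marked (\<lambda>z. (case z of (x, s) \<Rightarrow> ennreal (l x s / s)) * ennreal (ratio z))"
    unfolding intensity_def by (rule density_density_eq[OF measurable_density rm])
  also have "\<dots> = intensity (moved_density \<phi> l)"
    unfolding intensity_def
  proof (rule density_cong)
    show "(\<lambda>z. (case z of (x, s) \<Rightarrow> ennreal (l x s / s)) * ennreal (ratio z)) \<in> borel_measurable lborel_marked"
      by (intro borel_measurable_times_ennreal measurable_density rm)
    show "AE z in lborel_marked. (case z of (x, s) \<Rightarrow> ennreal (l x s / s)) * ennreal (ratio z) =
        (case z of (x, s) \<Rightarrow> ennreal (moved_density \<phi> l x s / s))"
    proof (rule AE_I2)
      fix z :: "(real^'n) \<times> real" assume "z \<in> space lborel_marked"
      then obtain x s where z: "z = (x, s)" "s > 0" by (auto simp: space_lborel_marked)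
      have "ennreal (l x s / s) * ennreal (ratio (x, s)) = ennreal (l x s / s * ratio (x, s))"
        using l_pos[OF z(2), of x] z(2) by (subst ennreal_mult') auto
      also have "l x s / s * ratio (x, s) = moved_density \<phi> l x s / s"
        using l_pos[OF z(2), of x] by (simp add: ratio_def moved_density_def)
      finally show "(case z of (x, s) \<Rightarrow> ennreal (l x s / s)) * ennreal (ratio z) =
        (case z of (x, s) \<Rightarrow> ennreal (moved_density \<phi> l x s / s))" by (simp add: z)
    qed
  qed (rule dm)
  finally show ?thesis .
qed

lemma hellinger_eq:
  "(\<integral>\<^sup>+z. ennreal ((sqrt (ratio z) - 1)\<^sup>2) \<partial>intensity l) =
     (\<integral>\<^sup>+(x, s). ennreal ((sqrt (l (inv \<phi> x) s / l x s * Jac \<phi> x) - 1)\<^sup>2 * (l x s / s)) \<partial>lborel_marked)"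
proof -
  have rm: "ratio \<in> borel_measurable lborel_marked"
    using measurable_ratio by (simp add: measurable_cong_sets[OF sets_intensity refl])
  have "(\<integral>\<^sup>+z. ennreal ((sqrt (ratio z) - 1)\<^sup>2) \<partial>intensity l) =
      (\<integral>\<^sup>+z. (case z of (x, s) \<Rightarrow> ennreal (l x s / s)) * ennreal ((sqrt (ratio z) - 1)\<^sup>2) \<partial>lborel_marked)"
  proof -
    have "(\<lambda>z. ennreal ((sqrt (ratio z) - 1)\<^sup>2)) \<in> borel_measurable lborel_marked"
      using rm by measurable
    then show ?thesis unfolding intensity_def by (rule nn_integral_density[OF measurable_density])
  qed
  also have "\<dots> = (\<integral>\<^sup>+(x, s). ennreal ((sqrt (l (inv \<phi> x) s / l x s * Jac \<phi> x) - 1)\<^sup>2 * (l x s / s)) \<partial>lborel_marked)"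
  proof (intro nn_integral_cong)
    fix z :: "(real^'n) \<times> real" assume "z \<in> space lborel_marked"
    then obtain x s where z: "z = (x, s)" "s > 0" by (auto simp: space_lborel_marked)
    have "ennreal (l x s / s) * ennreal ((sqrt (ratio z) - 1)\<^sup>2) = ennreal (l x s / s * (sqrt (ratio z) - 1)\<^sup>2)"
      by (rule ennreal_mult'[symmetric]) (use l_pos[OF z(2), of x] z(2) in simp)
    also have "l x s / s * (sqrt (ratio z) - 1)\<^sup>2 =
        (sqrt (l (inv \<phi> x) s / l x s * Jac \<phi> x) - 1)\<^sup>2 * (l x s / s)"
      by (simp add: z ratio_def)
    finally show "(case z of (x, s) \<Rightarrow> ennreal (l x s / s)) * ennreal ((sqrt (ratio z) - 1)\<^sup>2) =
      (case z of (x, s) \<Rightarrow> ennreal ((sqrt (l (inv \<phi> x) s / l x s * Jac \<phi> x) - 1)\<^sup>2 * (l x s / s)))"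
      by (simp add: z)
  qed
  finally show ?thesis .
qed

lemma hellinger_symmetric_form:
  "(\<integral>\<^sup>+(x, s). ennreal ((sqrt (l (inv \<phi> x) s / l x s * Jac \<phi> x) - 1)\<^sup>2 * (l x s / s)) \<partial>lborel_marked)
    = (\<integral>\<^sup>+(x, s). ennreal ((sqrt (l (inv \<phi> x) s * Jac \<phi> x) - sqrt (l x s))\<^sup>2 * (1 / s)) \<partial>lborel_marked)"
proof (intro nn_integral_cong)
  fix z :: "(real^'n) \<times> real" assume "z \<in> space lborel_marked"
  then obtain x s where z: "z = (x, s)" "s > 0" by (auto simp: space_lborel_marked)
  have l: "l x s > 0" by (rule l_pos[OF z(2)])
  let ?p = "l (inv \<phi> x) s * Jac \<phi> x"
  have "sqrt (l (inv \<phi> x) s / l x s * Jac \<phi> x) = sqrt ?p / sqrt (l x s)"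
    by (simp add: real_sqrt_divide[symmetric])
  then have "(sqrt (l (inv \<phi> x) s / l x s * Jac \<phi> x) - 1) * sqrt (l x s) = sqrt ?p - sqrt (l x s)"
    using l by (simp add: field_simps)
  then have "(sqrt (l (inv \<phi> x) s / l x s * Jac \<phi> x) - 1)\<^sup>2 * (sqrt (l x s))\<^sup>2 = (sqrt ?p - sqrt (l x s))\<^sup>2"
    by (simp only: power_mult_distrib[symmetric])
  then have "(sqrt (l (inv \<phi> x) s / l x s * Jac \<phi> x) - 1)\<^sup>2 * l x s = (sqrt ?p - sqrt (l x s))\<^sup>2"
    using l by simp
  then show "(case z of (x, s) \<Rightarrow> ennreal ((sqrt (l (inv \<phi> x) s / l x s * Jac \<phi> x) - 1)\<^sup>2 * (l x s / s))) =
     (case z of (x, s) \<Rightarrow> ennreal ((sqrt (l (inv \<phi> x) s * Jac \<phi> x) - sqrt (l x s))\<^sup>2 * (1 / s)))"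
    by (simp add: z)
qed

text \<open>
  Moving the measure amounts to composing the test function with \<open>\<phi>\<close>, both in the Fourier transform and
  in its exponent.
\<close>

lemma crm_moved:
  assumes \<mu>: "completely_random_measure (intensity l) \<mu>"
  shows "completely_random_measure (intensity (moved_density \<phi> l)) (distr \<mu> discrete_radon_space (act \<phi>))"
  unfolding completely_random_measure_def
proof (intro conjI ballI)
  interpret prob_space \<mu> using \<mu> by (simp add: completely_random_measure_def)
  have s\<mu>: "sets \<mu> = sets discrete_radon_space" using \<mu> by (simp add: completely_random_measure_def)
  have am: "act \<phi> \<in> measurable \<mu> discrete_radon_space"
    using measurable_act[OF \<phi>] by (simp add: measurable_cong_sets[OF s\<mu> refl])
  show "prob_space (distr \<mu> discrete_radon_space (act \<phi>))" by (rule prob_space_distr[OF am])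
  fix f :: "real^'n \<Rightarrow> real" assume f: "f \<in> C_c"
  have Gm: "(\<lambda>\<eta>. exp (\<i> * complex_of_real (\<integral>x. f x \<partial>\<eta>))) \<in> borel_measurable discrete_radon_space"
    using measurable_integral_discrete_radon_space[OF f] by measurable
  have rad: "\<eta> \<in> radon_measures" if "\<eta> \<in> space \<mu>" for \<eta>
    using that sets_eq_imp_space_eq[OF s\<mu>] by (simp add: space_discrete_radon_space discrete_imp_radon)
  have "(\<integral>\<eta>. exp (\<i> * complex_of_real (\<integral>x. f x \<partial>\<eta>)) \<partial>distr \<mu> discrete_radon_space (act \<phi>)) =
      (\<integral>\<eta>. exp (\<i> * complex_of_real (\<integral>x. f x \<partial>act \<phi> \<eta>)) \<partial>\<mu>)"
    by (rule integral_distr[OF am Gm])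
  also have "\<dots> = (\<integral>\<eta>. exp (\<i> * complex_of_real (\<integral>x. f (\<phi> x) \<partial>\<eta>)) \<partial>\<mu>)"
    by (intro Bochner_Integration.integral_cong refl) (simp add: integral_act[OF \<phi> rad f])
  also have "\<dots> = exp (\<integral>(x, s). (exp (\<i> * complex_of_real (s * f (\<phi> x))) - 1) \<partial>intensity l)"
    using \<mu> C_c_compose_Diff0[OF f \<phi>] by (simp add: completely_random_measure_def)
  also have "(\<integral>(x, s). (exp (\<i> * complex_of_real (s * f (\<phi> x))) - 1) \<partial>intensity l) =
      (\<integral>(x, s). (exp (\<i> * complex_of_real (s * f x)) - 1) \<partial>intensity (moved_density \<phi> l))"
  proof -
    have mm: "move \<in> measurable (intensity l) lborel_marked"
      using measurable_move by (simp add: measurable_cong_sets[OF sets_intensity refl])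
    have [measurable]: "(\<lambda>z. f (fst z)) \<in> borel_measurable (lborel_marked :: ((real^'n) \<times> real) measure)"
      by (rule measurable_compose[OF fst_measurable_marked borel_measurable_C_c[OF f]])
    have gm: "(\<lambda>(x, s). exp (\<i> * complex_of_real (s * f x)) - 1) \<in> borel_measurable lborel_marked"
      unfolding case_prod_unfold by measurable
    show ?thesis unfolding distr_intensity[symmetric]
      by (subst integral_distr[OF mm gm]) (simp add: case_prod_unfold)
  qed
  finally show "(\<integral>\<eta>. exp (\<i> * complex_of_real (\<integral>x. f x \<partial>\<eta>)) \<partial>distr \<mu> discrete_radon_space (act \<phi>)) =
      exp (\<integral>(x, s). (exp (\<i> * complex_of_real (s * f x)) - 1) \<partial>intensity (moved_density \<phi> l))" .
qed simp

theorem absolutely_continuous_iff: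
  assumes \<mu>: "completely_random_measure (intensity l) \<mu>"
  shows "absolutely_continuous \<mu> (distr \<mu> discrete_radon_space (act \<phi>)) \<longleftrightarrow>
    (\<integral>\<^sup>+(x, s). ennreal ((sqrt (l (inv \<phi> x) s / l x s * Jac \<phi> x) - 1)\<^sup>2 * (l x s / s)) \<partial>lborel_marked) < \<infinity>"
proof -
  have \<mu>': "completely_random_measure (density (intensity l) (\<lambda>z. ennreal (ratio z))) (distr \<mu> discrete_radon_space (act \<phi>))"
    unfolding density_ratio by (rule crm_moved[OF \<mu>])
  have lf': "locally_finite_intensity (density (intensity l) (\<lambda>z. ennreal (ratio z)))"
    unfolding density_ratio by (rule moved_locally_finite)
  show ?thesis
    unfolding hellinger_eq[symmetric]
    using crm_absolutely_continuous[OF sigma_finite_intensity intensity_nonzero l_locally_finite lf'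
        measurable_ratio less_imp_le[OF ratio_pos] _ \<mu> \<mu>']
      crm_absolutely_continuous_imp_hellinger_finite[OF sigma_finite_intensity intensity_nonzero l_locally_finite lf'
        AE_intensity_fst measurable_ratio ratio_pos \<mu> \<mu>']
    by blast
qed

end

theorem corollary31:
  fixes l :: "real^'n \<Rightarrow> real \<Rightarrow> real"
    and \<mu> :: "(real^'n) measure measure"
  assumes l_measurable:
      "(\<lambda>(x, s). l x s) \<in> borel_measurable (borel \<Otimes>\<^sub>M restrict_space borel {0<..})"
    and l_pos: "\<And>x s. s > 0 \<Longrightarrow> l x s > 0"
    and l_integrable: "\<And>A. A \<in> sets borel \<Longrightarrow> compact (closure A) \<Longrightarrow>
      (\<integral>\<^sup>+(x, s)\<in>A \<times> {0<..}. ennreal (l x s * min (inverse s) 1) \<partial>lborel_marked) < \<infinity>"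
    and \<mu>: "completely_random_measure (intensity l) \<mu>"
  shows "quasi_invariant \<mu> \<longleftrightarrow>
    (\<forall>\<phi>\<in>Diff0.
      (\<integral>\<^sup>+(x, s). ennreal ((sqrt (l (inv \<phi> x) s / l x s * Jac \<phi> x) - 1)\<^sup>2 * (l x s / s)) \<partial>lborel_marked)
        = (\<integral>\<^sup>+(x, s). ennreal ((sqrt (l (inv \<phi> x) s * Jac \<phi> x) - sqrt (l x s))\<^sup>2 * (1 / s)) \<partial>lborel_marked)
      \<and> (\<integral>\<^sup>+(x, s). ennreal ((sqrt (l (inv \<phi> x) s * Jac \<phi> x) - sqrt (l x s))\<^sup>2 * (1 / s)) \<partial>lborel_marked) < \<infinity>)"
proof -
  have lm: "(\<lambda>(x, s). l x s) \<in> borel_measurable lborel_marked"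
    using l_measurable by (simp add: measurable_cong_sets[OF sets_lborel_marked refl])
  note dm = measurable_intensity_density[OF lm]
  have lf: "locally_finite_intensity (intensity l)"
    unfolding locally_finite_intensity_def
  proof (intro conjI allI)
    show "sets (intensity l) = sets lborel_marked" by (simp add: intensity_def)
    fix R :: nat
    let ?C = "cball (0 :: real^'n) (real R)"
    have hm: "(\<lambda>(x, s). ennreal (min s 1) * indicator ?C x) \<in> borel_measurable lborel_marked"
      by (rule measurable_truncated_mass)
    have "(\<integral>\<^sup>+(x, s). ennreal (min s 1) * indicator ?C x \<partial>intensity l) =
        (\<integral>\<^sup>+z. (case z of (x, s) \<Rightarrow> ennreal (l x s / s)) * (case z of (x, s) \<Rightarrow> ennreal (min s 1) * indicator ?C x) \<partial>lborel_marked)"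
      unfolding intensity_def by (rule nn_integral_density[OF dm hm])
    also have "\<dots> = (\<integral>\<^sup>+(x, s)\<in>?C \<times> {0<..}. ennreal (l x s * min (inverse s) 1) \<partial>lborel_marked)"
    proof (intro nn_integral_cong)
      fix z :: "(real^'n) \<times> real" assume "z \<in> space lborel_marked"
      then obtain x s where z: "z = (x, s)" "s > 0" by (auto simp: space_lborel_marked)
      have "l x s / s * min s 1 = l x s * min (inverse s) 1"
        using z(2) by (auto simp: min_def field_simps)
      then have "ennreal (l x s / s) * ennreal (min s 1) = ennreal (l x s * min (inverse s) 1)"
        using l_pos[OF z(2), of x] z(2) by (subst ennreal_mult'[symmetric]) auto
      then show "(case z of (x, s) \<Rightarrow> ennreal (l x s / s)) * (case z of (x, s) \<Rightarrow> ennreal (min s 1) * indicator ?C x) =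
          (case z of (x, s) \<Rightarrow> ennreal (l x s * min (inverse s) 1)) * indicator (?C \<times> {0<..}) z"
        using z(2) by (simp add: z mult.assoc[symmetric] indicator_times)
    qed
    also have "\<dots> < \<infinity>" by (rule l_integrable) auto
    finally show "(\<integral>\<^sup>+(x, s). ennreal (min s 1) * indicator ?C x \<partial>intensity l) < \<infinity>" .
  qed
  have moved: "moved_intensity l \<phi>" if "\<phi> \<in> Diff0" for \<phi>
    by (intro moved_intensity.intro positive_intensity.intro moved_intensity_axioms.intro lm l_pos lf that)
  note iff = moved_intensity.absolutely_continuous_iff[OF moved \<mu>]
  note sym = moved_intensity.hellinger_symmetric_form[OF moved]
  have s\<mu>: "sets \<mu> = sets discrete_radon_space" using \<mu> by (simp add: completely_random_measure_def)
  have am: "act \<phi> \<in> measurable \<mu> discrete_radon_space" if "\<phi> \<in> Diff0" for \<phi>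
    using measurable_act[OF that] by (simp add: measurable_cong_sets[OF s\<mu> refl])
  \<comment> \<open>since \<open>Diff0\<close> is a group, one of the two directions of equivalence gives the other\<close>
  have converse: "absolutely_continuous (distr \<mu> discrete_radon_space (act \<phi>)) \<mu>"
    if ac: "absolutely_continuous \<mu> (distr \<mu> discrete_radon_space (act (inv \<phi>)))" and \<phi>: "\<phi> \<in> Diff0" for \<phi>
    unfolding absolutely_continuous_def
  proof
    fix A assume A: "A \<in> null_sets (distr \<mu> discrete_radon_space (act \<phi>))"
    then have As: "A \<in> sets discrete_radon_space" by auto
    have "act \<phi> -` A \<inter> space \<mu> \<in> null_sets \<mu>"
      using A by (simp add: null_sets_distr_iff[OF am[OF \<phi>]])
    then have "act \<phi> -` A \<inter> space \<mu> \<in> null_sets (distr \<mu> discrete_radon_space (act (inv \<phi>)))"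
      using ac by (auto simp: absolutely_continuous_def)
    then have "act (inv \<phi>) -` (act \<phi> -` A \<inter> space \<mu>) \<inter> space \<mu> \<in> null_sets \<mu>"
      by (simp add: null_sets_distr_iff[OF am[OF Diff0_inv[OF \<phi>]]])
    also have "act (inv \<phi>) -` (act \<phi> -` A \<inter> space \<mu>) \<inter> space \<mu> = A"
      using act_inv[OF \<phi>] act_discrete[OF Diff0_inv[OF \<phi>]] sets.sets_into_space[OF As]
        sets_eq_imp_space_eq[OF s\<mu>]
      by (auto simp: space_discrete_radon_space)
    finally show "A \<in> null_sets \<mu>" .
  qed
  have "quasi_invariant \<mu> \<longleftrightarrow> (\<forall>\<phi>\<in>Diff0. absolutely_continuous \<mu> (distr \<mu> discrete_radon_space (act \<phi>)))"
    using converse Diff0_inv s\<mu> by (auto simp: quasi_invariant_def equivalent_measures_def)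
  then show ?thesis using iff sym by simp
qed

end
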